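(* Let $\mathbf{H}$ be a decidable pseudovariety of groups, i.e. a pseudovariety of groups for which membership of a given finite group in $\mathbf{H}$ is decidable. Then $\mathsf{PL}_{\mathbf{GH}}$ is decidable: there is an algorithm which, given a finite semigroup $S$ and a non-empty subset $X\subseteq S$, decides whether $X$ is $\mathbf{GH}$-pointlike.
   Context: All semigroups are finite. A pseudovariety is a class of finite semigroups closed under subsemigroups, quotients and finite products of its members; a pseudovariety of groups is one all of whose members are groups. For a pseudovariety of groups $\mathbf{H}$, $\mathbf{GH}$ is the pseudovariety of all finite semigroups all of whose subgroups belong to $\mathbf{H}$. A relational morphism $\rho : S \to V$ is given (up to equality of its graph) by a subsemigroup of $S\times V$ (its graph) projecting onto $S$; for $v\in V$, $(v)\rho^{-1}$ is the set of $s\in S$ with $(s,v)$ in the graph. For a pseudovariety $\mathbf{V}$, a non-empty $X\subseteq S$ is $\mathbf{V}$-pointlike if for every relational morphism $\rho:S\to V$ with $V\in\mathbf{V}$ there is $v\in V$ with $X\subseteq (v)\rho^{-1}$. The set of $\mathbf{V}$-pointlike subsets of $S$ is $\mathsf{PL}_{\mathbf{V}}(S)$. *)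

theory Defs
  imports "HOL-Algebra.Group" "HOL-Library.Nat_Bijection"
begin

section \<open>Computability: partial recursive functions\<close>

datatype recf = Zero | Succ | Proj nat | Comp recf "recf list" | PrimRec recf recf | Mu recf

text \<open>\<open>computes p xs y\<close>: the program \<open>p\<close>, started on the arguments \<open>xs\<close>, halts with output \<open>y\<close>.\<close>

inductive computes :: "recf \<Rightarrow> nat list \<Rightarrow> nat \<Rightarrow> bool" where
  zero: "computes Zero xs 0"
| succ: "computes Succ [x] (Suc x)"
| proj: "i < length xs \<Longrightarrow> computes (Proj i) xs (xs ! i)"
| comp: "list_all2 (\<lambda>q y. computes q xs y) qs ys \<Longrightarrow> computes p ys z \<Longrightarrow>
    computes (Comp p qs) xs z"
| prim_0: "computes p xs y \<Longrightarrow> computes (PrimRec p q) (0 # xs) y"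
| prim_Suc: "computes (PrimRec p q) (n # xs) r \<Longrightarrow> computes q (n # r # xs) y \<Longrightarrow>
    computes (PrimRec p q) (Suc n # xs) y"
| mu: "computes p (n # xs) 0 \<Longrightarrow> \<forall>m<n. \<exists>y. computes p (m # xs) (Suc y) \<Longrightarrow>
    computes (Mu p) xs n"

inductive_cases computes_elims:
  "computes Zero xs z" "computes Succ xs z" "computes (Proj i) xs z"
  "computes (Comp p qs) xs z" "computes (PrimRec p q) (0 # xs) z"
  "computes (PrimRec p q) (Suc n # xs) z" "computes (Mu p) xs z"

lemma computes_deterministic: "computes p xs y \<Longrightarrow> computes p xs z \<Longrightarrow> z = y"
proof (induction arbitrary: z rule: computes.induct)
  case (zero xs)
  then show ?case by (rule computes_elims(1))
next
  case (succ x)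
  then show ?case by (rule computes_elims(2)) simp
next
  case (proj i xs)
  from proj.prems show ?case by (rule computes_elims(3))
next
  case (comp xs qs ys p y)
  from comp.prems obtain ys' where
    ys': "list_all2 (\<lambda>q y. computes q xs y) qs ys'" "computes p ys' z"
    by (rule computes_elims(4))
  have "ys' = ys"
    using comp.IH(1) ys'(1) by (auto simp: list_all2_conv_all_nth intro!: nth_equalityI)
  then show ?case using comp.IH(2) ys'(2) by blast
next
  case (prim_0 p xs y q)
  from prim_0.prems have "computes p xs z" by (rule computes_elims(5))
  then show ?case by (rule prim_0.IH)
next
  case (prim_Suc p q n xs r y)
  from prim_Suc.prems obtain r' where
    "computes (PrimRec p q) (n # xs) r'" "computes q (n # r' # xs) z"
    by (rule computes_elims(6))
  then show ?case using prim_Suc.IH by blast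
next
  case (mu p n xs)
  from mu.prems have z: "computes p (z # xs) 0" "\<forall>m<z. \<exists>y. computes p (m # xs) (Suc y)"
    by (auto elim: computes_elims(7))
  show ?case
  proof (cases z n rule: linorder_cases)
    case less
    then obtain y where "\<forall>w. computes p (z # xs) w \<longrightarrow> w = Suc y"
      using mu.IH(2) by blast
    then show ?thesis using z(1) by blast
  next
    case greater
    then obtain y where "computes p (n # xs) (Suc y)" using z(2) by blast
    then show ?thesis using mu.IH(1) by blast
  qed
qed

text \<open>
  Decidability of the property \<open>P\<close> for given instances of a problem: \<open>I\<close> describes the
  admissible instances and \<open>enc\<close> the arguments by which they are presented to the program.
\<close>

definition decidable_on :: "('a \<Rightarrow> bool) \<Rightarrow> ('a \<Rightarrow> nat list) \<Rightarrow> ('a \<Rightarrow> bool) \<Rightarrow> bool" where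
  "decidable_on I enc P \<longleftrightarrow> (\<exists>p. \<forall>x. I x \<longrightarrow> computes p (enc x) (if P x then 1 else 0))"


section \<open>Finite semigroups\<close>

record 'a sgp = "'a partial_object" +
  sg_mult :: "'a \<Rightarrow> 'a \<Rightarrow> 'a"

definition finite_semigroup :: "'a sgp \<Rightarrow> bool" where
  "finite_semigroup S \<longleftrightarrow> finite (carrier S) \<and> carrier S \<noteq> {} \<and>
     (\<forall>x\<in>carrier S. \<forall>y\<in>carrier S. sg_mult S x y \<in> carrier S) \<and>
     (\<forall>x\<in>carrier S. \<forall>y\<in>carrier S. \<forall>z\<in>carrier S.
        sg_mult S (sg_mult S x y) z = sg_mult S x (sg_mult S y z))"

definition subsemigroup :: "'a set \<Rightarrow> 'a sgp \<Rightarrow> bool" where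
  "subsemigroup A S \<longleftrightarrow> A \<noteq> {} \<and> A \<subseteq> carrier S \<and> (\<forall>x\<in>A. \<forall>y\<in>A. sg_mult S x y \<in> A)"

definition restrict_sgp :: "'a sgp \<Rightarrow> 'a set \<Rightarrow> 'a sgp" where
  "restrict_sgp S A = \<lparr>carrier = A, sg_mult = sg_mult S\<rparr>"

definition sgp_hom :: "'a sgp \<Rightarrow> 'b sgp \<Rightarrow> ('a \<Rightarrow> 'b) set" where
  "sgp_hom S T = {h \<in> carrier S \<rightarrow> carrier T.
     \<forall>x\<in>carrier S. \<forall>y\<in>carrier S. h (sg_mult S x y) = sg_mult T (h x) (h y)}"

definition prod_sgp :: "'a sgp \<Rightarrow> 'b sgp \<Rightarrow> ('a \<times> 'b) sgp" where
  "prod_sgp S T = \<lparr>carrier = carrier S \<times> carrier T,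
     sg_mult = (\<lambda>(s, t) (s', t'). (sg_mult S s s', sg_mult T t t'))\<rparr>"

definition Prod_sgp :: "'i set \<Rightarrow> ('i \<Rightarrow> 'a sgp) \<Rightarrow> ('i \<Rightarrow> 'a) sgp" where
  "Prod_sgp I F = \<lparr>carrier = (\<Pi>\<^sub>E i\<in>I. carrier (F i)),
     sg_mult = (\<lambda>x y. \<lambda>i\<in>I. sg_mult (F i) (x i) (y i))\<rparr>"

definition is_group :: "'a sgp \<Rightarrow> bool" where
  "is_group S \<longleftrightarrow> (\<exists>e. group \<lparr>carrier = carrier S, monoid.mult = sg_mult S, one = e\<rparr>)"


section \<open>Pseudovarieties\<close>

text \<open>
  A class of finite semigroups is represented by its members with carrier in \<open>nat\<close>, every finite
  semigroup being isomorphic to such a one. Accordingly, quotients are given as homomorphic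
  images and finite products up to isomorphism, which makes the class invariant under isomorphism.
  The product of the empty family puts the trivial semigroup into every pseudovariety.
\<close>

definition pseudovariety :: "nat sgp set \<Rightarrow> bool" where
  "pseudovariety V \<longleftrightarrow>
     (\<forall>S\<in>V. finite_semigroup S) \<and>
     (\<forall>S\<in>V. \<forall>A. subsemigroup A S \<longrightarrow> restrict_sgp S A \<in> V) \<and>
     (\<forall>S\<in>V. \<forall>T h. finite_semigroup T \<and> h \<in> sgp_hom S T \<and> h ` carrier S = carrier T
        \<longrightarrow> T \<in> V) \<and>
     (\<forall>(n::nat) F P h. (\<forall>i<n. F i \<in> V) \<and> finite_semigroup P \<and>
        h \<in> sgp_hom P (Prod_sgp {..<n} F) \<and>
        bij_betw h (carrier P) (carrier (Prod_sgp {..<n} F)) \<longrightarrow> P \<in> V)"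

definition group_pseudovariety :: "nat sgp set \<Rightarrow> bool" where
  "group_pseudovariety H \<longleftrightarrow> pseudovariety H \<and> (\<forall>G\<in>H. is_group G)"

definition GH :: "nat sgp set \<Rightarrow> nat sgp set" where
  "GH H = {S. finite_semigroup S \<and>
     (\<forall>A. subsemigroup A S \<and> is_group (restrict_sgp S A) \<longrightarrow> restrict_sgp S A \<in> H)}"


section \<open>Pointlike sets\<close>

definition relational_morphism :: "'a sgp \<Rightarrow> 'b sgp \<Rightarrow> ('a \<times> 'b) set \<Rightarrow> bool" where
  "relational_morphism S V \<rho> \<longleftrightarrow> subsemigroup \<rho> (prod_sgp S V) \<and> fst ` \<rho> = carrier S"

definition PL :: "nat sgp set \<Rightarrow> 'a sgp \<Rightarrow> 'a set set" where
  "PL \<V> S = {X. X \<noteq> {} \<and> X \<subseteq> carrier S \<and>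
     (\<forall>V\<in>\<V>. \<forall>\<rho>. relational_morphism S V \<rho> \<longrightarrow>
        (\<exists>v\<in>carrier V. X \<subseteq> {s. (s, v) \<in> \<rho>}))}"


section \<open>Finite semigroups as input of an algorithm\<close>

text \<open>
  A finite semigroup is presented by its multiplication table, the elements being numbered
  from 0; subsets are presented as bit masks.
\<close>

definition table_sgp :: "nat list list \<Rightarrow> nat sgp" where
  "table_sgp T = \<lparr>carrier = {..<length T}, sg_mult = (\<lambda>i j. T ! i ! j)\<rparr>"

definition semigroup_table :: "nat list list \<Rightarrow> bool" where
  "semigroup_table T \<longleftrightarrow>
     (\<forall>r\<in>set T. length r = length T) \<and> finite_semigroup (table_sgp T)"

definition enc_table :: "nat list list \<Rightarrow> nat" where
  "enc_table T = list_encode (map list_encode T)"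

definition decidable_group_membership :: "nat sgp set \<Rightarrow> bool" where
  "decidable_group_membership H \<longleftrightarrow>
     decidable_on (\<lambda>T. semigroup_table T \<and> is_group (table_sgp T))
       (\<lambda>T. [enc_table T])
       (\<lambda>T. table_sgp T \<in> H)"

definition decidable_pointlikes :: "nat sgp set \<Rightarrow> bool" where
  "decidable_pointlikes \<V> \<longleftrightarrow>
     decidable_on (\<lambda>(T, X). semigroup_table T \<and> X \<noteq> {} \<and> X \<subseteq> carrier (table_sgp T))
       (\<lambda>(T, X). [enc_table T, set_encode X])
       (\<lambda>(T, X). X \<in> PL \<V> (table_sgp T))"

end

(*
  X is pointlike for GH H exactly if X lies in every "closed" family C of non-empty subsets of S:
  C contains the singletons, is closed under products and non-empty subsets, and for each group G
  of sets in C there is a homomorphism h from G into a member of H with Union (ker h) in C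
  (the theorem of van Gool and Steinberg). The closed families form a finite, searchable set, so
  this is decidable; only groups of order at most 2^|S| have to be tested for membership in H.

  The pointlike sets form a closed family: a relational morphism from a group G to V in GH H
  restricts to a subgroup of the graph, so G / N lies in H for the fibre N over an idempotent.

  Conversely, let C be closed. Represent C faithfully by a finite set T of relations, under
  composition. By induction on |T| and on the set A of generators one finds V in GH H and f from
  V to T with f v O f w <= f (v O w) such that each a in A is below some f v. If all a in A act
  as permutations on T, then A generates a group and V is its image under h. Otherwise some
  left ideal T a (or right ideal a T) is proper; words are cut into blocks over A - {a} and blocks
  a^n, and the covers for A - {a}, for {a}, and for the block products in T a are merged.
*)
theory Submission
  imports Defs
begin

section \<open>Groups, saturation and lax covers\<close>

text \<open>Saturation is imposed on arbitrary sets of relations, without the singletons and the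
  closure under subsets, because the induction descends to ideals of \<open>T\<close>, which inherit
  saturation but in general neither of these. Relations are convenient since composition respects
  inclusion and distributes over unions, and since \<open>Id\<close> can be adjoined as an identity.
  A cover may be lax: if \<open>f v O f w\<close> is only contained in \<open>f (v O w)\<close>, the
  pairs of an element \<open>s\<close> and a \<open>v\<close> with \<open>s\<close> in the set
  represented by \<open>f v\<close> still form a subsemigroup.

  The obstacle in merging covers is to create no new subgroups. \<open>H\<close> need not be closed
  under extensions, so products of the wreath kind could leave \<open>GH H\<close>. Cutting words
  into blocks keeps each subgroup of the merged semigroup in one of the three semigroups that are
  merged. Consequently the homomorphisms supplied by saturation are used to build a cover in just
  two situations: the powers of one element, and a set of elements that act as permutations.\<close>

definition semigroup_on :: "('a \<Rightarrow> 'a \<Rightarrow> 'a) \<Rightarrow> 'a set \<Rightarrow> bool" where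
  "semigroup_on m C \<longleftrightarrow> (\<forall>x\<in>C. \<forall>y\<in>C. m x y \<in> C) \<and>
     (\<forall>x\<in>C. \<forall>y\<in>C. \<forall>z\<in>C. m (m x y) z = m x (m y z))"

definition group_on :: "('a \<Rightarrow> 'a \<Rightarrow> 'a) \<Rightarrow> 'a set \<Rightarrow> 'a \<Rightarrow> bool" where
  "group_on m G e \<longleftrightarrow> semigroup_on m G \<and> e \<in> G \<and> (\<forall>x\<in>G. m e x = x \<and> m x e = x) \<and>
     (\<forall>x\<in>G. \<exists>y\<in>G. m x y = e \<and> m y x = e)"

definition hom_into :: "nat sgp set \<Rightarrow> ('a \<Rightarrow> 'a \<Rightarrow> 'a) \<Rightarrow> 'a set \<Rightarrow> ('a \<Rightarrow> nat) \<Rightarrow> bool" where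
  "hom_into H m G h \<longleftrightarrow> (\<exists>Q\<in>H. h ` G \<subseteq> carrier Q \<and>
     (\<forall>x\<in>G. \<forall>y\<in>G. h (m x y) = sg_mult Q (h x) (h y)))"

text \<open>Subgroups are compared with members of \<open>H\<close> by injective homomorphisms,
  since \<open>H\<close> has only carriers in \<open>nat\<close> while the semigroups built below
  have other types. For a finite semigroup on \<open>nat\<close> this is membership in
  \<open>GH H\<close>, by \<open>GH_on_iff\<close>.\<close>

definition GH_on :: "nat sgp set \<Rightarrow> ('a \<Rightarrow> 'a \<Rightarrow> 'a) \<Rightarrow> 'a set \<Rightarrow> bool" where
  "GH_on H m V \<longleftrightarrow> finite V \<and> semigroup_on m V \<and>
     (\<forall>G e. G \<subseteq> V \<and> group_on m G e \<longrightarrow> (\<exists>h. hom_into H m G h \<and> inj_on h G))"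

text \<open>The elements are sets so that a kernel has a union. The product \<open>m\<close> stays a
  parameter: it is \<open>setmult\<close> on subsets of a semigroup, and composition on the
  relations that represent them.\<close>

definition saturated :: "nat sgp set \<Rightarrow> ('b set \<Rightarrow> 'b set \<Rightarrow> 'b set) \<Rightarrow> 'b set set \<Rightarrow> bool" where
  "saturated H m C \<longleftrightarrow> (\<forall>x\<in>C. \<forall>y\<in>C. m x y \<in> C) \<and>
     (\<forall>G e. G \<subseteq> C \<and> group_on m G e \<longrightarrow>
        (\<exists>h. hom_into H m G h \<and> \<Union>{g \<in> G. h g = h e} \<in> C))"

text \<open>\<open>Id\<close> is kept out of \<open>V\<close> so that it can serve as a formal identity when covers are merged.\<close>

definition covers :: "nat sgp set \<Rightarrow> 'a rel set \<Rightarrow> 'a rel set \<Rightarrow> bool" where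
  "covers H T A \<longleftrightarrow> (\<exists>(V :: nat rel set) f. GH_on H (O) V \<and> Id \<notin> V \<and> f ` V \<subseteq> T \<and>
     (\<forall>v\<in>V. \<forall>w\<in>V. f v O f w \<subseteq> f (v O w)) \<and> (\<forall>a\<in>A. \<exists>v\<in>V. a \<subseteq> f v))"

lemma group_onD:
  assumes "group_on m G e"
  shows "e \<in> G" "\<And>x y. x \<in> G \<Longrightarrow> y \<in> G \<Longrightarrow> m x y \<in> G"
    "\<And>x. x \<in> G \<Longrightarrow> m e x = x" "\<And>x. x \<in> G \<Longrightarrow> m x e = x"
    "\<And>x. x \<in> G \<Longrightarrow> \<exists>y\<in>G. m x y = e \<and> m y x = e"
    "\<And>x y z. x \<in> G \<Longrightarrow> y \<in> G \<Longrightarrow> z \<in> G \<Longrightarrow> m (m x y) z = m x (m y z)"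
  using assms by (simp_all add: group_on_def semigroup_on_def)

lemma Union_relcomp_subset:
  assumes "\<And>X Y. X \<in> A \<Longrightarrow> Y \<in> B \<Longrightarrow> X O Y \<subseteq> Z"
  shows "\<Union>A O \<Union>B \<subseteq> Z"
  using assms by blast

lemma hom_intoE:
  assumes "hom_into H m G h"
  obtains Q where "Q \<in> H" "h ` G \<subseteq> carrier Q"
    "\<forall>x\<in>G. \<forall>y\<in>G. h (m x y) = sg_mult Q (h x) (h y)"
  using assms unfolding hom_into_def by blast

lemma group_on_image:
  assumes G: "group_on m G e" and j: "\<And>x y. x \<in> G \<Longrightarrow> y \<in> G \<Longrightarrow> j (m x y) = m' (j x) (j y)"
  shows "group_on m' (j ` G) (j e)"
proof -
  note grp = group_onD[OF G]
  have jm: "m' (j x) (j y) = j (m x y)" if "x \<in> G" "y \<in> G" for x y using j that by simp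
  show ?thesis
    unfolding group_on_def semigroup_on_def
  proof (intro conjI ballI)
    fix x' assume "x' \<in> j ` G"
    then obtain x where x: "x \<in> G" "x' = j x" by blast
    then obtain y where "y \<in> G" "m x y = e" "m y x = e" using grp(5) by blast
    then show "\<exists>y\<in>j ` G. m' x' y = j e \<and> m' y x' = j e" using x by (auto simp: jm)
  qed (auto simp: jm grp)
qed

text \<open>The target \<open>W\<close> and the embedding may depend on the subgroup
  \<open>G\<close>. The merged semigroup needs this freedom, since its subgroups sit in different
  parts of it.\<close>

lemma GH_on_embed:
  assumes V: "finite V" "semigroup_on m V"
    and emb: "\<And>G e. G \<subseteq> V \<Longrightarrow> group_on m G e \<Longrightarrow>
      \<exists>(W :: 'b set) m' j. GH_on H m' W \<and> j ` G \<subseteq> W \<and> inj_on j G \<and>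
        (\<forall>x\<in>G. \<forall>y\<in>G. j (m x y) = m' (j x) (j y))"
  shows "GH_on H m V"
  unfolding GH_on_def
proof (intro conjI V allI impI)
  fix G e assume G: "G \<subseteq> V \<and> group_on m G e"
  then obtain W :: "'b set" and m' j where j: "GH_on H m' W" "j ` G \<subseteq> W" "inj_on j G"
    and j4: "\<forall>x\<in>G. \<forall>y\<in>G. j (m x y) = m' (j x) (j y)" using emb[of G e] by auto
  have jm: "m' (j x) (j y) = j (m x y)" if "x \<in> G" "y \<in> G" for x y using j4 that by simp
  have "group_on m' (j ` G) (j e)" using group_on_image[of m G e j m'] G jm by simp
  then obtain h where h: "hom_into H m' (j ` G) h" "inj_on h (j ` G)"
    using j(1,2) unfolding GH_on_def by blast
  have "hom_into H m G (h \<circ> j)"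
    using h(1) unfolding hom_into_def by (auto simp: jm image_comp)
  moreover have "inj_on (h \<circ> j) G" using comp_inj_on[OF j(3) h(2)] .
  ultimately show "\<exists>h. hom_into H m G h \<and> inj_on h G" by blast
qed

text \<open>\<open>covers\<close> fixes the type \<open>nat rel\<close>, so that covers obtained by
  induction can be fed into the next construction; here a cover of any type is converted.
  \<open>V\<close> is replaced by its right regular representation, with \<open>0\<close> as an
  adjoined identity and \<open>Suc (c w)\<close> standing for \<open>w\<close>. The row of
  \<open>0\<close> makes the representation faithful, and no relation in it sends \<open>0\<close>
  to \<open>0\<close>, so \<open>Id\<close> is not among them.\<close>

lemma coversI:
  fixes V :: "'v set"
  assumes V: "GH_on H m V" and fV: "f ` V \<subseteq> T"
    and lax: "\<And>v w. v \<in> V \<Longrightarrow> w \<in> V \<Longrightarrow> f v O f w \<subseteq> f (m v w)"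
    and A: "\<And>a. a \<in> A \<Longrightarrow> \<exists>v\<in>V. a \<subseteq> f v"
  shows "covers H T A"
proof -
  have fin: "finite V" and sg: "semigroup_on m V" using V by (auto simp: GH_on_def)
  have mV: "m v w \<in> V" if "v \<in> V" "w \<in> V" for v w using sg that by (simp add: semigroup_on_def)
  have assoc: "m (m u v) w = m u (m v w)" if "u \<in> V" "v \<in> V" "w \<in> V" for u v w
    using sg that by (simp add: semigroup_on_def)
  obtain c :: "'v \<Rightarrow> nat" where c: "inj_on c V"
    using finite_imp_inj_to_nat_seg[OF fin] by blast
  define r :: "'v \<Rightarrow> nat rel" where
    "r v = insert (0, Suc (c v)) ((\<lambda>w. (Suc (c w), Suc (c (m w v)))) ` V)" for v
  have r0: "(0, k) \<in> r v \<longleftrightarrow> k = Suc (c v)" for k v by (auto simp: r_def)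
  have rS: "(Suc i, k) \<in> r v \<longleftrightarrow> (\<exists>w\<in>V. i = c w \<and> k = Suc (c (m w v)))" for i k v
    by (auto simp: r_def)
  have inj: "inj_on r V"
  proof (rule inj_onI)
    fix v w assume vw: "v \<in> V" "w \<in> V" "r v = r w"
    then have "Suc (c v) = Suc (c w)" using r0 by blast
    then show "v = w" using c vw by (simp add: inj_on_eq_iff)
  qed
  have hom: "r (m v w) = r v O r w" if vw: "v \<in> V" "w \<in> V" for v w
  proof -
    have "((i, k) \<in> r (m v w)) = ((i, k) \<in> r v O r w)" for i k
    proof (cases i)
      case 0
      have "((0, k) \<in> r v O r w) = ((Suc (c v), k) \<in> r w)" by (auto simp: relcomp_unfold r0)
      also have "\<dots> = (k = Suc (c (m v w)))"
        using vw c by (auto simp: rS inj_on_eq_iff)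
      finally show ?thesis using 0 r0 by simp
    next
      case (Suc i')
      show ?thesis
      proof
        assume "(i, k) \<in> r (m v w)"
        then obtain u where u: "u \<in> V" "i' = c u" "k = Suc (c (m u (m v w)))" using Suc rS by auto
        have "(i, Suc (c (m u v))) \<in> r v" unfolding Suc rS using u by blast
        moreover have "(Suc (c (m u v)), k) \<in> r w"
          unfolding rS using u vw by (intro bexI[of _ "m u v"]) (simp_all add: mV assoc)
        ultimately show "(i, k) \<in> r v O r w" by blast
      next
        assume "(i, k) \<in> r v O r w"
        then obtain l where l: "(i, l) \<in> r v" "(l, k) \<in> r w" by blast
        then obtain u where u: "u \<in> V" "i' = c u" "l = Suc (c (m u v))" using Suc rS by auto
        moreover have muv: "m u v \<in> V" using mV u(1) vw(1) .
        ultimately have "k = Suc (c (m (m u v) w))" using l(2) c by (auto simp: rS inj_on_eq_iff)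
        then show "(i, k) \<in> r (m v w)"
          unfolding Suc rS using u vw by (intro bexI[of _ u]) (simp_all add: assoc)
      qed
    qed
    then show ?thesis by (auto simp: set_eq_iff)
  qed
  let ?i = "inv_into V r"
  have inv: "?i (r v) = v" if "v \<in> V" for v using inj that by simp
  have "GH_on H (O) (r ` V)"
  proof (rule GH_on_embed)
    show "finite (r ` V)" using fin by simp
    show "semigroup_on (O) (r ` V)"
      unfolding semigroup_on_def using mV by (auto simp: O_assoc simp flip: hom)
    fix G e assume "G \<subseteq> r ` V" "group_on (O) G e"
    moreover have "?i ` G \<subseteq> V" using \<open>G \<subseteq> r ` V\<close> inv by auto
    moreover have "inj_on ?i G" using \<open>G \<subseteq> r ` V\<close> by (simp add: inj_on_inv_into)
    moreover have "\<forall>x\<in>G. \<forall>y\<in>G. ?i (x O y) = m (?i x) (?i y)"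
    proof (intro ballI)
      fix x y assume "x \<in> G" "y \<in> G"
      then obtain v w where "x = r v" "v \<in> V" "y = r w" "w \<in> V" using \<open>G \<subseteq> r ` V\<close> by blast
      then show "?i (x O y) = m (?i x) (?i y)" using inv mV by (simp flip: hom)
    qed
    ultimately show "\<exists>(W :: 'v set) m' j. GH_on H m' W \<and> j ` G \<subseteq> W \<and> inj_on j G \<and>
        (\<forall>x\<in>G. \<forall>y\<in>G. j (x O y) = m' (j x) (j y))" using V by blast
  qed
  moreover have "Id \<notin> r ` V"
  proof
    assume "Id \<in> r ` V"
    then obtain v where v: "Id = r v" by (rule imageE)
    have "((0::nat), 0) \<in> Id" by simp
    then show False unfolding v r0 by simp
  qed
  moreover have "(f \<circ> ?i) ` r ` V \<subseteq> T" using fV inv by auto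
  moreover have "\<forall>v\<in>r ` V. \<forall>w\<in>r ` V. (f \<circ> ?i) v O (f \<circ> ?i) w \<subseteq> (f \<circ> ?i) (v O w)"
    using lax mV inv by (simp flip: hom)
  moreover have "\<exists>v\<in>r ` V. a \<subseteq> (f \<circ> ?i) v" if a: "a \<in> A" for a
  proof -
    obtain v where "v \<in> V" "a \<subseteq> f v" using A[OF a] by blast
    then show ?thesis using inv by (intro bexI[of _ "r v"]) auto
  qed
  then have "\<forall>a\<in>A. \<exists>v\<in>r ` V. a \<subseteq> (f \<circ> ?i) v" by (rule ballI)
  ultimately show ?thesis
    unfolding covers_def by (intro exI[of _ "r ` V"] exI[of _ "f \<circ> ?i"] conjI)
qed

text \<open>Composition distributes over unions, so the union of a class of \<open>h\<close> is a
  translate of the union of the kernel. For \<open>G\<close> inside a saturated set, the unions of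
  all classes lie there as soon as the union of the kernel does.\<close>

lemma hom_coset:
  fixes G :: "'a rel set"
  assumes G: "group_on (O) G e" and h: "hom_into H (O) G h" and g: "g \<in> G"
  shows "\<Union>{x \<in> G. h x = h g} = g O \<Union>{x \<in> G. h x = h e}"
proof -
  from h obtain Q where "Q \<in> H" "h ` G \<subseteq> carrier Q"
    and Q0: "\<forall>x\<in>G. \<forall>y\<in>G. h (x O y) = sg_mult Q (h x) (h y)"
    by (rule hom_intoE)
  note Q = Q0[rule_format]
  obtain g' where g': "g' \<in> G" "g O g' = e" "g' O g = e" using group_onD(5)[OF G g] by blast
  have e: "e \<in> G" "\<And>x. x \<in> G \<Longrightarrow> e O x = x \<and> x O e = x" using group_onD[OF G] by simp_all
  have cl: "x O y \<in> G" if "x \<in> G" "y \<in> G" for x y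
    using group_onD(2)[OF G that] .
  have "{x \<in> G. h x = h g} = (O) g ` {x \<in> G. h x = h e}"
  proof (intro equalityI subsetI)
    fix x assume x: "x \<in> {x \<in> G. h x = h g}"
    then have "h (g' O x) = sg_mult Q (h g') (h g)" using Q[OF g'(1), of x] by simp
    then have "h (g' O x) = h e" using Q[OF g'(1) g] g'(3) by simp
    then have "g' O x \<in> {x \<in> G. h x = h e}" using g' cl x by simp
    moreover have "x = g O (g' O x)" using x g' e by (simp flip: O_assoc)
    ultimately show "x \<in> (O) g ` {x \<in> G. h x = h e}" by blast
  next
    fix x assume "x \<in> (O) g ` {x \<in> G. h x = h e}"
    then obtain y where y: "y \<in> G" "h y = h e" "x = g O y" by blast
    then have "h x = sg_mult Q (h g) (h e)" using Q[OF g y(1)] by simp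
    then have "h x = h (g O e)" using Q[OF g e(1)] by simp
    then show "x \<in> {x \<in> G. h x = h g}" using y g cl e by simp
  qed
  then show ?thesis by (auto simp: relcomp_UNION_distrib)
qed

section \<open>Covers for a single element and for elements acting as permutations\<close>

lemma idempotent_power:
  fixes a :: "'a rel"
  assumes T: "finite T" "a \<in> T" "\<And>x y. x \<in> T \<Longrightarrow> y \<in> T \<Longrightarrow> x O y \<in> T"
  obtains k where "k > 0" "a ^^ (k + k) = a ^^ k"
proof -
  have pT: "a ^^ Suc n \<in> T" for n by (induction n) (use T in auto)
  have "\<not> inj (\<lambda>n. a ^^ Suc n)"
    using T(1) pT by (meson finite_imageD finite_subset image_subset_iff infinite_UNIV_nat)
  then obtain i j where ij: "a ^^ Suc i = a ^^ Suc j" "i < j"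
    unfolding inj_def by (metis linorder_neqE_nat)
  define p where "p = j - i"
  have step: "a ^^ (n + p) = a ^^ n" if n: "n \<ge> Suc i" for n
  proof -
    obtain r where r: "n = Suc i + r" using le_Suc_ex[OF n] by blast
    have "a ^^ (Suc j + r) = a ^^ (Suc i + r)" using ij(1) by (simp only: relpow_add)
    moreover have "Suc j + r = n + p" using r ij p_def by simp
    ultimately show ?thesis using r by metis
  qed
  have step': "a ^^ (n + q * p) = a ^^ n" if "n \<ge> Suc i" for n q
  proof (induction q)
    case (Suc q)
    have "a ^^ (n + Suc q * p) = a ^^ ((n + q * p) + p)" by (simp add: algebra_simps)
    then show ?case using step[of "n + q * p"] that Suc by simp
  qed simp
  \<comment> \<open>\<open>Suc i * p\<close> is a multiple of the period that has reached the
    periodic part, so adding it once more to this exponent changes nothing.\<close>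
  have "p > 0" using ij p_def by simp
  then have "Suc i * p \<ge> Suc i" by (metis Suc_leI mult_le_mono2 mult.right_neutral One_nat_def)
  then show ?thesis using that[of "Suc i * p"] step'[of "Suc i * p" "Suc i"] \<open>p > 0\<close> by simp
qed

lemma relpow_in:
  assumes "a \<in> T" "\<And>x y. x \<in> T \<Longrightarrow> y \<in> T \<Longrightarrow> x O y \<in> T" "n > 0"
  shows "a ^^ n \<in> T"
proof -
  have "a ^^ Suc n \<in> T" for n by (induction n) (use assms in auto)
  then show ?thesis using assms(3) by (metis gr0_implies_Suc)
qed

text \<open>The cover records an exponent \<open>n\<close> in two ways: exactly as long as
  \<open>n\<close> is below \<open>k\<close>, and through the class under \<open>h\<close> of a
  power in the group \<open>G\<close>. The shift by \<open>k\<close> in the second component moves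
  small exponents into the periodic part as well; \<open>a ^^ k\<close> is the identity of
  \<open>G\<close>, so the shift respects products. For \<open>n < k\<close> the fibre of
  \<open>\<psi>\<close> is a single power, otherwise the powers in it form a class of
  \<open>h\<close>.\<close>

lemma covers_monogenic:
  fixes T :: "'a rel set"
  assumes fin: "finite T" and sat: "saturated H (O) T" and a: "a \<in> T"
  shows "covers H T {a}"
proof -
  have cl: "x O y \<in> T" if "x \<in> T" "y \<in> T" for x y using sat that by (simp add: saturated_def)
  obtain k where k: "k > 0" "a ^^ (k + k) = a ^^ k" using idempotent_power[OF fin a cl] by blast
  have k2: "a ^^ (n + k) = a ^^ n" if n: "n \<ge> k" for n
  proof -
    obtain r where "n = k + r" using le_Suc_ex[OF n] by blast
    then have "a ^^ (n + k) = a ^^ (k + k) O a ^^ r" by (simp flip: relpow_add add: ac_simps)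
    then show ?thesis using k(2) \<open>n = k + r\<close> by (simp flip: relpow_add)
  qed
  have kmul: "a ^^ (Suc q * k) = a ^^ k" for q
  proof (induction q)
    case (Suc q)
    have "a ^^ (Suc (Suc q) * k) = a ^^ (Suc q * k + k)" by (simp add: algebra_simps)
    then show ?case using k2[of "Suc q * k"] Suc by simp
  qed simp
  define G where "G = (\<lambda>n. a ^^ n) ` {k..}"
  have G: "group_on (O) G (a ^^ k)"
    unfolding group_on_def semigroup_on_def
  proof (intro conjI ballI)
    show "x O y \<in> G" if "x \<in> G" "y \<in> G" for x y
      using that unfolding G_def by (auto simp flip: relpow_add)
    show "(x O y) O z = x O (y O z)" for x y z :: "'a rel" by (rule O_assoc)
    show "a ^^ k \<in> G" unfolding G_def by simp
    fix x assume "x \<in> G"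
    then obtain n where n: "n \<ge> k" "x = a ^^ n" unfolding G_def by auto
    show "a ^^ k O x = x" "x O a ^^ k = x"
      using k2[OF n(1)] n(2) by (simp_all flip: relpow_add add: add.commute)
    have "n > 0" using n k by simp
    \<comment> \<open>The inverse exponent: \<open>n + l\<close> is \<open>2 * n * k\<close>, a
      positive multiple of \<open>k\<close>, and \<open>l\<close> is at least \<open>n\<close>, so
      it lies in the range that defines \<open>G\<close>.\<close>
    define l where "l = n * (2 * k - 1)"
    have nl: "n + l = Suc (2 * n - 1) * k"
    proof -
      have "n + l = n * Suc (2 * k - 1)" by (simp add: l_def)
      also have "\<dots> = n * (2 * k)" using k by simp
      finally show ?thesis using \<open>n > 0\<close> by simp
    qed
    have "2 * k - 1 \<ge> 1" using k by simp
    then have "l \<ge> n" unfolding l_def by (metis mult_le_mono2 mult.right_neutral)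
    then have "a ^^ l \<in> G" using n unfolding G_def by simp
    moreover have "x O a ^^ l = a ^^ k" "a ^^ l O x = a ^^ k"
      using kmul nl n(2) by (simp_all flip: relpow_add add: add.commute)
    ultimately show "\<exists>y\<in>G. x O y = a ^^ k \<and> y O x = a ^^ k" by blast
  qed
  have GT: "G \<subseteq> T" unfolding G_def using relpow_in[OF a cl] k(1) by auto
  then obtain h where h: "hom_into H (O) G h" and U: "\<Union>{g \<in> G. h g = h (a ^^ k)} \<in> T"
    using sat G unfolding saturated_def by blast
  from h obtain Q where Q0: "Q \<in> H" "h ` G \<subseteq> carrier Q"
    "\<forall>x\<in>G. \<forall>y\<in>G. h (x O y) = sg_mult Q (h x) (h y)"
    by (rule hom_intoE)
  note Q = Q0(1,2) Q0(3)[rule_format]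
  define \<psi> where "\<psi> n = (min n k, h (a ^^ (n + k)))" for n
  define m where "m = (\<lambda>(i, q) (j, r). (min (i + j) k, sg_mult Q q r))"
  define V where "V = \<psi> ` {0<..}"
  define f where "f v = \<Union>{a ^^ n |n. n > 0 \<and> \<psi> n = v}" for v
  have inG: "a ^^ (n + k) \<in> G" for n unfolding G_def by simp
  have m\<psi>: "m (\<psi> i) (\<psi> j) = \<psi> (i + j)" for i j
  proof -
    have "a ^^ (i + j + k) = a ^^ ((i + k) + (j + k))"
      using k2[of "i + j + k"] by (simp add: ac_simps)
    then have "h (a ^^ (i + j + k)) = sg_mult Q (h (a ^^ (i + k))) (h (a ^^ (j + k)))"
      using Q(3)[OF inG inG, of i j] by (simp flip: relpow_add)
    then show ?thesis by (auto simp: \<psi>_def m_def)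
  qed
  have "GH_on H m V"
    unfolding GH_on_def
  proof (intro conjI allI impI)
    have "finite (h ` G)" using finite_subset[OF GT fin] by simp
    moreover have "V \<subseteq> {..k} \<times> h ` G" unfolding V_def \<psi>_def using inG by auto
    ultimately show "finite V" by (meson finite_SigmaI finite_atMost finite_subset)
    show "semigroup_on m V"
      unfolding semigroup_on_def V_def by (auto simp: m\<psi> add.assoc)
    fix K e assume K: "K \<subseteq> V \<and> group_on m K e"
    have e: "e \<in> K" "m e e = e" using K group_onD[of m K e] by simp_all
    then obtain n where n: "n > 0" "e = \<psi> n" using K V_def by auto
    \<comment> \<open>Since \<open>n > 0\<close>, the truncated exponent can be idempotent only at
      \<open>k\<close>. In a subgroup all first components are then \<open>k\<close>, and the second
      component alone tells the elements apart.\<close>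
    then have "min (n + n) k = min n k" using e(2) m\<psi>[of n n] by (simp add: \<psi>_def)
    then have "fst e = k" using n by (simp add: \<psi>_def)
    have fstk: "fst x = k" if "x \<in> K" for x
    proof -
      have "m e x = x" using that K group_onD(3) by metis
      then show ?thesis using \<open>fst e = k\<close>
        by (cases e; cases x) (auto simp: m_def)
    qed
    have "hom_into H m K snd"
      unfolding hom_into_def
    proof (intro bexI[OF _ Q(1)] conjI ballI)
      show "snd ` K \<subseteq> carrier Q" using K Q(2) inG unfolding V_def \<psi>_def by fastforce
    qed (auto simp: m_def)
    moreover have "inj_on snd K" using fstk by (simp add: inj_on_def prod_eq_iff)
    ultimately show "\<exists>h. hom_into H m K h \<and> inj_on h K" by blast
  qed
  moreover have "f ` V \<subseteq> T"
  proof
    fix t assume "t \<in> f ` V"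
    then obtain n where n: "n > 0" "t = f (\<psi> n)" unfolding V_def by auto
    show "t \<in> T"
    proof (cases "n < k")
      case True
      have "i = n" if "\<psi> i = \<psi> n" for i
        using that True by (simp add: \<psi>_def min_def split: if_splits)
      then have "{a ^^ i |i. i > 0 \<and> \<psi> i = \<psi> n} = {a ^^ n}"
        using n(1) by blast
      then show ?thesis using n relpow_in[OF a cl] by (simp add: f_def)
    next
      case False
      then have nG: "a ^^ n \<in> G" by (simp add: G_def)
      have "{a ^^ i |i. i > 0 \<and> \<psi> i = \<psi> n} = {x \<in> G. h x = h (a ^^ n)}"
      proof (intro equalityI subsetI)
        fix x assume "x \<in> {a ^^ i |i. i > 0 \<and> \<psi> i = \<psi> n}"
        then obtain i where i: "x = a ^^ i" "\<psi> i = \<psi> n" by blast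
        then have "i \<ge> k" using False by (simp add: \<psi>_def min_def split: if_splits)
        then show "x \<in> {x \<in> G. h x = h (a ^^ n)}"
          using i False k2[of i] k2[of n] by (simp add: \<psi>_def G_def)
      next
        fix x assume "x \<in> {x \<in> G. h x = h (a ^^ n)}"
        then obtain i where i: "x = a ^^ i" "i \<ge> k" "h (a ^^ i) = h (a ^^ n)"
          unfolding G_def by blast
        then have "\<psi> i = \<psi> n" using False k2[of i] k2[of n] by (simp add: \<psi>_def)
        moreover have "i > 0" using i k by simp
        ultimately show "x \<in> {a ^^ i |i. i > 0 \<and> \<psi> i = \<psi> n}" using i by blast
      qed
      then have "t = a ^^ n O \<Union>{x \<in> G. h x = h (a ^^ k)}"
        using hom_coset[OF G h nG] n by (simp add: f_def)
      then show ?thesis using cl U relpow_in[OF a cl n(1)] by simp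
    qed
  qed
  moreover have "f v O f w \<subseteq> f (m v w)" if "v \<in> V" "w \<in> V" for v w
  proof -
    have "a ^^ i O a ^^ j \<subseteq> f (m v w)" if "i > 0" "\<psi> i = v" "j > 0" "\<psi> j = w" for i j
    proof -
      have "\<psi> (i + j) = m v w" using that m\<psi>[of i j] by simp
      then have "a ^^ (i + j) \<subseteq> f (m v w)"
        unfolding f_def using that by (intro Union_upper CollectI exI[of _ "i + j"]) simp
      then show ?thesis by (simp add: relpow_add)
    qed
    then show ?thesis
      unfolding f_def[of v] f_def[of w] by (intro Union_relcomp_subset) blast
  qed
  moreover have "\<exists>v\<in>V. b \<subseteq> f v" if "b \<in> {a}" for b
  proof -
    have "a ^^ 1 \<subseteq> f (\<psi> 1)"
      unfolding f_def by (intro Union_upper CollectI exI[of _ 1]) simp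
    moreover have "\<psi> 1 \<in> V" unfolding V_def by simp
    ultimately show ?thesis using that by auto
  qed
  ultimately show ?thesis by (rule coversI)
qed

text \<open>The group used is the set \<open>U\<close> of all elements of \<open>T\<close> both of
  whose translations are onto, which avoids forming the closure of \<open>A\<close>. By finiteness
  \<open>U\<close> contains an idempotent, and an idempotent whose translations are onto acts as an
  identity on the whole of \<open>T\<close>. The values of the cover are the unions of the classes
  of \<open>h\<close>.\<close>

lemma covers_units:
  fixes T :: "'a rel set"
  assumes fin: "finite T" and sat: "saturated H (O) T" and A: "A \<subseteq> T" "A \<noteq> {}"
    and perm: "\<And>a. a \<in> A \<Longrightarrow> (\<lambda>t. t O a) ` T = T" "\<And>a. a \<in> A \<Longrightarrow> (\<lambda>t. a O t) ` T = T"
  shows "covers H T A"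
proof -
  have cl: "x O y \<in> T" if "x \<in> T" "y \<in> T" for x y using sat that by (simp add: saturated_def)
  define U where "U = {u \<in> T. (\<lambda>t. t O u) ` T = T \<and> (\<lambda>t. u O t) ` T = T}"
  have AU: "A \<subseteq> U" using A(1) perm unfolding U_def by blast
  have Ucl: "x O y \<in> U" if "x \<in> U" "y \<in> U" for x y
  proof -
    have "(\<lambda>t. t O (x O y)) ` T = (\<lambda>t. t O y) ` (\<lambda>t. t O x) ` T"
      "(\<lambda>t. (x O y) O t) ` T = (\<lambda>t. x O t) ` (\<lambda>t. y O t) ` T"
      by (simp_all add: image_image O_assoc)
    then show ?thesis using that cl by (simp add: U_def)
  qed
  have finU: "finite U" using fin by (simp add: U_def)
  obtain b where b: "b \<in> U" using A AU by blast
  obtain k where k: "k > 0" "b ^^ (k + k) = b ^^ k" using idempotent_power[OF finU b Ucl] by blast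
  define e where "e = b ^^ k"
  have e: "e \<in> U" "e O e = e" using k relpow_in[OF b Ucl] by (simp_all add: e_def relpow_add)
  have id: "e O x = x" "x O e = x" if x: "x \<in> T" for x
  proof -
    have "x \<in> (\<lambda>t. e O t) ` T" using e(1) x by (simp add: U_def)
    then obtain s where "x = e O s" by (rule imageE)
    then show "e O x = x" using e(2) by (simp flip: O_assoc)
    have "x \<in> (\<lambda>t. t O e) ` T" using e(1) x by (simp add: U_def)
    then obtain s where "x = s O e" by (rule imageE)
    then show "x O e = x" using e(2) by (simp add: O_assoc)
  qed
  have G: "group_on (O) U e"
    unfolding group_on_def semigroup_on_def
  proof (intro conjI ballI)
    show "x O y \<in> U" if "x \<in> U" "y \<in> U" for x y using that Ucl by blast
    show "(x O y) O z = x O (y O z)" for x y z :: "'a rel" by (rule O_assoc)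
    show "e \<in> U" by (rule e)
    fix x assume x: "x \<in> U"
    then have xT: "x \<in> T" by (simp add: U_def)
    show "e O x = x" "x O e = x" using id[OF xT] .
    have eT: "e \<in> T" using e by (simp add: U_def)
    have "e \<in> (\<lambda>t. t O x) ` T" using eT x by (simp add: U_def)
    then obtain s where s: "s \<in> T" "s O x = e" by (metis imageE)
    have "e \<in> (\<lambda>t. x O t) ` T" using eT x by (simp add: U_def)
    then obtain s' where s': "s' \<in> T" "x O s' = e" by (metis imageE)
    have "s = s O e" using id s by simp
    also have "\<dots> = (s O x) O s'" using s' by (simp add: O_assoc)
    also have "\<dots> = s'" using s id s' by simp
    finally have ss: "s = s'" .
    have "y \<in> (\<lambda>t. t O s) ` T" if "y \<in> T" for y
      by (rule image_eqI[of _ _ "y O x"]) (use that cl xT ss s' id in \<open>simp_all add: O_assoc\<close>)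
    moreover have "y \<in> (\<lambda>t. s O t) ` T" if "y \<in> T" for y
      by (rule image_eqI[of _ _ "x O y"]) (use that cl xT s id in \<open>simp_all flip: O_assoc\<close>)
    ultimately have "s \<in> U" using s cl by (auto simp: U_def)
    then show "\<exists>y\<in>U. x O y = e \<and> y O x = e" using s s' ss by blast
  qed
  moreover have "U \<subseteq> T" by (auto simp: U_def)
  ultimately obtain h where h: "hom_into H (O) U h" and K: "\<Union>{g \<in> U. h g = h e} \<in> T"
    using sat unfolding saturated_def by blast
  from h obtain Q where Q0: "Q \<in> H" "h ` U \<subseteq> carrier Q"
    "\<forall>x\<in>U. \<forall>y\<in>U. h (x O y) = sg_mult Q (h x) (h y)"
    by (rule hom_intoE)
  note Q = Q0(1,2) Q0(3)[rule_format]
  define f where "f q = \<Union>{g \<in> U. h g = q}" for q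
  have "GH_on H (sg_mult Q) (h ` U)"
    unfolding GH_on_def
  proof (intro conjI allI impI)
    show "finite (h ` U)" using finU by simp
    show "semigroup_on (sg_mult Q) (h ` U)"
      unfolding semigroup_on_def using Ucl by (auto simp: O_assoc simp flip: Q(3))
    fix K e' assume K: "K \<subseteq> h ` U \<and> group_on (sg_mult Q) K e'"
    have "hom_into H (sg_mult Q) K (\<lambda>x. x)"
      unfolding hom_into_def using K Q by (intro bexI[OF _ Q(1)]) auto
    then show "\<exists>h. hom_into H (sg_mult Q) K h \<and> inj_on h K" using inj_on_id2 by blast
  qed
  moreover have "f ` h ` U \<subseteq> T"
  proof
    fix t assume "t \<in> f ` h ` U"
    then obtain g where g: "g \<in> U" "t = f (h g)" by blast
    then have "t = g O \<Union>{x \<in> U. h x = h e}" using hom_coset[OF G h g(1)] by (simp add: f_def)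
    then show "t \<in> T" using cl K g \<open>U \<subseteq> T\<close> by blast
  qed
  moreover have "f v O f w \<subseteq> f (sg_mult Q v w)" if "v \<in> h ` U" "w \<in> h ` U" for v w
  proof -
    have "x O y \<subseteq> f (sg_mult Q v w)" if "x \<in> U" "h x = v" "y \<in> U" "h y = w" for x y
    proof -
      have "x O y \<in> U" "h (x O y) = sg_mult Q v w" using that Ucl Q(3) by auto
      then show ?thesis unfolding f_def by blast
    qed
    then show ?thesis
      unfolding f_def[of v] f_def[of w] by (intro Union_relcomp_subset) blast
  qed
  moreover have "\<exists>v\<in>h ` U. a \<subseteq> f v" if "a \<in> A" for a
    using that AU unfolding f_def by blast
  ultimately show ?thesis by (rule coversI)
qed

subsection \<open>Merging two covers\<close>

text \<open>
  A word over two alphabets is cut at each boundary from the second alphabet to the first. An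
  element of the merged semigroup records a word without cut by its two parts (\<open>Id\<close> standing for
  an empty part), and any other word by its first factor, the product of the letters \<open>c\<close> of its
  inner factors, and its last factor. The outer factors are kept apart because multiplication
  can still extend them.
\<close>

definition cut :: "nat rel \<times> nat rel \<Rightarrow> nat rel \<times> nat rel \<Rightarrow> bool" where
  "cut d d' \<longleftrightarrow> snd d \<noteq> Id \<and> fst d' \<noteq> Id"

definition join :: "nat rel \<times> nat rel \<Rightarrow> nat rel \<times> nat rel \<Rightarrow> nat rel \<times> nat rel" where
  "join d d' = (fst d O fst d', snd d O snd d')"

text \<open>The contribution of the two outer factors that meet when two words with cuts are
  concatenated. Both become inner: they stay two factors if a cut falls between them, and fuse into
  one otherwise.\<close>

definition inner :: "(nat rel \<times> nat rel \<Rightarrow> nat rel) \<Rightarrow> nat rel \<times> nat rel \<Rightarrow> nat rel \<times> nat rel \<Rightarrow> nat rel"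
  where "inner c d d' = (if cut d d' then c d O c d' else c (join d d'))"

type_synonym merged =
  "(nat rel \<times> nat rel) + (nat rel \<times> nat rel) \<times> nat rel \<times> (nat rel \<times> nat rel)"

fun merge_mult :: "(nat rel \<times> nat rel \<Rightarrow> nat rel) \<Rightarrow> merged \<Rightarrow> merged \<Rightarrow> merged" where
  "merge_mult c (Inl d) (Inl d') = (if cut d d' then Inr (d, Id, d') else Inl (join d d'))"
| "merge_mult c (Inl d) (Inr (p, m, q)) =
     (if cut d p then Inr (d, c p O m, q) else Inr (join d p, m, q))"
| "merge_mult c (Inr (p, m, q)) (Inl d) =
     (if cut q d then Inr (p, m O c q, d) else Inr (p, m, join q d))"
| "merge_mult c (Inr (p, m, q)) (Inr (p', m', q')) = Inr (p, m O inner c q p' O m', q')"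

text \<open>A first factor is followed by a cut and so has a nonempty second part; a last factor is
  preceded by a cut and so has a nonempty first part. The middle is \<open>Id\<close> if there is no
  inner factor. The pair \<open>(Id, Id)\<close>, the empty word, is left out.\<close>

definition merge_carrier :: "nat rel set \<Rightarrow> nat rel set \<Rightarrow> nat rel set \<Rightarrow> merged set" where
  "merge_carrier V1 V2 V3 = Inl ` (insert Id V1 \<times> insert Id V2 - {(Id, Id)}) \<union>
     Inr ` ((insert Id V1 \<times> V2) \<times> insert Id V3 \<times> (V1 \<times> insert Id V2))"

locale id_free =
  fixes V :: "nat rel set"
  assumes closed: "x \<in> V \<Longrightarrow> y \<in> V \<Longrightarrow> x O y \<in> V" and Id: "Id \<notin> V"
begin

lemma closed': "x \<in> insert Id V \<Longrightarrow> y \<in> insert Id V \<Longrightarrow> x O y \<in> insert Id V"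
  using closed by auto

lemma closedL: "x \<in> V \<Longrightarrow> y \<in> insert Id V \<Longrightarrow> x O y \<in> V"
  and closedR: "x \<in> insert Id V \<Longrightarrow> y \<in> V \<Longrightarrow> x O y \<in> V"
  using closed by auto

lemma eq_Id: "x \<in> insert Id V \<Longrightarrow> y \<in> insert Id V \<Longrightarrow> x O y = Id \<longleftrightarrow> x = Id \<and> y = Id"
  using closed[of x y] Id by auto

end

locale merge =
  V1: id_free V1 + V2: id_free V2 + V3: id_free V3
  for V1 V2 V3 :: "nat rel set" +
  fixes c :: "nat rel \<times> nat rel \<Rightarrow> nat rel"
  assumes c: "d \<in> V1 \<times> V2 \<Longrightarrow> c d \<in> V3"
begin

abbreviation "m \<equiv> merge_mult c"
abbreviation "V \<equiv> merge_carrier V1 V2 V3"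
text \<open>\<open>D\<close> holds the nonempty words without a cut, \<open>P\<close> the possible
  first factors and \<open>Q\<close> the possible last factors of a word with cuts.\<close>

definition "D = insert Id V1 \<times> insert Id V2 - {(Id, Id)}"
definition "P = insert Id V1 \<times> V2"
definition "Q = V1 \<times> insert Id V2"

lemma V_cases:
  assumes "v \<in> V"
  obtains d where "v = Inl d" "d \<in> D"
  | p n q where "v = Inr (p, n, q)" "p \<in> P" "n \<in> insert Id V3" "q \<in> Q"
  using assms unfolding merge_carrier_def D_def P_def Q_def by blast

lemma Inl_V: "Inl d \<in> V \<longleftrightarrow> d \<in> D"
  and Inr_V: "Inr (p, n, q) \<in> V \<longleftrightarrow> p \<in> P \<and> n \<in> insert Id V3 \<and> q \<in> Q"
  unfolding merge_carrier_def D_def P_def Q_def by blast+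

lemma P_sel: "p \<in> P \<Longrightarrow> fst p \<in> insert Id V1" "p \<in> P \<Longrightarrow> snd p \<in> V2"
  unfolding P_def Q_def mem_Times_iff by blast+

lemma Q_sel: "q \<in> Q \<Longrightarrow> fst q \<in> V1" "q \<in> Q \<Longrightarrow> snd q \<in> insert Id V2"
  unfolding P_def Q_def mem_Times_iff by blast+

lemma P_I: "fst p \<in> insert Id V1 \<Longrightarrow> snd p \<in> V2 \<Longrightarrow> p \<in> P"
  unfolding P_def mem_Times_iff by blast

lemma Q_I: "fst q \<in> V1 \<Longrightarrow> snd q \<in> insert Id V2 \<Longrightarrow> q \<in> Q"
  unfolding Q_def mem_Times_iff by blast

lemma D_iff: "d \<in> D \<longleftrightarrow> fst d \<in> insert Id V1 \<and> snd d \<in> insert Id V2 \<and> \<not> (fst d = Id \<and> snd d = Id)"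
  unfolding D_def Diff_iff mem_Times_iff singleton_iff prod_eq_iff fst_conv snd_conv by blast

lemma PQ_D:
  shows "p \<in> P \<Longrightarrow> p \<in> D" "q \<in> Q \<Longrightarrow> q \<in> D"
  unfolding D_iff using P_sel Q_sel V1.Id V2.Id by (metis insertCI)+

lemma D_sel: "d \<in> D \<Longrightarrow> fst d \<in> insert Id V1" "d \<in> D \<Longrightarrow> snd d \<in> insert Id V2"
  unfolding D_iff by blast+

text \<open>No product of nonempty parts is \<open>Id\<close>, so a joined factor has an empty part
  only where both factors have one. Joining therefore neither hides nor invents a cut with a third
  factor.\<close>

lemma cut_join1:
  assumes "a \<in> D" "b \<in> D"
  shows "cut (join a b) d \<longleftrightarrow> cut a d \<or> cut b d"
proof -
  have "snd a O snd b = Id \<longleftrightarrow> snd a = Id \<and> snd b = Id" using assms D_sel by (intro V2.eq_Id)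
  then show ?thesis unfolding cut_def join_def fst_conv snd_conv by blast
qed

lemma cut_join2:
  assumes "a \<in> D" "b \<in> D"
  shows "cut d (join a b) \<longleftrightarrow> cut d a \<or> cut d b"
proof -
  have "fst a O fst b = Id \<longleftrightarrow> fst a = Id \<and> fst b = Id" using assms D_sel by (intro V1.eq_Id)
  then show ?thesis unfolding cut_def join_def fst_conv snd_conv by blast
qed

lemma join_assoc: "join (join a b) d = join a (join b d)"
  by (simp add: join_def O_assoc)

lemma join_D:
  assumes "a \<in> D" "b \<in> D"
  shows "join a b \<in> D"
proof -
  have "fst a O fst b \<in> insert Id V1" "snd a O snd b \<in> insert Id V2"
    by (rule V1.closed' V2.closed'; rule D_sel; rule assms)+
  moreover have "fst a O fst b = Id \<longleftrightarrow> fst a = Id \<and> fst b = Id"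
    "snd a O snd b = Id \<longleftrightarrow> snd a = Id \<and> snd b = Id"
    by (rule V1.eq_Id V2.eq_Id; rule D_sel; rule assms)+
  moreover have "\<not> (fst a = Id \<and> snd a = Id)" using assms(1) unfolding D_iff by blast
  ultimately show ?thesis unfolding D_iff join_def fst_conv snd_conv by blast
qed

lemma join_P:
  assumes "a \<in> D" "p \<in> P"
  shows "join a p \<in> P"
  by (rule P_I) (simp_all only: join_def fst_conv snd_conv V1.closed' V2.closedR D_sel[OF assms(1)] P_sel[OF assms(2)])

lemma join_Q:
  assumes "q \<in> Q" "a \<in> D"
  shows "join q a \<in> Q"
  by (rule Q_I) (simp_all only: join_def fst_conv snd_conv V2.closed' V1.closedL D_sel[OF assms(2)] Q_sel[OF assms(1)])

lemma cut_c:
  assumes "cut a b" "a \<in> D" "b \<in> D"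
  shows "a \<in> P" "b \<in> Q"
  using D_sel[OF assms(2)] D_sel[OF assms(3)] assms(1) unfolding cut_def
  by (blast intro: P_I Q_I)+

text \<open>A factor with cuts on both sides has two nonempty parts and therefore a letter.\<close>

lemma P_Q_c: "d \<in> P \<Longrightarrow> d \<in> Q \<Longrightarrow> c d \<in> V3"
  using P_sel(2)[of d] Q_sel(1)[of d] c[of d] by (simp add: mem_Times_iff)

lemma inner_V3:
  assumes "q \<in> Q" "p \<in> P"
  shows "inner c q p \<in> V3"
proof (cases "cut q p")
  case True
  then have "q \<in> P" "p \<in> Q" using cut_c[OF True] PQ_D assms by blast+
  then show ?thesis using True assms P_Q_c V3.closed by (simp add: inner_def)
next
  case False
  have "join q p \<in> P" "join q p \<in> Q" using join_P join_Q PQ_D assms by blast+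
  then show ?thesis using False P_Q_c by (simp add: inner_def)
qed

lemma closed: 
  assumes "u \<in> V" "v \<in> V"
  shows "m u v \<in> V"
  using assms(1)
proof (cases rule: V_cases)
  case u: (1 d)
  show ?thesis using assms(2)
  proof (cases rule: V_cases)
    case v: (1 d')
    show ?thesis using u v cut_c[of d d'] join_D[of d d'] by (auto simp: Inl_V Inr_V)
  next
    case v: (2 p n q)
    show ?thesis
    proof (cases "cut d p")
      case True
      then have "d \<in> P" "p \<in> Q" using cut_c[OF True] u v PQ_D by blast+
      then show ?thesis using True u v P_Q_c V3.closedL by (simp add: Inr_V)
    qed (use u v join_P in \<open>simp add: Inr_V\<close>)
  qed
next
  case u: (2 p n q)
  show ?thesis using assms(2)
  proof (cases rule: V_cases)
    case v: (1 d)
    show ?thesis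
    proof (cases "cut q d")
      case True
      then have "q \<in> P" "d \<in> Q" using cut_c[OF True] u v PQ_D by blast+
      then show ?thesis using True u v P_Q_c V3.closedR by (simp add: Inr_V)
    qed (use u v join_Q in \<open>simp add: Inr_V\<close>)
  next
    case v: (2 p' n' q')
    have "inner c q p' O n' \<in> V3" using inner_V3 V3.closedL u v by blast
    then have "n O inner c q p' O n' \<in> V3" using V3.closedR u by blast
    then show ?thesis using u v by (simp add: Inr_V)
  qed
qed

text \<open>This decides associativity. If neither seam between three uncut words were a cut, but
  the outer two had a cut between them, the two bracketings would disagree about its place; a
  nonempty middle word rules this out.\<close>

lemma cut_trans: "b \<in> D \<Longrightarrow> cut a d \<Longrightarrow> cut a b \<or> cut b d"
  unfolding cut_def D_iff by blast

lemma assoc: 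
  assumes "u \<in> V" "v \<in> V" "w \<in> V"
  shows "m (m u v) w = m u (m v w)"
proof -
  note s = cut_join1 cut_join2 PQ_D O_assoc inner_def join_assoc
  from assms show ?thesis
    by (elim V_cases) (simp_all add: s, (metis cut_trans PQ_D)+)
qed

lemma GH_merge:
  assumes "GH_on H (O) V1" "GH_on H (O) V2" "GH_on H (O) V3"
  shows "GH_on H m V"
proof (rule GH_on_embed)
  have "finite V1" "finite V2" "finite V3" using assms by (simp_all add: GH_on_def)
  then show "finite V" unfolding merge_carrier_def by simp
  show "semigroup_on m V" using closed assoc by (simp add: semigroup_on_def)
  fix G e assume GV: "G \<subseteq> V" and G: "group_on m G e"
  note grp = group_onD[OF G]
  have idem: "m e e = e" using grp by blast
  have "e \<in> V" using GV grp by blast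
  then show "\<exists>(W :: nat rel set) m' j. GH_on H m' W \<and> j ` G \<subseteq> W \<and> inj_on j G \<and>
        (\<forall>x\<in>G. \<forall>y\<in>G. j (m x y) = m' (j x) (j y))"
  proof (cases rule: V_cases)
    case e: (1 d)
    have Inl: "\<exists>d'\<in>D. g = Inl d' \<and> \<not> cut d d' \<and> \<not> cut d' d" if g: "g \<in> G" for g
    proof -
      obtain g' where g': "g' \<in> G" "m g g' = e" using grp(5)[OF g] by blast
      have "g \<in> V" using g GV by blast
      then show ?thesis
      proof (cases rule: V_cases)
        case (1 d')
        then show ?thesis using grp(3,4)[OF g] e by (auto split: if_splits)
      next
        case (2 p n q)
        then show ?thesis using g'(2) e by (cases g') (auto split: if_splits)
      qed
    qed
    have "snd d = Id \<and> fst d \<noteq> Id \<or> fst d = Id \<and> snd d \<noteq> Id"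
      using Inl[OF grp(1)] e unfolding cut_def D_iff by blast
    then show ?thesis
    proof
      assume d: "snd d = Id \<and> fst d \<noteq> Id"
      have form: "\<exists>x\<in>V1. g = Inl (x, Id)" if g: "g \<in> G" for g
      proof -
        obtain d' where "d' \<in> D" "g = Inl d'" "\<not> cut d d'" "\<not> cut d' d" using Inl[OF g] by blast
        then show ?thesis using d unfolding cut_def D_iff by (cases d') auto
      qed
      let ?j = "\<lambda>g. fst (projl g)"
      have form': "g = Inl (?j g, Id)" "?j g \<in> V1" if "g \<in> G" for g
        using form[OF that] by auto
      have "?j ` G \<subseteq> V1" using form'(2) by blast
      moreover have "inj_on ?j G" by (rule inj_onI) (metis form'(1))
      moreover have "?j (m x y) = ?j x O ?j y" if xy: "x \<in> G" "y \<in> G" for x y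
      proof -
        obtain a b where "x = Inl a" "y = Inl b" "\<not> cut a b"
          using form[OF xy(1)] form[OF xy(2)] by (auto simp: cut_def)
        then show ?thesis by (simp add: join_def)
      qed
      ultimately show ?thesis using assms(1) by (intro exI[of _ V1] exI[of _ "(O)"] exI[of _ ?j]) simp
    next
      assume d: "fst d = Id \<and> snd d \<noteq> Id"
      have form: "\<exists>x\<in>V2. g = Inl (Id, x)" if g: "g \<in> G" for g
      proof -
        obtain d' where "d' \<in> D" "g = Inl d'" "\<not> cut d d'" "\<not> cut d' d" using Inl[OF g] by blast
        then show ?thesis using d unfolding cut_def D_iff by (cases d') auto
      qed
      let ?j = "\<lambda>g. snd (projl g)"
      have form': "g = Inl (Id, ?j g)" "?j g \<in> V2" if "g \<in> G" for g
        using form[OF that] by auto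
      have "?j ` G \<subseteq> V2" using form'(2) by blast
      moreover have "inj_on ?j G" by (rule inj_onI) (metis form'(1))
      moreover have "?j (m x y) = ?j x O ?j y" if xy: "x \<in> G" "y \<in> G" for x y
      proof -
        obtain a b where "x = Inl a" "y = Inl b" "\<not> cut a b"
          using form[OF xy(1)] form[OF xy(2)] by (auto simp: cut_def)
        then show ?thesis by (simp add: join_def)
      qed
      ultimately show ?thesis using assms(2) by (intro exI[of _ V2] exI[of _ "(O)"] exI[of _ ?j]) simp
    qed
  next
    case e: (2 p n q)
    define k where "k = inner c q p"
    have k: "k \<in> V3" using inner_V3 e by (simp add: k_def)
    have form: "\<exists>x\<in>insert Id V3. g = Inr (p, x, q) \<and> x O k O n = x" if g: "g \<in> G" for g
    proof -
      have eg: "m e g = g" "m g e = g" using grp(3,4)[OF g] by simp_all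
      have "g \<in> V" using g GV by blast
      then show ?thesis
      proof (cases rule: V_cases)
        case (1 d')
        then show ?thesis using eg e by (auto split: if_splits)
      next
        case (2 p' n' q')
        then show ?thesis using eg e by (simp add: k_def)
      qed
    qed
    \<comment> \<open>Composing with the middle component \<open>n\<close> of the identity undoes
      this map on the group, as \<open>x O k O n = x\<close>.\<close>
    let ?j = "\<lambda>g. fst (snd (projr g)) O k"
    have "?j ` G \<subseteq> V3" using form V3.closedR[OF _ k] by fastforce
    moreover have "inj_on ?j G"
    proof (rule inj_onI)
      fix g h assume gh: "g \<in> G" "h \<in> G" "?j g = ?j h"
      obtain x y where xy: "g = Inr (p, x, q)" "x O k O n = x" "h = Inr (p, y, q)" "y O k O n = y"
        using form gh by metis
      have "x = (x O k) O n" using xy by (simp add: O_assoc)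
      also have "\<dots> = (y O k) O n" using gh(3) xy by simp
      also have "\<dots> = y" using xy by (simp add: O_assoc)
      finally show "g = h" using xy by simp
    qed
    moreover have "\<forall>x\<in>G. \<forall>y\<in>G. ?j (m x y) = ?j x O ?j y"
    proof (intro ballI)
      fix x y assume "x \<in> G" "y \<in> G"
      then obtain a b where "x = Inr (p, a, q)" "y = Inr (p, b, q)" using form by metis
      then show "?j (m x y) = ?j x O ?j y" by (simp add: k_def O_assoc)
    qed
    ultimately show ?thesis using assms(3) by (intro exI[of _ V3] exI[of _ "(O)"] exI[of _ ?j]) simp
  qed
qed

end

text \<open>An element is mapped to the composition of all that it records, with the middle
  component evaluated by \<open>f3\<close> and \<open>Id\<close> by \<open>Id\<close>. Where two
  factors meet without a cut, only parts over the same alphabet have to be multiplied, and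
  \<open>f1\<close> or \<open>f2\<close> is lax. Where a cut appears, a factor that becomes inner is
  replaced by its letter, whose value contains it by \<open>letters\<close>, and \<open>f3\<close>
  is lax.\<close>

lemma covers_merge:
  fixes V1 V2 V3 :: "nat rel set" and f1 f2 f3 :: "nat rel \<Rightarrow> 'a rel"
  assumes V: "GH_on H (O) V1" "GH_on H (O) V2" "GH_on H (O) V3"
    and Id: "Id \<notin> V1" "Id \<notin> V2" "Id \<notin> V3"
    and fT: "f1 ` V1 \<subseteq> T" "f2 ` V2 \<subseteq> T" "f3 ` V3 \<subseteq> T"
    and T: "\<And>x y. x \<in> T \<Longrightarrow> y \<in> T \<Longrightarrow> x O y \<in> T"
    and lax: "\<And>x y. x \<in> V1 \<Longrightarrow> y \<in> V1 \<Longrightarrow> f1 x O f1 y \<subseteq> f1 (x O y)"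
      "\<And>x y. x \<in> V2 \<Longrightarrow> y \<in> V2 \<Longrightarrow> f2 x O f2 y \<subseteq> f2 (x O y)"
      "\<And>x y. x \<in> V3 \<Longrightarrow> y \<in> V3 \<Longrightarrow> f3 x O f3 y \<subseteq> f3 (x O y)"
    and letters: "\<And>x y. x \<in> V1 \<Longrightarrow> y \<in> V2 \<Longrightarrow> \<exists>z\<in>V3. f1 x O f2 y \<subseteq> f3 z"
    and A: "\<And>a. a \<in> A \<Longrightarrow> (\<exists>v\<in>V1. a \<subseteq> f1 v) \<or> (\<exists>v\<in>V2. a \<subseteq> f2 v)"
  shows "covers H T A"
proof -
  have "\<forall>d\<in>V1 \<times> V2. \<exists>z\<in>V3. f1 (fst d) O f2 (snd d) \<subseteq> f3 z" using letters by auto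
  then obtain c where cc: "\<forall>d\<in>V1 \<times> V2. c d \<in> V3 \<and> f1 (fst d) O f2 (snd d) \<subseteq> f3 (c d)"
    unfolding bchoice_iff Bex_def by blast
  interpret merge V1 V2 V3 c
    using V Id cc by unfold_locales (auto simp: GH_on_def semigroup_on_def)
  define ext :: "(nat rel \<Rightarrow> 'a rel) \<Rightarrow> nat rel \<Rightarrow> 'a rel"
    where "ext f x = (if x = Id then Id else f x)" for f x
  have ext: "ext f x O ext f y \<subseteq> ext f (x O y)"
    if W: "id_free W" and "x \<in> insert Id W" "y \<in> insert Id W"
      "\<And>x y. x \<in> W \<Longrightarrow> y \<in> W \<Longrightarrow> f x O f y \<subseteq> f (x O y)" for f x y W
    using that id_free.eq_Id[OF W] by (auto simp: ext_def)
  have ext1: "ext f x = f x" if "x \<in> W" "Id \<notin> W" for f x W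
    using that by (auto simp: ext_def)
  define F where "F d = ext f1 (fst d) O ext f2 (snd d)" for d
  define f where "f v = (case v of Inl d \<Rightarrow> F d | Inr (p, n, q) \<Rightarrow> F p O ext f3 n O F q)" for v
  have e3: "ext f3 x O ext f3 y \<subseteq> ext f3 (x O y)" if "x \<in> insert Id V3" "y \<in> insert Id V3" for x y
    using ext[OF V3.id_free_axioms that lax(3)] .
  have FD: "F a O F b \<subseteq> F (join a b)" if "a \<in> D" "b \<in> D" "\<not> cut a b" for a b
  proof (cases "snd a = Id")
    case True
    then have "F a O F b = (ext f1 (fst a) O ext f1 (fst b)) O ext f2 (snd b)"
      by (simp add: F_def ext_def O_assoc)
    also have "\<dots> \<subseteq> ext f1 (fst a O fst b) O ext f2 (snd b)"
      by (intro relcomp_mono order_refl ext[OF V1.id_free_axioms _ _ lax(1)] D_sel that)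
    finally show ?thesis using True by (simp add: F_def join_def)
  next
    case False
    then have *: "fst b = Id" using that by (simp add: cut_def)
    then have "F a O F b = ext f1 (fst a) O (ext f2 (snd a) O ext f2 (snd b))"
      by (simp add: F_def ext_def O_assoc)
    also have "\<dots> \<subseteq> ext f1 (fst a) O ext f2 (snd a O snd b)"
      by (intro relcomp_mono order_refl ext[OF V2.id_free_axioms _ _ lax(2)] D_sel that)
    finally show ?thesis using * by (simp add: F_def join_def)
  qed
  have Fc: "F d \<subseteq> ext f3 (c d)" if "d \<in> P" "d \<in> Q" for d
  proof -
    have d: "d \<in> V1 \<times> V2" using P_sel(2)[of d] Q_sel(1)[of d] that by (simp add: mem_Times_iff)
    have cd: "c d \<in> V3" "f1 (fst d) O f2 (snd d) \<subseteq> f3 (c d)" using bspec[OF cc d] by simp_all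
    have "fst d \<in> V1" "snd d \<in> V2" using d by auto
    then have "F d = f1 (fst d) O f2 (snd d)"
      using ext1[OF _ Id(1)] ext1[OF _ Id(2)] by (simp add: F_def)
    then show ?thesis using cd ext1[OF _ Id(3)] by simp
  qed
  have Finner: "F q O F p \<subseteq> ext f3 (inner c q p)" if qp: "q \<in> Q" "p \<in> P" for q p
  proof (cases "cut q p")
    case True
    then have *: "q \<in> P" "p \<in> Q" using cut_c[OF True] PQ_D qp by blast+
    have "F q O F p \<subseteq> ext f3 (c q) O ext f3 (c p)" using Fc * qp by (intro relcomp_mono)
    also have "\<dots> \<subseteq> ext f3 (c q O c p)" using e3 P_Q_c * qp by simp
    finally show ?thesis using True by (simp add: inner_def)
  next
    case False
    have "join q p \<in> P" "join q p \<in> Q" using join_P join_Q PQ_D qp by blast+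
    then have "F (join q p) \<subseteq> ext f3 (c (join q p))" using Fc by simp
    then show ?thesis using FD[of q p] False PQ_D qp by (simp add: inner_def)
  qed
  have lax_f: "f u O f v \<subseteq> f (m u v)" if "u \<in> V" "v \<in> V" for u v
    using that(1)
  proof (cases rule: V_cases)
    case u: (1 d)
    show ?thesis using that(2)
    proof (cases rule: V_cases)
      case v: (1 d')
      show ?thesis using u v FD[of d d'] by (simp add: f_def ext_def)
    next
      case v: (2 p n q)
      show ?thesis
      proof (cases "cut d p")
        case True
        then have "d \<in> P" "p \<in> Q" using cut_c[OF True] u v PQ_D by blast+
        then have "c p \<in> V3" "F p \<subseteq> ext f3 (c p)" using Fc P_Q_c v by blast+
        then have "F p O ext f3 n \<subseteq> ext f3 (c p) O ext f3 n" "c p \<in> insert Id V3" by blast+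
        then have "F p O ext f3 n \<subseteq> ext f3 (c p O n)" using e3[of "c p" n] v by blast
        then have "F d O (F p O ext f3 n) O F q \<subseteq> F d O ext f3 (c p O n) O F q"
          by (intro relcomp_mono order_refl)
        then show ?thesis using True u v by (simp add: f_def O_assoc)
      next
        case False
        then have "(F d O F p) O (ext f3 n O F q) \<subseteq> F (join d p) O (ext f3 n O F q)"
          using FD u v PQ_D by (intro relcomp_mono order_refl) blast
        then show ?thesis using False u v by (simp add: f_def O_assoc)
      qed
    qed
  next
    case u: (2 p n q)
    show ?thesis using that(2)
    proof (cases rule: V_cases)
      case v: (1 d)
      show ?thesis
      proof (cases "cut q d")
        case True
        then have "q \<in> P" "d \<in> Q" using cut_c[OF True] u v PQ_D by blast+
        then have "c q \<in> V3" "F q \<subseteq> ext f3 (c q)" using Fc P_Q_c u by blast+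
        then have "ext f3 n O F q \<subseteq> ext f3 n O ext f3 (c q)" "c q \<in> insert Id V3" by blast+
        then have "ext f3 n O F q \<subseteq> ext f3 (n O c q)" using e3[of n "c q"] u by blast
        then have "F p O (ext f3 n O F q) O F d \<subseteq> F p O ext f3 (n O c q) O F d"
          by (intro relcomp_mono order_refl)
        then show ?thesis using True u v by (simp add: f_def O_assoc)
      next
        case False
        then have "F p O ext f3 n O (F q O F d) \<subseteq> F p O ext f3 n O F (join q d)"
          using FD u v PQ_D by (intro relcomp_mono order_refl) blast
        then show ?thesis using False u v by (simp add: f_def O_assoc)
      qed
    next
      case v: (2 p' n' q')
      let ?k = "inner c q p'"
      have k: "?k \<in> V3" using inner_V3 u v by simp
      have kn: "?k O n' \<in> insert Id V3" using V3.closedL[OF k] v by simp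
      have "ext f3 n O (F q O F p') O ext f3 n' \<subseteq> ext f3 n O ext f3 ?k O ext f3 n'"
        using Finner u v by (intro relcomp_mono order_refl)
      also have "\<dots> \<subseteq> ext f3 n O ext f3 (?k O n')"
        using e3[of ?k n'] k v by (intro relcomp_mono order_refl) simp
      also have "\<dots> \<subseteq> ext f3 (n O ?k O n')" using e3[of n "?k O n'"] kn u by simp
      finally have "F p O (ext f3 n O (F q O F p') O ext f3 n') O F q' \<subseteq>
          F p O ext f3 (n O ?k O n') O F q'"
        by (intro relcomp_mono order_refl)
      then show ?thesis using u v by (simp add: f_def O_assoc)
    qed
  qed
  \<comment> \<open>\<open>T\<close> need not contain \<open>Id\<close>. The value is in
    \<open>T\<close> because \<open>D\<close> excludes the pair with two empty parts.\<close>
  have FT: "F d \<in> T" if "d \<in> D" for d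
  proof -
    have "fst d = Id \<or> fst d \<in> V1" "snd d = Id \<or> snd d \<in> V2" "fst d \<noteq> Id \<or> snd d \<noteq> Id"
      using that by (auto simp: D_iff)
    then show ?thesis using T fT unfolding F_def ext_def by (auto simp: image_subset_iff)
  qed
  have "f v \<in> T" if "v \<in> V" for v
    using that
  proof (cases rule: V_cases)
    case (1 d)
    then show ?thesis using FT by (simp add: f_def)
  next
    case (2 p n q)
    then have "F p \<in> T" "F q \<in> T" using FT PQ_D by blast+
    moreover have "n = Id \<or> n \<in> V3" using 2 by simp
    ultimately show ?thesis using 2 T fT by (auto simp: f_def ext_def image_subset_iff)
  qed
  then have "f ` V \<subseteq> T" by blast
  moreover have "\<exists>v\<in>V. a \<subseteq> f v" if a: "a \<in> A" for a
    using A[OF a]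
  proof
    assume "\<exists>v\<in>V1. a \<subseteq> f1 v"
    then obtain v where "v \<in> V1" "a \<subseteq> f1 v" by blast
    then show ?thesis using V1.Id
      by (intro bexI[of _ "Inl (v, Id)"]) (auto simp: f_def F_def ext_def Inl_V D_iff)
  next
    assume "\<exists>v\<in>V2. a \<subseteq> f2 v"
    then obtain v where "v \<in> V2" "a \<subseteq> f2 v" by blast
    then show ?thesis using V2.Id
      by (intro bexI[of _ "Inl (Id, v)"]) (auto simp: f_def F_def ext_def Inl_V D_iff)
  qed
  ultimately show ?thesis using coversI[OF GH_merge[OF V], of f T A] lax_f by blast
qed

subsection \<open>Saturated families are covered\<close>

lemma coversE:
  assumes "covers H T A"
  obtains V :: "nat rel set" and f where "GH_on H (O) V" "Id \<notin> V" "f ` V \<subseteq> T"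
    "\<forall>x\<in>V. \<forall>y\<in>V. f x O f y \<subseteq> f (x O y)" "\<forall>a\<in>A. \<exists>v\<in>V. a \<subseteq> f v"
  using assms unfolding covers_def by blast

lemma saturatedE:
  assumes "saturated H m C" "G \<subseteq> C" "group_on m G e"
  obtains h where "hom_into H m G h" "\<Union>{g \<in> G. h g = h e} \<in> C"
  using assms unfolding saturated_def by metis

lemma covers_empty: "covers H T {}"
  unfolding covers_def
  by (intro exI[of _ "{}"]) (auto simp: GH_on_def semigroup_on_def group_on_def)

text \<open>The choices \<open>T\<close> and \<open>insert Id T\<close> for \<open>X\<close> give
  the ideal \<open>T a\<close> and the left ideal generated by \<open>a\<close>. The identity of a
  subgroup has the form \<open>e = x O a\<close>, and the union \<open>U\<close> of a kernel
  satisfies \<open>U O e = U\<close>; so \<open>U\<close> equals \<open>(U O x) O a\<close> and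
  stays in the ideal.\<close>

lemma saturated_left_ideal:
  assumes sat: "saturated H (O) T" and a: "a \<in> T" and X: "T \<subseteq> X" "X \<subseteq> insert Id T"
  shows "saturated H (O) ((\<lambda>x. x O a) ` X)"
  unfolding saturated_def
proof (intro conjI allI impI)
  have cl: "x O y \<in> T" if "x \<in> T" "y \<in> T" for x y using sat that by (simp add: saturated_def)
  have XT: "x O a \<in> T" if "x \<in> X" for x using X that cl a by auto
  show "\<forall>x\<in>(\<lambda>x. x O a) ` X. \<forall>y\<in>(\<lambda>x. x O a) ` X. x O y \<in> (\<lambda>x. x O a) ` X"
  proof (intro ballI)
    fix x y assume "x \<in> (\<lambda>x. x O a) ` X" "y \<in> (\<lambda>x. x O a) ` X"
    then obtain u v where "x = u O a" "u \<in> X" "y = v O a" "v \<in> X" by blast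
    moreover from this have "(u O a) O v \<in> T" using X XT cl by auto
    ultimately show "x O y \<in> (\<lambda>x. x O a) ` X"
      using X by (intro image_eqI[of _ _ "(u O a) O v"]) (auto simp: O_assoc)
  qed
  fix G e assume G: "G \<subseteq> (\<lambda>x. x O a) ` X \<and> group_on (O) G e"
  then have GT: "G \<subseteq> T" and grp: "group_on (O) G e" using XT by blast+
  from sat GT grp obtain h where h: "hom_into H (O) G h" and U: "\<Union>{g \<in> G. h g = h e} \<in> T"
    by (rule saturatedE)
  have "e \<in> (\<lambda>x. x O a) ` X" using G group_onD(1)[OF grp] by blast
  then obtain x where x: "e = x O a" "x \<in> X" by blast
  let ?U = "\<Union>{g \<in> G. h g = h e}"
  have "?U O e = (\<Union>g\<in>{g \<in> G. h g = h e}. g O e)" by blast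
  also have "\<dots> = ?U" using group_onD(4)[OF grp] by auto
  finally have "?U = (?U O x) O a" using x by (simp add: O_assoc)
  moreover have "?U O x \<in> T" using x(2) X(2) U cl by auto
  ultimately have "?U \<in> (\<lambda>x. x O a) ` X" using X(1) by blast
  then show "\<exists>h. hom_into H (O) G h \<and> \<Union>{g \<in> G. h g = h e} \<in> (\<lambda>x. x O a) ` X" using h by blast
qed

lemma saturated_right_ideal:
  assumes sat: "saturated H (O) T" and a: "a \<in> T" and X: "T \<subseteq> X" "X \<subseteq> insert Id T"
  shows "saturated H (O) ((\<lambda>x. a O x) ` X)"
  unfolding saturated_def
proof (intro conjI allI impI)
  have cl: "x O y \<in> T" if "x \<in> T" "y \<in> T" for x y using sat that by (simp add: saturated_def)
  have XT: "a O x \<in> T" if "x \<in> X" for x using X that cl a by auto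
  show "\<forall>x\<in>(\<lambda>x. a O x) ` X. \<forall>y\<in>(\<lambda>x. a O x) ` X. x O y \<in> (\<lambda>x. a O x) ` X"
  proof (intro ballI)
    fix x y assume "x \<in> (\<lambda>x. a O x) ` X" "y \<in> (\<lambda>x. a O x) ` X"
    then obtain u v where "x = a O u" "u \<in> X" "y = a O v" "v \<in> X" by blast
    moreover from this have "u O (a O v) \<in> T" using X XT cl by auto
    ultimately show "x O y \<in> (\<lambda>x. a O x) ` X"
      using X by (intro image_eqI[of _ _ "u O (a O v)"]) (auto simp: O_assoc)
  qed
  fix G e assume G: "G \<subseteq> (\<lambda>x. a O x) ` X \<and> group_on (O) G e"
  then have GT: "G \<subseteq> T" and grp: "group_on (O) G e" using XT by blast+
  from sat GT grp obtain h where h: "hom_into H (O) G h" and U: "\<Union>{g \<in> G. h g = h e} \<in> T"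
    by (rule saturatedE)
  have "e \<in> (\<lambda>x. a O x) ` X" using G group_onD(1)[OF grp] by blast
  then obtain x where x: "e = a O x" "x \<in> X" by blast
  let ?U = "\<Union>{g \<in> G. h g = h e}"
  have "e O ?U = (\<Union>g\<in>{g \<in> G. h g = h e}. e O g)" by blast
  also have "\<dots> = ?U" using group_onD(3)[OF grp] by auto
  finally have "?U = a O (x O ?U)" using x by (simp flip: O_assoc)
  moreover have "x O ?U \<in> T" using x(2) X(2) U cl by auto
  ultimately have "?U \<in> (\<lambda>x. a O x) ` X" using X(1) by blast
  then show "\<exists>h. hom_into H (O) G h \<and> \<Union>{g \<in> G. h g = h e} \<in> (\<lambda>x. a O x) ` X" using h by blast
qed

text \<open>The outer induction is on \<open>card T\<close>, the inner one on \<open>card A\<close>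
  for fixed \<open>T\<close>. If \<open>T a\<close> is proper, the blocks of \<open>a\<close> are
  covered inside the left ideal generated by \<open>a\<close>, not merely inside \<open>T\<close>:
  composing a value in \<open>T\<close> with a value in that ideal leads into \<open>T a\<close>. So
  the letters live in a smaller saturated set, where the outer induction hypothesis covers all of
  them at once.\<close>

theorem saturated_covers:
  fixes T :: "'a rel set"
  assumes "finite T" "saturated H (O) T" "A \<subseteq> T"
  shows "covers H T A"
  using assms
proof (induction "card T" arbitrary: T A rule: less_induct)
  case (less T)
  note IH_T = less.hyps
  show ?case using less.prems
  proof (induction "card A" arbitrary: A rule: less_induct)
    case (less A)
    note fin = less.prems(1) and sat = less.prems(2) and AT = less.prems(3)
    have cl: "x O y \<in> T" if "x \<in> T" "y \<in> T" for x y using sat that by (simp add: saturated_def)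
    have IH_A: "covers H T (A - {a})" if a: "a \<in> A" for a
    proof (rule less.hyps[OF _ fin sat])
      show "card (A - {a}) < card A"
        using a finite_subset[OF AT fin] by (intro card_Diff1_less)
    qed (use AT in blast)
    consider "A = {}" | "A \<noteq> {}" "\<forall>a\<in>A. (\<lambda>t. t O a) ` T = T \<and> (\<lambda>t. a O t) ` T = T"
      | a where "a \<in> A" "(\<lambda>t. t O a) ` T \<noteq> T" | a where "a \<in> A" "(\<lambda>t. a O t) ` T \<noteq> T"
      by blast
    then show ?case
    proof cases
      case 1
      then show ?thesis by (simp add: covers_empty)
    next
      case 2
      then show ?thesis by (intro covers_units[OF fin sat AT]) auto
    next
      case (3 a)
      then have a: "a \<in> T" using AT by blast
      let ?L = "\<lambda>X. (\<lambda>t. t O a) ` X"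
      have L1T: "?L (insert Id T) \<subseteq> T" using cl a by auto
      obtain V1 :: "nat rel set" and f1 where c1': "GH_on H (O) V1" "Id \<notin> V1" "f1 ` V1 \<subseteq> T"
        "\<forall>x\<in>V1. \<forall>y\<in>V1. f1 x O f1 y \<subseteq> f1 (x O y)" "\<forall>b\<in>A - {a}. \<exists>v\<in>V1. b \<subseteq> f1 v"
        by (rule coversE[OF IH_A[OF 3(1)]])
      note c1 = c1'(1-3) c1'(4,5)[rule_format]
      \<comment> \<open>\<open>Id\<close> is inserted because \<open>a\<close> itself need not lie
        in \<open>T a\<close>.\<close>
      have "covers H (?L (insert Id T)) {a}"
        using saturated_left_ideal[OF sat a, of "insert Id T"] fin
        by (intro covers_monogenic) (auto intro!: image_eqI[of _ _ Id])
      then obtain V2 :: "nat rel set" and f2 where c2': "GH_on H (O) V2" "Id \<notin> V2" "f2 ` V2 \<subseteq> ?L (insert Id T)"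
        "\<forall>x\<in>V2. \<forall>y\<in>V2. f2 x O f2 y \<subseteq> f2 (x O y)" "\<forall>b\<in>{a}. \<exists>v\<in>V2. b \<subseteq> f2 v"
        by (rule coversE)
      note c2 = c2'(1-3) c2'(4,5)[rule_format]
      let ?A = "(\<lambda>(x, y). f1 x O f2 y) ` (V1 \<times> V2)"
      have A3: "?A \<subseteq> ?L T"
      proof clarify
        fix x y assume xy: "x \<in> V1" "y \<in> V2"
        then obtain t where t: "t \<in> insert Id T" "f2 y = t O a" using c2(3) by blast
        then have "f1 x O t \<in> T" using c1(3) xy cl by auto
        then show "f1 x O f2 y \<in> ?L T" using t(2) by (intro image_eqI[of _ _ "f1 x O t"]) (simp add: O_assoc)
      qed
      have "?L T \<subset> T" using 3 cl a by blast
      then have "card (?L T) < card T" using fin by (simp add: psubset_card_mono)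
      then have "covers H (?L T) ?A"
        using IH_T[OF _ _ _ A3] fin saturated_left_ideal[OF sat a, of T] by blast
      then obtain V3 :: "nat rel set" and f3 where c3': "GH_on H (O) V3" "Id \<notin> V3" "f3 ` V3 \<subseteq> ?L T"
        "\<forall>x\<in>V3. \<forall>y\<in>V3. f3 x O f3 y \<subseteq> f3 (x O y)" "\<forall>b\<in>?A. \<exists>v\<in>V3. b \<subseteq> f3 v"
        by (rule coversE)
      note c3 = c3'(1-3) c3'(4,5)[rule_format]
      show ?thesis
      proof (rule covers_merge[OF c1(1) c2(1) c3(1) c1(2) c2(2) c3(2) c1(3) _ _ cl c1(4) c2(4) c3(4)])
        show "f2 ` V2 \<subseteq> T" using c2(3) L1T by (rule subset_trans)
        show "f3 ` V3 \<subseteq> T" using c3(3) psubset_imp_subset[OF \<open>?L T \<subset> T\<close>] by (rule subset_trans)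
        show "\<exists>z\<in>V3. f1 x O f2 y \<subseteq> f3 z" if "x \<in> V1" "y \<in> V2" for x y
          using that by (intro c3(5)) auto
        show "(\<exists>v\<in>V1. b \<subseteq> f1 v) \<or> (\<exists>v\<in>V2. b \<subseteq> f2 v)" if "b \<in> A" for b
          using that c1(5)[of b] c2(5)[of b] by (cases "b = a") simp_all
      qed
    next
      case (4 a)
      then have a: "a \<in> T" using AT by blast
      let ?L = "\<lambda>X. (\<lambda>t. a O t) ` X"
      have L1T: "?L (insert Id T) \<subseteq> T" using cl a by auto
      \<comment> \<open>For a right ideal the block of \<open>a\<close> has to come first in a
        factor, since the composition of the two values must begin with \<open>a\<close>. The two
        covers therefore exchange their roles.\<close>
      obtain V2 :: "nat rel set" and f2 where c2': "GH_on H (O) V2" "Id \<notin> V2" "f2 ` V2 \<subseteq> T"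
        "\<forall>x\<in>V2. \<forall>y\<in>V2. f2 x O f2 y \<subseteq> f2 (x O y)" "\<forall>b\<in>A - {a}. \<exists>v\<in>V2. b \<subseteq> f2 v"
        by (rule coversE[OF IH_A[OF 4(1)]])
      note c2 = c2'(1-3) c2'(4,5)[rule_format]
      have "covers H (?L (insert Id T)) {a}"
        using saturated_right_ideal[OF sat a, of "insert Id T"] fin
        by (intro covers_monogenic) (auto intro!: image_eqI[of _ _ Id])
      then obtain V1 :: "nat rel set" and f1 where c1': "GH_on H (O) V1" "Id \<notin> V1" "f1 ` V1 \<subseteq> ?L (insert Id T)"
        "\<forall>x\<in>V1. \<forall>y\<in>V1. f1 x O f1 y \<subseteq> f1 (x O y)" "\<forall>b\<in>{a}. \<exists>v\<in>V1. b \<subseteq> f1 v"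
        by (rule coversE)
      note c1 = c1'(1-3) c1'(4,5)[rule_format]
      let ?A = "(\<lambda>(x, y). f1 x O f2 y) ` (V1 \<times> V2)"
      have A3: "?A \<subseteq> ?L T"
      proof clarify
        fix x y assume xy: "x \<in> V1" "y \<in> V2"
        then obtain t where t: "t \<in> insert Id T" "f1 x = a O t" using c1(3) by blast
        then have "t O f2 y \<in> T" using c2(3) xy cl by auto
        then show "f1 x O f2 y \<in> ?L T" using t(2) by (intro image_eqI[of _ _ "t O f2 y"]) (simp add: O_assoc)
      qed
      have "?L T \<subset> T" using 4 cl a by blast
      then have "card (?L T) < card T" using fin by (simp add: psubset_card_mono)
      then have "covers H (?L T) ?A"
        using IH_T[OF _ _ _ A3] fin saturated_right_ideal[OF sat a, of T] by blast
      then obtain V3 :: "nat rel set" and f3 where c3': "GH_on H (O) V3" "Id \<notin> V3" "f3 ` V3 \<subseteq> ?L T"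
        "\<forall>x\<in>V3. \<forall>y\<in>V3. f3 x O f3 y \<subseteq> f3 (x O y)" "\<forall>b\<in>?A. \<exists>v\<in>V3. b \<subseteq> f3 v"
        by (rule coversE)
      note c3 = c3'(1-3) c3'(4,5)[rule_format]
      show ?thesis
      proof (rule covers_merge[OF c1(1) c2(1) c3(1) c1(2) c2(2) c3(2) _ c2(3) _ cl c1(4) c2(4) c3(4)])
        show "f1 ` V1 \<subseteq> T" using c1(3) L1T by (rule subset_trans)
        show "f3 ` V3 \<subseteq> T" using c3(3) psubset_imp_subset[OF \<open>?L T \<subset> T\<close>] by (rule subset_trans)
        show "\<exists>z\<in>V3. f1 x O f2 y \<subseteq> f3 z" if "x \<in> V1" "y \<in> V2" for x y
          using that by (intro c3(5)) auto
        show "(\<exists>v\<in>V1. b \<subseteq> f1 v) \<or> (\<exists>v\<in>V2. b \<subseteq> f2 v)" if "b \<in> A" for b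
          using that c1(5)[of b] c2(5)[of b] by (cases "b = a") simp_all
      qed
    qed
  qed
qed

section \<open>Pointlike sets as the least closed family\<close>

lemma group_on_translations:
  assumes sg: "semigroup_on m W" and "W \<noteq> {}"
    and tr: "\<And>w. w \<in> W \<Longrightarrow> m w ` W = W" "\<And>w. w \<in> W \<Longrightarrow> (\<lambda>x. m x w) ` W = W"
  obtains e where "group_on m W e"
proof -
  have assoc: "m (m x y) z = m x (m y z)" if "x \<in> W" "y \<in> W" "z \<in> W" for x y z
    using sg that by (simp add: semigroup_on_def)
  obtain w where w: "w \<in> W" using \<open>W \<noteq> {}\<close> by blast
  have L: "\<exists>z\<in>W. y = m x z" if "x \<in> W" "y \<in> W" for x y
    using tr(1)[OF that(1)] that(2) by (metis imageE)
  have R: "\<exists>z\<in>W. y = m z x" if "x \<in> W" "y \<in> W" for x y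
    using tr(2)[OF that(1)] that(2) by (metis imageE)
  \<comment> \<open>A right identity for the single element \<open>w\<close> is one for all of
    \<open>W\<close>, because every element is a left multiple of \<open>w\<close>; dually for
    \<open>e'\<close>.\<close>
  obtain e where e: "e \<in> W" "m w e = w" using L[OF w w] by metis
  obtain e' where e': "e' \<in> W" "m e' w = w" using R[OF w w] by metis
  have re: "m x e = x" if "x \<in> W" for x
    using R[OF w that] assoc w e by metis
  have le: "m e' x = x" if "x \<in> W" for x
    using L[OF w that] assoc w e' by metis
  have ee: "e' = e" using re[OF e'(1)] le[OF e(1)] by simp
  have "\<exists>y\<in>W. m x y = e \<and> m y x = e" if x: "x \<in> W" for x
  proof -
    obtain y where y: "y \<in> W" "m x y = e" using L[OF x e(1)] by metis
    obtain z where z: "z \<in> W" "m z x = e" using R[OF x e(1)] by metis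
    have "z = m z (m x y)" using y re z by simp
    also have "\<dots> = y" using assoc[OF z(1) x y(1)] z le ee y by simp
    finally show ?thesis using y z by blast
  qed
  then have "group_on m W e"
    unfolding group_on_def using sg e(1) re le ee by simp
  then show thesis by (rule that)
qed

lemma is_group_restrict:
  "is_group (restrict_sgp S A) \<longleftrightarrow> (\<exists>e. group_on (sg_mult S) A e)"
proof
  assume "is_group (restrict_sgp S A)"
  then obtain e where "group \<lparr>carrier = A, monoid.mult = sg_mult S, one = e\<rparr>"
    unfolding is_group_def restrict_sgp_def by auto
  then interpret group "\<lparr>carrier = A, monoid.mult = sg_mult S, one = e\<rparr>" .
  let ?G = "\<lparr>carrier = A, monoid.mult = sg_mult S, one = e\<rparr>"
  have "group_on (sg_mult S) A e"
    unfolding group_on_def semigroup_on_def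
  proof (intro conjI ballI)
    fix x assume x: "x \<in> A"
    show "\<exists>y\<in>A. sg_mult S x y = e \<and> sg_mult S y x = e"
      using r_inv[of x] l_inv[of x] inv_closed[of x] x by (intro bexI[of _ "inv\<^bsub>?G\<^esub> x"]) simp_all
  qed (use m_closed m_assoc l_one r_one one_closed in simp_all)
  then show "\<exists>e. group_on (sg_mult S) A e" ..
next
  assume "\<exists>e. group_on (sg_mult S) A e"
  then obtain e where e: "group_on (sg_mult S) A e" ..
  have "group \<lparr>carrier = A, monoid.mult = sg_mult S, one = e\<rparr>"
  proof (rule groupI)
    show "\<exists>y\<in>carrier \<lparr>carrier = A, monoid.mult = sg_mult S, one = e\<rparr>.
        y \<otimes>\<^bsub>\<lparr>carrier = A, monoid.mult = sg_mult S, one = e\<rparr>\<^esub> x = \<one>\<^bsub>\<lparr>carrier = A, monoid.mult = sg_mult S, one = e\<rparr>\<^esub>"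
      if x: "x \<in> carrier \<lparr>carrier = A, monoid.mult = sg_mult S, one = e\<rparr>" for x
      using group_onD(5)[OF e, of x] x by auto
  qed (simp_all add: group_onD(1-4,6)[OF e])
  then show "is_group (restrict_sgp S A)" unfolding is_group_def restrict_sgp_def by auto
qed

lemma finite_semigroup_iff:
  "finite_semigroup S \<longleftrightarrow> finite (carrier S) \<and> carrier S \<noteq> {} \<and> semigroup_on (sg_mult S) (carrier S)"
  by (simp add: finite_semigroup_def semigroup_on_def)

section \<open>Closure properties of a pseudovariety in terms of homomorphisms\<close>

locale pseudovar =
  fixes H :: "nat sgp set"
  assumes H: "pseudovariety H"
begin

lemma fin: "Q \<in> H \<Longrightarrow> finite_semigroup Q"
  using H unfolding pseudovariety_def by blast

lemma sub: "Q \<in> H \<Longrightarrow> subsemigroup A Q \<Longrightarrow> restrict_sgp Q A \<in> H"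
  using H unfolding pseudovariety_def by blast

lemma quot: "Q \<in> H \<Longrightarrow> finite_semigroup T \<Longrightarrow> h \<in> sgp_hom Q T \<Longrightarrow> h ` carrier Q = carrier T \<Longrightarrow> T \<in> H"
  using H unfolding pseudovariety_def by blast

lemma prod: "\<forall>i<n. F i \<in> H \<Longrightarrow> finite_semigroup P \<Longrightarrow> h \<in> sgp_hom P (Prod_sgp {..<n} F) \<Longrightarrow>
    bij_betw h (carrier P) (carrier (Prod_sgp {..<(n::nat)} F)) \<Longrightarrow> P \<in> H"
  using H unfolding pseudovariety_def by blast

text \<open>\<open>T\<close> divides the member \<open>Q\<close> of \<open>H\<close> that contains
  the values of \<open>h\<close>: it is a quotient of the subsemigroup formed by these values,
  because \<open>p\<close> identifies all that \<open>h\<close> identifies.\<close>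

lemma hom_image_in:
  assumes h: "hom_into H m A h" and A: "semigroup_on m A" "A \<noteq> {}" "finite A"
    and p: "\<And>x y. x \<in> A \<Longrightarrow> y \<in> A \<Longrightarrow> h x = h y \<Longrightarrow> p x = p y"
    and T: "carrier T = p ` A" "\<And>x y. x \<in> A \<Longrightarrow> y \<in> A \<Longrightarrow> sg_mult T (p x) (p y) = p (m x y)"
  shows "T \<in> H"
proof -
  from h obtain Q where Q: "Q \<in> H" "h ` A \<subseteq> carrier Q"
    "\<forall>x\<in>A. \<forall>y\<in>A. h (m x y) = sg_mult Q (h x) (h y)" by (rule hom_intoE)
  have cl: "m x y \<in> A" if "x \<in> A" "y \<in> A" for x y using A(1) that by (simp add: semigroup_on_def)
  have assoc: "m (m x y) z = m x (m y z)" if "x \<in> A" "y \<in> A" "z \<in> A" for x y z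
    using A(1) that by (simp add: semigroup_on_def)
  have Qm: "sg_mult Q (h x) (h y) = h (m x y)" if "x \<in> A" "y \<in> A" for x y using Q(3) that by simp
  have "subsemigroup (h ` A) Q" unfolding subsemigroup_def using Q(2) A(2) cl by (auto simp: Qm)
  then have QA: "restrict_sgp Q (h ` A) \<in> H" using sub Q(1) by blast
  define k where "k = (\<lambda>q. p (inv_into A h q))"
  have kh: "k (h x) = p x" if "x \<in> A" for x
    unfolding k_def using that by (intro p) (auto simp: f_inv_into_f inv_into_into)
  show "T \<in> H"
  proof (rule quot[OF QA])
    show "finite_semigroup T"
      unfolding finite_semigroup_iff T(1) semigroup_on_def using A cl by (auto simp: T(2) assoc)
    show "k ` carrier (restrict_sgp Q (h ` A)) = carrier T"
      unfolding restrict_sgp_def T(1) by (auto simp: kh image_image)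
    show "k \<in> sgp_hom (restrict_sgp Q (h ` A)) T"
      unfolding sgp_hom_def restrict_sgp_def T(1) using cl by (auto simp: kh T(2) Qm)
  qed
qed

lemma GH_on_iff:
  assumes S: "finite_semigroup S"
  shows "S \<in> GH H \<longleftrightarrow> GH_on H (sg_mult S) (carrier S)"
proof
  assume G: "S \<in> GH H"
  show "GH_on H (sg_mult S) (carrier S)"
    unfolding GH_on_def
  proof (intro conjI allI impI)
    show "finite (carrier S)" "semigroup_on (sg_mult S) (carrier S)"
      using S by (simp_all add: finite_semigroup_iff)
    fix A e assume A: "A \<subseteq> carrier S \<and> group_on (sg_mult S) A e"
    then have grp: "group_on (sg_mult S) A e" by simp
    have "subsemigroup A S" unfolding subsemigroup_def using A group_onD[OF grp] by blast
    then have "restrict_sgp S A \<in> H" using G grp is_group_restrict unfolding GH_def by blast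
    then have "hom_into H (sg_mult S) A (\<lambda>x. x)"
      unfolding hom_into_def by (rule bexI[rotated]) (simp add: restrict_sgp_def)
    then show "\<exists>h. hom_into H (sg_mult S) A h \<and> inj_on h A" using inj_on_id2 by blast
  qed
next
  assume G: "GH_on H (sg_mult S) (carrier S)"
  show "S \<in> GH H"
    unfolding GH_def
  proof (intro CollectI conjI S allI impI)
    fix A assume A: "subsemigroup A S \<and> is_group (restrict_sgp S A)"
    then obtain e where e: "group_on (sg_mult S) A e" unfolding is_group_restrict by blast
    have AS: "A \<subseteq> carrier S" using A by (simp add: subsemigroup_def)
    then obtain h where h: "hom_into H (sg_mult S) A h" "inj_on h A"
      using G e unfolding GH_on_def by blast
    show "restrict_sgp S A \<in> H"
    proof (rule hom_image_in[OF h(1), of "\<lambda>x. x"])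
      show "semigroup_on (sg_mult S) A" using e by (simp add: group_on_def)
      show "A \<noteq> {}" using group_onD(1)[OF e] by blast
      show "finite A" using AS S finite_subset by (auto simp: finite_semigroup_iff)
      show "x = y" if "x \<in> A" "y \<in> A" "h x = h y" for x y using h(2) that by (simp add: inj_on_eq_iff)
    qed (simp_all add: restrict_sgp_def)
  qed
qed

text \<open>The one-element semigroup is in \<open>H\<close> as the empty product. This guarantees
  that a homomorphism with smallest kernel exists.\<close>

lemma hom_trivial: "hom_into H m G (\<lambda>_. 0)"
proof -
  let ?P = "\<lparr>carrier = {0}, sg_mult = (\<lambda>_ _. 0)\<rparr> :: nat sgp"
  have "?P \<in> H"
  proof (rule prod[of 0 "\<lambda>_. ?P" ?P "\<lambda>_ _. undefined"])
    show "finite_semigroup ?P" by (simp add: finite_semigroup_def)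
    show "(\<lambda>_ _. undefined) \<in> sgp_hom ?P (Prod_sgp {..<0::nat} (\<lambda>_. ?P))"
      unfolding sgp_hom_def
    proof (intro CollectI conjI ballI)
      show "(\<lambda>_ _. undefined) \<in> carrier ?P \<rightarrow> carrier (Prod_sgp {..<0::nat} (\<lambda>_. ?P))"
        unfolding Prod_sgp_def partial_object.simps lessThan_0 PiE_empty_domain by simp
      show "(\<lambda>_. undefined) = sg_mult (Prod_sgp {..<0::nat} (\<lambda>_. ?P)) (\<lambda>_. undefined) (\<lambda>_. undefined)"
        by (rule ext) (simp add: Prod_sgp_def)
    qed
    show "bij_betw (\<lambda>_ _. undefined) (carrier ?P) (carrier (Prod_sgp {..<0::nat} (\<lambda>_. ?P)))"
      unfolding Prod_sgp_def partial_object.simps lessThan_0 PiE_empty_domain by (simp add: bij_betw_def)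
  qed simp
  then show ?thesis unfolding hom_into_def by (rule bexI[rotated]) auto
qed

text \<open>The kernel of the pair is the intersection of the two kernels. On a finite group a
  kernel of least size is therefore contained in every other kernel.\<close>

lemma hom_pair:
  assumes "hom_into H m G h1" "hom_into H m G h2"
  shows "hom_into H m G (\<lambda>x. prod_encode (h1 x, h2 x))"
proof -
  from assms(1) obtain Q1 where Q1: "Q1 \<in> H" "h1 ` G \<subseteq> carrier Q1"
    "\<forall>x\<in>G. \<forall>y\<in>G. h1 (m x y) = sg_mult Q1 (h1 x) (h1 y)" by (rule hom_intoE)
  from assms(2) obtain Q2 where Q2: "Q2 \<in> H" "h2 ` G \<subseteq> carrier Q2"
    "\<forall>x\<in>G. \<forall>y\<in>G. h2 (m x y) = sg_mult Q2 (h2 x) (h2 y)" by (rule hom_intoE)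
  define F where "F i = (if i = 0 then Q1 else Q2)" for i :: nat
  define pm where "pm p q = prod_encode (sg_mult Q1 (fst (prod_decode p)) (fst (prod_decode q)),
    sg_mult Q2 (snd (prod_decode p)) (snd (prod_decode q)))" for p q
  define P where "P = (\<lparr>carrier = prod_encode ` (carrier Q1 \<times> carrier Q2), sg_mult = pm\<rparr> :: nat sgp)"
  define k where "k p = (\<lambda>i\<in>{..<2::nat}. if i = 0 then fst (prod_decode p) else snd (prod_decode p))" for p
  have "P \<in> H"
  proof (rule prod[of 2 F P k])
    show "\<forall>i<2. F i \<in> H" using Q1 Q2 by (simp add: F_def)
    have fin12: "finite_semigroup Q1" "finite_semigroup Q2" using fin Q1 Q2 by blast+
    have pm: "pm (prod_encode (a, b)) (prod_encode (c, d)) = prod_encode (sg_mult Q1 a c, sg_mult Q2 b d)"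
      for a b c d by (simp add: pm_def)
    have cl: "sg_mult Q1 a c \<in> carrier Q1" if "a \<in> carrier Q1" "c \<in> carrier Q1" for a c
      using fin12(1) that by (simp add: finite_semigroup_def)
    have cl': "sg_mult Q2 a c \<in> carrier Q2" if "a \<in> carrier Q2" "c \<in> carrier Q2" for a c
      using fin12(2) that by (simp add: finite_semigroup_def)
    show "finite_semigroup P"
      unfolding finite_semigroup_def P_def partial_object.simps sgp.simps
    proof (intro conjI)
      show "finite (prod_encode ` (carrier Q1 \<times> carrier Q2))"
        "prod_encode ` (carrier Q1 \<times> carrier Q2) \<noteq> {}"
        using fin12 by (simp_all add: finite_semigroup_def)
      show "\<forall>x\<in>prod_encode ` (carrier Q1 \<times> carrier Q2). \<forall>y\<in>prod_encode ` (carrier Q1 \<times> carrier Q2).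
          pm x y \<in> prod_encode ` (carrier Q1 \<times> carrier Q2)"
        using cl cl' by (auto simp: pm)
      show "\<forall>x\<in>prod_encode ` (carrier Q1 \<times> carrier Q2). \<forall>y\<in>prod_encode ` (carrier Q1 \<times> carrier Q2).
          \<forall>z\<in>prod_encode ` (carrier Q1 \<times> carrier Q2). pm (pm x y) z = pm x (pm y z)"
        using fin12 by (auto simp: pm finite_semigroup_def)
    qed
    show "k \<in> sgp_hom P (Prod_sgp {..<2} F)"
      unfolding sgp_hom_def
    proof (intro CollectI conjI ballI)
      show "k \<in> carrier P \<rightarrow> carrier (Prod_sgp {..<2} F)"
        by (auto simp: k_def P_def Prod_sgp_def F_def split: if_splits)
      show "k (sg_mult P x y) = sg_mult (Prod_sgp {..<2} F) (k x) (k y)" for x y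
        by (rule ext) (simp add: k_def P_def Prod_sgp_def F_def pm_def)
    qed
    show "bij_betw k (carrier P) (carrier (Prod_sgp {..<2} F))"
      unfolding bij_betw_def
    proof
      have "x = y" if "k x = k y" for x y
      proof -
        have "k x 0 = k y 0" "k x 1 = k y 1" using that by simp_all
        then have "prod_decode x = prod_decode y" by (simp add: k_def prod_eq_iff)
        then show ?thesis by (metis prod_decode_inverse)
      qed
      then show "inj_on k (carrier P)" by (simp add: inj_on_def)
      show "k ` carrier P = carrier (Prod_sgp {..<2} F)"
      proof (intro equalityI subsetI)
        fix f assume "f \<in> k ` carrier P"
        then show "f \<in> carrier (Prod_sgp {..<2} F)"
          by (auto simp: k_def P_def Prod_sgp_def F_def split: if_splits)
      next
        fix f assume "f \<in> carrier (Prod_sgp {..<2} F)"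
        then have f: "f \<in> (\<Pi>\<^sub>E i\<in>{..<2}. carrier (F i))" by (simp add: Prod_sgp_def)
        then have "f 0 \<in> carrier Q1" "f 1 \<in> carrier Q2"
          using PiE_mem[OF f, of 0] PiE_mem[OF f, of 1] by (simp_all add: F_def)
        moreover have "k (prod_encode (f 0, f 1)) = f"
        proof
          fix i
          show "k (prod_encode (f 0, f 1)) i = f i"
            using PiE_arb[OF f, of i] less_2_cases[of i] by (cases "i < 2") (auto simp: k_def)
        qed
        ultimately show "f \<in> k ` carrier P"
          unfolding P_def by (intro image_eqI[of _ _ "prod_encode (f 0, f 1)"]) auto
      qed
    qed
  qed
  then show ?thesis
    unfolding hom_into_def
  proof (rule bexI[rotated], intro conjI ballI)
    show "(\<lambda>x. prod_encode (h1 x, h2 x)) ` G \<subseteq> carrier P" using Q1(2) Q2(2)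
      by (auto simp: P_def image_subset_iff inj_image_mem_iff[OF inj_prod_encode])
  qed (use Q1 Q2 in \<open>simp add: P_def pm_def\<close>)
qed


text \<open>The values of \<open>p\<close> may have any type; numbering them by \<open>d\<close>
  produces a copy with carrier in \<open>nat\<close>, which \<open>hom_image_in\<close> places in
  \<open>H\<close>.\<close>

lemma embed_quotient:
  assumes j: "hom_into H m A j" "inj_on j A" and A: "semigroup_on m A" "A \<noteq> {}" "finite A"
    and p: "\<And>x y. x \<in> A \<Longrightarrow> y \<in> A \<Longrightarrow> p (m x y) = m' (p x) (p y)"
  shows "\<exists>d. hom_into H m' (p ` A) d \<and> inj_on d (p ` A)"
proof -
  obtain d :: "'b \<Rightarrow> nat" where d: "inj_on d (p ` A)"
    using finite_imp_inj_to_nat_seg[of "p ` A"] A(3) by blast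
  let ?i = "inv_into (p ` A) d"
  define T where "T = (\<lparr>carrier = (d \<circ> p) ` A, sg_mult = \<lambda>x y. d (m' (?i x) (?i y))\<rparr> :: nat sgp)"
  have cl: "m x y \<in> A" if "x \<in> A" "y \<in> A" for x y using A(1) that by (simp add: semigroup_on_def)
  have Tm: "sg_mult T (d (p x)) (d (p y)) = d (m' (p x) (p y))" if "x \<in> A" "y \<in> A" for x y
    using d that by (simp add: T_def)
  have "T \<in> H"
  proof (rule hom_image_in[OF j(1) A, of "d \<circ> p"])
    show "(d \<circ> p) x = (d \<circ> p) y" if "x \<in> A" "y \<in> A" "j x = j y" for x y
      using j(2) that by (simp add: inj_on_eq_iff)
    show "carrier T = (d \<circ> p) ` A" by (simp add: T_def)
    show "sg_mult T ((d \<circ> p) x) ((d \<circ> p) y) = (d \<circ> p) (m x y)" if "x \<in> A" "y \<in> A" for x y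
      using Tm that p by simp
  qed
  then have "hom_into H m' (p ` A) d"
    unfolding hom_into_def
  proof (rule bexI[rotated], intro conjI ballI)
    show "d ` p ` A \<subseteq> carrier T" by (simp add: T_def image_comp)
    show "d (m' x y) = sg_mult T (d x) (d y)" if "x \<in> p ` A" "y \<in> p ` A" for x y
      using that by (auto simp: Tm)
  qed
  then show ?thesis using d by blast
qed

end

definition setmult :: "'a sgp \<Rightarrow> 'a set \<Rightarrow> 'a set \<Rightarrow> 'a set" where
  "setmult S X Y = (\<lambda>(x, y). sg_mult S x y) ` (X \<times> Y)"

definition pl_closed :: "nat sgp set \<Rightarrow> 'a sgp \<Rightarrow> 'a set set \<Rightarrow> bool" where
  "pl_closed H S C \<longleftrightarrow> C \<subseteq> Pow (carrier S) - {{}} \<and> (\<forall>s\<in>carrier S. {s} \<in> C) \<and>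
     (\<forall>X\<in>C. \<forall>Y. Y \<subseteq> X \<and> Y \<noteq> {} \<longrightarrow> Y \<in> C) \<and> saturated H (setmult S) C"

lemma setmultI: "x \<in> X \<Longrightarrow> y \<in> Y \<Longrightarrow> sg_mult S x y \<in> setmult S X Y"
  unfolding setmult_def by force

lemma setmultE:
  assumes "z \<in> setmult S X Y"
  obtains x y where "x \<in> X" "y \<in> Y" "z = sg_mult S x y"
  using assms unfolding setmult_def by auto

section \<open>The pointlike sets form a closed family\<close>

context pseudovar
begin

text \<open>
  A relational morphism \<open>R\<close> from a group to a semigroup in \<open>GH H\<close> restricts to a subgroup \<open>W\<close> of
  the graph (a minimal subsemigroup projecting onto the group); the projection of \<open>W\<close> to \<open>V\<close> lies
  in \<open>H\<close>, and so does its quotient \<open>G / N\<close>, where \<open>N\<close> is the fibre of \<open>W\<close> over its identity.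
\<close>

lemma hom_below_relation:
  fixes m :: "'a \<Rightarrow> 'a \<Rightarrow> 'a" and n :: "'b \<Rightarrow> 'b \<Rightarrow> 'b"
  assumes G: "group_on m G u" "finite G" and V: "GH_on H n V"
    and R: "R \<subseteq> G \<times> V" "fst ` R = G"
      "\<And>x v y w. (x, v) \<in> R \<Longrightarrow> (y, w) \<in> R \<Longrightarrow> (m x y, n v w) \<in> R"
  obtains h \<epsilon> where "hom_into H m G h" "\<forall>g\<in>G. h g = h u \<longrightarrow> (g, \<epsilon>) \<in> R"
proof -
  note grp = group_onD[OF G(1)]
  have Vfin: "finite V" and Vsg: "semigroup_on n V" using V by (simp_all add: GH_on_def)
  define t where "t = (\<lambda>(x, v) (y, w). (m x y, n v w))"
  define good where "good W \<longleftrightarrow> W \<subseteq> R \<and> fst ` W = G \<and> (\<forall>a\<in>W. \<forall>b\<in>W. t a b \<in> W)" for W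
  have "good R" using R by (auto simp: good_def t_def)
  then obtain W where W: "good W" "\<And>W'. good W' \<Longrightarrow> card W \<le> card W'"
    using ex_has_least_nat[of good R card] by blast
  have WR: "W \<subseteq> R" "fst ` W = G" and Wt: "\<And>a b. a \<in> W \<Longrightarrow> b \<in> W \<Longrightarrow> t a b \<in> W"
    using W(1) by (auto simp: good_def)
  have RGV: "a \<in> R \<Longrightarrow> fst a \<in> G \<and> snd a \<in> V" for a using R(1) by auto
  have WGV: "a \<in> W \<Longrightarrow> fst a \<in> G \<and> snd a \<in> V" for a using RGV WR(1) by blast
  have "finite R" using R(1) G(2) Vfin finite_subset by blast
  then have finW: "finite W" using WR(1) finite_subset by blast
  have min: "W' = W" if "W' \<subseteq> W" "good W'" for W'
    using card_seteq[OF finW that(1)] W(2)[OF that(2)] by blast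
  have tass: "t (t a b) d = t a (t b d)" if "a \<in> W" "b \<in> W" "d \<in> W" for a b d
    using WGV[OF that(1)] WGV[OF that(2)] WGV[OF that(3)] grp(6) Vsg
    by (simp add: t_def split_beta semigroup_on_def)
  have sg: "semigroup_on t W" unfolding semigroup_on_def using Wt tass by blast
  have fst_t: "fst (t a b) = m (fst a) (fst b)" "snd (t a b) = n (snd a) (snd b)" for a b
    by (simp_all add: t_def split_beta)
  \<comment> \<open>The translate of \<open>W\<close> is again a subsemigroup, and it still projects
    onto \<open>G\<close> because \<open>fst w\<close> is invertible there; minimality gives
    equality. Together with \<open>trR\<close> this makes \<open>W\<close> a group.\<close>
  have trL: "t w ` W = W" if w: "w \<in> W" for w
  proof (rule min)
    show "t w ` W \<subseteq> W" using Wt w by blast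
    show "good (t w ` W)" unfolding good_def
    proof (intro conjI ballI)
      show "t w ` W \<subseteq> R" using Wt w WR(1) by blast
      show "fst ` t w ` W = G"
      proof (intro equalityI subsetI)
        fix x assume x: "x \<in> G"
        have wG: "fst w \<in> G" using WGV w by blast
        obtain y where y: "y \<in> G" "m (fst w) y = u" using grp(5)[OF wG] by blast
        have "m y x \<in> fst ` W" using WR(2) grp(2) y x by simp
        then obtain b where b: "b \<in> W" "fst b = m y x" by force
        have "fst (t w b) = x" using fst_t b y x wG grp(3) grp(6)[OF wG y(1) x] by simp
        then show "x \<in> fst ` t w ` W" using b by force
      qed (use Wt w WGV in blast)
      fix a b assume "a \<in> t w ` W" "b \<in> t w ` W"
      then obtain a' b' where ab: "a' \<in> W" "a = t w a'" "b' \<in> W" "b = t w b'" by blast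
      then have "t a b = t w (t a' (t w b'))" using tass Wt w by simp
      then show "t a b \<in> t w ` W" using ab Wt w by blast
    qed
  qed
  have trR: "(\<lambda>x. t x w) ` W = W" if w: "w \<in> W" for w
  proof (rule min)
    show "(\<lambda>x. t x w) ` W \<subseteq> W" using Wt w by blast
    show "good ((\<lambda>x. t x w) ` W)" unfolding good_def
    proof (intro conjI ballI)
      show "(\<lambda>x. t x w) ` W \<subseteq> R" using Wt w WR(1) by blast
      show "fst ` (\<lambda>x. t x w) ` W = G"
      proof (intro equalityI subsetI)
        fix x assume x: "x \<in> G"
        have wG: "fst w \<in> G" using WGV w by blast
        obtain y where y: "y \<in> G" "m y (fst w) = u" using grp(5)[OF wG] by blast
        have "m x y \<in> fst ` W" using WR(2) grp(2) y x by simp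
        then obtain b where b: "b \<in> W" "fst b = m x y" by force
        have "fst (t b w) = x" using fst_t b y x wG grp(4) grp(6)[OF x y(1) wG] by simp
        then show "x \<in> fst ` (\<lambda>x. t x w) ` W" using b by force
      qed (use Wt w WGV in blast)
      fix a b assume "a \<in> (\<lambda>x. t x w) ` W" "b \<in> (\<lambda>x. t x w) ` W"
      then obtain a' b' where ab: "a' \<in> W" "a = t a' w" "b' \<in> W" "b = t b' w" by blast
      then have "t a b = t (t (t a' w) b') w" using tass Wt w by simp
      then show "t a b \<in> (\<lambda>x. t x w) ` W" using ab Wt w by blast
    qed
  qed
  have "W \<noteq> {}" using WR(2) grp(1) by blast
  then obtain e where e: "group_on t W e" using group_on_translations[OF sg _ trL trR] by blast
  note Wgrp = group_onD[OF e]
  define \<epsilon> where "\<epsilon> = snd e"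
  have eG: "fst e \<in> G" using WGV Wgrp(1) by blast
  have "m (fst e) (fst e) = fst e" using Wgrp(3)[OF Wgrp(1)] fst_t by metis
  moreover obtain y where y: "y \<in> G" "m y (fst e) = u" using grp(5)[OF eG] by blast
  ultimately have fe: "fst e = u" using grp(3)[OF eG] grp(6)[OF y(1) eG eG] by metis
  then have e_eq: "e = (u, \<epsilon>)" by (simp add: \<epsilon>_def prod_eq_iff)
  let ?V = "snd ` W"
  have Vgrp: "group_on n ?V \<epsilon>" unfolding \<epsilon>_def by (rule group_on_image[OF e]) (simp add: fst_t)
  have "?V \<subseteq> V" using WGV by blast
  then obtain j where j: "hom_into H n ?V j" "inj_on j ?V"
    using V Vgrp unfolding GH_on_def by blast
  \<comment> \<open>Over the projection of \<open>W\<close> these fibres are the cosets of the fibre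
    over \<open>\<epsilon>\<close>. They multiply like the elements below them, so they realize
    \<open>G / N\<close> as a quotient of a group that embeds into a member of
    \<open>H\<close>.\<close>
  define p where "p v = {x. (x, v) \<in> W}" for v
  define m' where "m' X Y = {m x y |x y. x \<in> X \<and> y \<in> Y}" for X Y
  have WtI: "(m x y, n v w) \<in> W" if "(x, v) \<in> W" "(y, w) \<in> W" for x y v w
    using Wt[OF that] by (simp add: t_def)
  have inv: "\<exists>x' v'. (x', v') \<in> W \<and> m x x' = u \<and> m x' x = u \<and> n v v' = \<epsilon> \<and> n v' v = \<epsilon>"
    if xv: "(x, v) \<in> W" for x v
  proof -
    obtain b where "b \<in> W" "t (x, v) b = e" "t b (x, v) = e" using Wgrp(5)[OF xv] by blast
    then show ?thesis by (cases b) (auto simp: t_def e_eq)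
  qed
  have WG: "x \<in> G" "v \<in> ?V" if "(x, v) \<in> W" for x v using WGV[OF that] that by force+
  note Vg = group_onD[OF Vgrp]
  have p_mult: "p (n v w) = m' (p v) (p w)" if vw: "v \<in> ?V" "w \<in> ?V" for v w
  proof (intro equalityI subsetI)
    fix x assume "x \<in> m' (p v) (p w)"
    then show "x \<in> p (n v w)" using WtI WG by (auto simp: m'_def p_def)
  next
    fix x assume "x \<in> p (n v w)"
    then have x: "(x, n v w) \<in> W" by (simp add: p_def)
    obtain g where g: "(g, v) \<in> W" using vw(1) by auto
    obtain g' v' where g': "(g', v') \<in> W" "m g g' = u" "n v' v = \<epsilon>" using inv[OF g] by metis
    have "n v' (n v w) = n (n v' v) w" using Vg(6)[OF WG(2)[OF g'(1)] vw] by simp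
    then have "n v' (n v w) = w" using g'(3) Vg(3)[OF vw(2)] by simp
    then have gx: "(m g' x, w) \<in> W" using WtI[OF g'(1) x] by simp
    have "m g (m g' x) = m (m g g') x" using grp(6) WG(1) g g'(1) x by metis
    then have "x = m g (m g' x)" using g'(2) grp(3) WG(1)[OF x] by simp
    then show "x \<in> m' (p v) (p w)" using g gx WG(1) unfolding m'_def p_def by blast
  qed
  have p_eq: "p v \<subseteq> p w" if "(x, v) \<in> W" "(x, w) \<in> W" for x v w
  proof
    fix y assume "y \<in> p v"
    then have y: "(y, v) \<in> W" by (simp add: p_def)
    note inv1 = inv[OF that(1)]
    obtain x' v' where x': "(x', v') \<in> W" "m x' x = u" "n v v' = \<epsilon>" using inv1 by metis
    have "(m (m y x') x, n (n v v') w) \<in> W" using WtI[OF WtI[OF y x'(1)] that(2)] .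
    moreover have "m (m y x') x = y"
      using grp(6)[OF WG(1)[OF y] WG(1)[OF x'(1)] WG(1)[OF that(1)]] x'(2) grp(4) WG(1)[OF y] by simp
    moreover have "n (n v v') w = w" using x'(3) Vg(3) WG(2)[OF that(2)] by simp
    ultimately show "y \<in> p w" using WG(1)[OF y] by (simp add: p_def)
  qed
  have "semigroup_on n ?V" using Vgrp by (simp add: group_on_def)
  moreover have "?V \<noteq> {}" using \<open>W \<noteq> {}\<close> by simp
  moreover have "finite ?V" using finW by simp
  ultimately obtain d where d: "hom_into H m' (p ` ?V) d" "inj_on d (p ` ?V)"
    using embed_quotient[OF j, of p m'] p_mult by blast
  from d(1) obtain Q where Q: "Q \<in> H" "d ` p ` ?V \<subseteq> carrier Q"
    "\<forall>x\<in>p ` ?V. \<forall>y\<in>p ` ?V. d (m' x y) = sg_mult Q (d x) (d y)" by (rule hom_intoE)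
  have "\<forall>x\<in>G. \<exists>v. (x, v) \<in> W" using WR(2) by force
  \<comment> \<open>Any choice of \<open>\<nu>\<close> leads to the same map, since two fibres with
    a common element coincide by \<open>p_eq\<close>.\<close>
  then obtain \<nu> where \<nu>: "\<forall>x\<in>G. (x, \<nu> x) \<in> W" by metis
  then have \<nu>V: "\<nu> x \<in> ?V" if "x \<in> G" for x using that WG by blast
  have "hom_into H m G (\<lambda>x. d (p (\<nu> x)))"
    unfolding hom_into_def
  proof (rule bexI[OF _ Q(1)], intro conjI ballI)
    show "(\<lambda>x. d (p (\<nu> x))) ` G \<subseteq> carrier Q"
    proof clarify
      fix x assume "x \<in> G"
      then have "d (p (\<nu> x)) \<in> d ` p ` ?V" using \<nu>V by (intro imageI)
      then show "d (p (\<nu> x)) \<in> carrier Q" using Q(2) by (rule subsetD[rotated])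
    qed
    fix x y assume xy: "x \<in> G" "y \<in> G"
    have a: "(m x y, \<nu> (m x y)) \<in> W" "(m x y, n (\<nu> x) (\<nu> y)) \<in> W"
      using \<nu>[rule_format, OF grp(2)[OF xy]]
        WtI[OF \<nu>[rule_format, OF xy(1)] \<nu>[rule_format, OF xy(2)]] .
    have "p (\<nu> (m x y)) = p (n (\<nu> x) (\<nu> y))"
      using p_eq[OF a] p_eq[OF a(2,1)] by (rule subset_antisym)
    then have "p (\<nu> (m x y)) = m' (p (\<nu> x)) (p (\<nu> y))" using p_mult \<nu>V xy by simp
    then show "d (p (\<nu> (m x y))) = sg_mult Q (d (p (\<nu> x))) (d (p (\<nu> y)))"
      using Q(3)[rule_format, OF imageI[OF \<nu>V] imageI[OF \<nu>V], OF xy] by simp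
  qed
  moreover have "\<forall>g\<in>G. d (p (\<nu> g)) = d (p (\<nu> u)) \<longrightarrow> (g, \<epsilon>) \<in> R"
  proof (intro ballI impI)
    fix g assume g: "g \<in> G" "d (p (\<nu> g)) = d (p (\<nu> u))"
    then have "p (\<nu> g) = p (\<nu> u)" using d(2) \<nu>V grp(1) by (simp add: inj_on_eq_iff)
    then have "(g, \<nu> u) \<in> W" using \<nu> g(1) by (auto simp: p_def)
    moreover have "p (\<nu> u) \<subseteq> p \<epsilon>" using p_eq[of u] \<nu> grp(1) Wgrp(1) e_eq by blast
    ultimately have "(g, \<epsilon>) \<in> W" using g(1) by (auto simp: p_def)
    then show "(g, \<epsilon>) \<in> R" using WR(1) by blast
  qed
  ultimately show thesis by (rule that)
qed

text \<open>For a group \<open>G\<close> of pointlike sets a single \<open>h\<close> has to serve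
  all relational morphisms at once, so it is chosen with the smallest kernel. A given relational
  morphism induces a relation from \<open>G\<close> to \<open>V\<close>, and
  \<open>hom_below_relation\<close> yields an \<open>h'\<close> whose kernel lies in one fibre of
  it. By the choice of \<open>h\<close>, pairing with \<open>h'\<close> leaves the kernel of
  \<open>h\<close> unchanged; hence this kernel lies in the same fibre.\<close>

lemma PL_saturated:
  fixes S :: "'a sgp"
  assumes S: "finite_semigroup S"
  shows "pl_closed H S (PL (GH H) S)"
proof -
  have rel: "subsemigroup \<rho> (prod_sgp S V)" "fst ` \<rho> = carrier S" if "relational_morphism S V \<rho>" for V :: "nat sgp" and \<rho>
    using that by (simp_all add: relational_morphism_def)
  have relI: "s \<in> carrier S" "v \<in> carrier V" if "relational_morphism S V \<rho>" "(s, v) \<in> \<rho>"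
    for V :: "nat sgp" and \<rho> s v
    using rel(1)[OF that(1)] that(2) by (auto simp: subsemigroup_def prod_sgp_def)
  have relM: "(sg_mult S s t, sg_mult V v w) \<in> \<rho>"
    if "relational_morphism S V \<rho>" "(s, v) \<in> \<rho>" "(t, w) \<in> \<rho>" for V :: "nat sgp" and \<rho> s t v w
    using rel(1)[OF that(1)] that(2,3) by (fastforce simp: subsemigroup_def prod_sgp_def)
  have PLD: "X \<noteq> {}" "X \<subseteq> carrier S"
    "\<And>V \<rho>. V \<in> GH H \<Longrightarrow> relational_morphism S V \<rho> \<Longrightarrow> \<exists>v\<in>carrier V. X \<subseteq> {s. (s, v) \<in> \<rho>}"
    if "X \<in> PL (GH H) S" for X using that by (simp_all add: PL_def)
  have PLI: "X \<in> PL (GH H) S" if "X \<noteq> {}" "X \<subseteq> carrier S"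
    "\<And>V \<rho>. V \<in> GH H \<Longrightarrow> relational_morphism S V \<rho> \<Longrightarrow> \<exists>v\<in>carrier V. \<forall>x\<in>X. (x, v) \<in> \<rho>" for X
    using that by (fastforce simp: PL_def)
  have smul: "sg_mult S x y \<in> carrier S" if "x \<in> carrier S" "y \<in> carrier S" for x y
    using S that by (simp add: finite_semigroup_def)
  show ?thesis
    unfolding pl_closed_def saturated_def
  proof (intro conjI ballI allI impI)
    show "PL (GH H) S \<subseteq> Pow (carrier S) - {{}}" using PLD(1,2) by blast
    fix s assume s: "s \<in> carrier S"
    show "{s} \<in> PL (GH H) S"
    proof (rule PLI)
      fix V and \<rho> :: "('a \<times> nat) set" assume "relational_morphism S V \<rho>"
      moreover from this obtain v where "(s, v) \<in> \<rho>" using rel(2) s by force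
      ultimately show "\<exists>v\<in>carrier V. \<forall>x\<in>{s}. (x, v) \<in> \<rho>" using relI(2) by blast
    qed (use s in auto)
  next
    fix X Y assume X: "X \<in> PL (GH H) S" and Y: "Y \<subseteq> X \<and> Y \<noteq> {}"
    show "Y \<in> PL (GH H) S"
    proof (rule PLI)
      show "\<exists>v\<in>carrier V. \<forall>x\<in>Y. (x, v) \<in> \<rho>" if "V \<in> GH H" "relational_morphism S V \<rho>" for V \<rho>
        using PLD(3)[OF X that] Y by blast
    qed (use Y PLD(2)[OF X] in auto)
  next
    fix X Y assume X: "X \<in> PL (GH H) S" and Y: "Y \<in> PL (GH H) S"
    show "setmult S X Y \<in> PL (GH H) S"
    proof (rule PLI)
      show "setmult S X Y \<noteq> {}" using PLD(1)[OF X] PLD(1)[OF Y] by (simp add: setmult_def)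
      show "setmult S X Y \<subseteq> carrier S"
        using PLD(2)[OF X] PLD(2)[OF Y] smul by (fastforce elim: setmultE)
      fix V \<rho> assume V: "V \<in> GH H" "relational_morphism S V \<rho>"
      obtain v where v: "v \<in> carrier V" "X \<subseteq> {s. (s, v) \<in> \<rho>}" using PLD(3)[OF X V] by blast
      obtain w where w: "w \<in> carrier V" "Y \<subseteq> {s. (s, w) \<in> \<rho>}" using PLD(3)[OF Y V] by blast
      have "\<forall>x\<in>setmult S X Y. (x, sg_mult V v w) \<in> \<rho>"
        using v w relM[OF V(2)] by (blast elim: setmultE)
      moreover have "sg_mult V v w \<in> carrier V"
        using V(1) v(1) w(1) by (simp add: GH_def finite_semigroup_def)
      ultimately show "\<exists>v\<in>carrier V. \<forall>x\<in>setmult S X Y. (x, v) \<in> \<rho>" by blast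
    qed
  next
    fix G E assume GE: "G \<subseteq> PL (GH H) S \<and> group_on (setmult S) G E"
    then have GP: "G \<subseteq> PL (GH H) S" and G: "group_on (setmult S) G E" by simp_all
    have "G \<subseteq> Pow (carrier S)" using GP PLD(2) by blast
    then have finG: "finite G" using S finite_subset by (auto simp: finite_semigroup_def)
    have EG: "E \<in> G" using group_onD(1)[OF G] .
    let ?K = "\<lambda>h. {g \<in> G. h g = h E}"
    obtain h where h: "hom_into H (setmult S) G h"
      "\<And>h'. hom_into H (setmult S) G h' \<Longrightarrow> card (?K h) \<le> card (?K h')"
      using ex_has_least_nat[of "hom_into H (setmult S) G" "\<lambda>_. 0" "\<lambda>h. card (?K h)"] hom_trivial
      by blast
    have "\<Union>(?K h) \<in> PL (GH H) S"
    proof (rule PLI)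
      show "\<Union>(?K h) \<noteq> {}" using EG PLD(1)[of E] GP by blast
      show "\<Union>(?K h) \<subseteq> carrier S" using GP PLD(2) by blast
      fix V \<rho> assume V: "V \<in> GH H" "relational_morphism S V \<rho>"
      have VG: "GH_on H (sg_mult V) (carrier V)" using GH_on_iff[of V] V(1) by (metis (no_types, lifting) GH_def mem_Collect_eq)
      \<comment> \<open>A set \<open>g\<close> is related to every \<open>v\<close> whose fibre
        contains it. That each \<open>g\<close> in \<open>G\<close> has such a \<open>v\<close> is
        exactly pointlikeness, applied to this one relational morphism.\<close>
      define R where "R = {(g, v). g \<in> G \<and> v \<in> carrier V \<and> (\<forall>s\<in>g. (s, v) \<in> \<rho>)}"
      have "R \<subseteq> G \<times> carrier V" by (auto simp: R_def)
      moreover have "fst ` R = G"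
      proof (intro equalityI subsetI)
        fix g assume g: "g \<in> G"
        then obtain v where "v \<in> carrier V" "g \<subseteq> {s. (s, v) \<in> \<rho>}" using PLD(3)[OF _ V] GP by blast
        then have "(g, v) \<in> R" using g by (auto simp: R_def)
        then show "g \<in> fst ` R" by force
      qed (auto simp: R_def)
      moreover have "(setmult S x y, sg_mult V v w) \<in> R" if xy: "(x, v) \<in> R" "(y, w) \<in> R" for x v y w
      proof -
        have "sg_mult V v w \<in> carrier V" using V(1) xy by (simp add: GH_def finite_semigroup_def R_def)
        moreover have "\<forall>s\<in>setmult S x y. (s, sg_mult V v w) \<in> \<rho>"
          using xy relM[OF V(2)] by (auto simp: R_def elim: setmultE)
        ultimately show ?thesis using group_onD(2)[OF G] xy by (simp add: R_def)
      qed
      ultimately obtain h' \<epsilon> where h': "hom_into H (setmult S) G h'" "\<forall>g\<in>G. h' g = h' E \<longrightarrow> (g, \<epsilon>) \<in> R"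
        using hom_below_relation[OF G finG VG, of R] by metis
      let ?p = "\<lambda>x. prod_encode (h x, h' x)"
      have sub: "?K ?p \<subseteq> ?K h" by auto
      have "card (?K h) \<le> card (?K ?p)" using h(2)[OF hom_pair[OF h(1) h'(1)]] .
      then have "?K ?p = ?K h" using card_seteq[OF _ sub] finG by simp
      then have "\<forall>g\<in>?K h. (g, \<epsilon>) \<in> R" using h'(2) by auto
      then have "\<epsilon> \<in> carrier V" "\<forall>x\<in>\<Union>(?K h). (x, \<epsilon>) \<in> \<rho>" using EG by (auto simp: R_def)
      then show "\<exists>v\<in>carrier V. \<forall>x\<in>\<Union>(?K h). (x, v) \<in> \<rho>" by blast
    qed
    then show "\<exists>h. hom_into H (setmult S) G h \<and> \<Union>(?K h) \<in> PL (GH H) S" using h(1) by blast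
  qed
qed

end

subsection \<open>The right regular representation of subsets\<close>

text \<open>\<open>None\<close> is an identity adjoined to the semigroup. Its row is
  \<open>X\<close> itself, so \<open>unreg\<close> recovers \<open>X\<close> even if the semigroup
  has no identity. Products and unions of subsets become compositions and unions of
  relations.\<close>

definition reg :: "'a sgp \<Rightarrow> 'a set \<Rightarrow> 'a option rel" where
  "reg S X = (\<lambda>s. (None, Some s)) ` X \<union> (\<lambda>(p, s). (Some p, Some (sg_mult S p s))) ` (carrier S \<times> X)"

definition unreg :: "'a option rel \<Rightarrow> 'a set" where
  "unreg r = {s. (None, Some s) \<in> r}"

lemma unreg_reg [simp]: "unreg (reg S X) = X"
  by (auto simp: unreg_def reg_def)

lemma reg_Union: "reg S (\<Union>K) = \<Union>(reg S ` K)"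
  by (auto simp: reg_def)

lemma reg_setmult:
  assumes S: "finite_semigroup S" and X: "X \<subseteq> carrier S" and Y: "Y \<subseteq> carrier S"
  shows "reg S (setmult S X Y) = reg S X O reg S Y"
proof (intro equalityI subrelI)
  have assoc: "sg_mult S (sg_mult S x y) z = sg_mult S x (sg_mult S y z)"
    if "x \<in> carrier S" "y \<in> carrier S" "z \<in> carrier S" for x y z
    using S that by (simp add: finite_semigroup_def)
  have cl: "sg_mult S x y \<in> carrier S" if "x \<in> carrier S" "y \<in> carrier S" for x y
    using S that by (simp add: finite_semigroup_def)
  fix a b
  show "(a, b) \<in> reg S X O reg S Y" if ab: "(a, b) \<in> reg S (setmult S X Y)"
  proof (cases a)
    case None
    then obtain x y where "x \<in> X" "y \<in> Y" "b = Some (sg_mult S x y)"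
      using ab unfolding reg_def by (auto elim: setmultE)
    moreover from this have "(None, Some x) \<in> reg S X" "(Some x, b) \<in> reg S Y"
      using X unfolding reg_def by auto
    ultimately show ?thesis using None by blast
  next
    case (Some p)
    then obtain x y where xy: "p \<in> carrier S" "x \<in> X" "y \<in> Y" "b = Some (sg_mult S p (sg_mult S x y))"
      using ab unfolding reg_def by (auto elim: setmultE)
    then have "b = Some (sg_mult S (sg_mult S p x) y)"
      using assoc[OF xy(1) subsetD[OF X xy(2)] subsetD[OF Y xy(3)]] by simp
    moreover have "sg_mult S p x \<in> carrier S" using cl[OF xy(1) subsetD[OF X xy(2)]] .
    ultimately have "(Some p, Some (sg_mult S p x)) \<in> reg S X" "(Some (sg_mult S p x), b) \<in> reg S Y"
      using xy unfolding reg_def by auto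
    then show ?thesis using Some by blast
  qed
  show "(a, b) \<in> reg S (setmult S X Y)" if ab: "(a, b) \<in> reg S X O reg S Y"
  proof -
    obtain c where ac: "(a, c) \<in> reg S X" and cb: "(c, b) \<in> reg S Y" using ab by blast
    show ?thesis
    proof (cases a)
      case None
      then obtain x where x: "x \<in> X" "c = Some x" using ac unfolding reg_def by auto
      then obtain y where y: "y \<in> Y" "b = Some (sg_mult S x y)" using cb unfolding reg_def by auto
      then show ?thesis using None setmultI[OF x(1) y(1)] unfolding reg_def by auto
    next
      case (Some p)
      then obtain x where x: "p \<in> carrier S" "x \<in> X" "c = Some (sg_mult S p x)"
        using ac unfolding reg_def by auto
      then obtain y where y: "y \<in> Y" "b = Some (sg_mult S (sg_mult S p x) y)"
        using cb unfolding reg_def by auto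
      then have "b = Some (sg_mult S p (sg_mult S x y))"
        using assoc[OF x(1) subsetD[OF X x(2)] subsetD[OF Y y(1)]] by simp
      then show ?thesis using Some x(1) setmultI[OF x(2) y(1)] unfolding reg_def by force
    qed
  qed
qed

lemma reg_saturated:
  assumes S: "finite_semigroup S" and C: "C \<subseteq> Pow (carrier S)" and sat: "saturated H (setmult S) C"
  shows "saturated H (O) (reg S ` C)"
proof -
  have cl: "setmult S x y \<in> C" if "x \<in> C" "y \<in> C" for x y using sat that by (simp add: saturated_def)
  have hom: "reg S x O reg S y = reg S (setmult S x y)" if "x \<in> C" "y \<in> C" for x y
    using reg_setmult[OF S] C that by blast
  show ?thesis
    unfolding saturated_def
  proof (intro conjI ballI allI impI)
    show "x O y \<in> reg S ` C" if "x \<in> reg S ` C" "y \<in> reg S ` C" for x y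
      using that hom cl by auto
    fix G e assume Ge: "G \<subseteq> reg S ` C \<and> group_on (O) G e"
    then have GC: "G \<subseteq> reg S ` C" and G: "group_on (O) G e" by simp_all
    have ru: "reg S (unreg g) = g" "unreg g \<in> C" if g: "g \<in> G" for g using GC g by auto
    have uhom: "unreg (x O y) = setmult S (unreg x) (unreg y)" if "x \<in> G" "y \<in> G" for x y
      using hom[OF ru(2) ru(2), OF that] ru(1) that by (metis unreg_reg)
    have grp: "group_on (setmult S) (unreg ` G) (unreg e)"
      using group_on_image[of "(O)" G e unreg "setmult S"] G uhom by blast
    have sub: "unreg ` G \<subseteq> C" using ru(2) by blast
    from sat sub grp obtain h where h: "hom_into H (setmult S) (unreg ` G) h"
      "\<Union>{g \<in> unreg ` G. h g = h (unreg e)} \<in> C" by (rule saturatedE)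
    from h(1) obtain Q where Q: "Q \<in> H" "h ` unreg ` G \<subseteq> carrier Q"
      "\<forall>x\<in>unreg ` G. \<forall>y\<in>unreg ` G. h (setmult S x y) = sg_mult Q (h x) (h y)" by (rule hom_intoE)
    have "hom_into H (O) G (h \<circ> unreg)"
      unfolding hom_into_def
      by (rule bexI[OF _ Q(1)]) (use Q(2,3) uhom in \<open>simp add: image_comp\<close>)
    moreover have "reg S ` {g \<in> unreg ` G. h g = h (unreg e)} = {g \<in> G. h (unreg g) = h (unreg e)}"
    proof (intro equalityI subsetI)
      fix x assume "x \<in> reg S ` {g \<in> unreg ` G. h g = h (unreg e)}"
      then obtain g where "g \<in> G" "h (unreg g) = h (unreg e)" "x = reg S (unreg g)" by blast
      then show "x \<in> {g \<in> G. h (unreg g) = h (unreg e)}" using ru(1) by simp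
    next
      fix x assume "x \<in> {g \<in> G. h (unreg g) = h (unreg e)}"
      then show "x \<in> reg S ` {g \<in> unreg ` G. h g = h (unreg e)}"
        using ru(1) by (intro image_eqI[of _ _ "unreg x"]) auto
    qed
    then have "reg S (\<Union>{g \<in> unreg ` G. h g = h (unreg e)}) =
        \<Union>{g \<in> G. (h \<circ> unreg) g = (h \<circ> unreg) e}"
      by (simp add: reg_Union)
    then have "\<Union>{g \<in> G. (h \<circ> unreg) g = (h \<circ> unreg) e} \<in> reg S ` C"
      using imageI[OF h(2), of "reg S"] by (rule subst[where P = "\<lambda>z. z \<in> reg S ` C"])
    ultimately show "\<exists>h. hom_into H (O) G h \<and> \<Union>{g \<in> G. h g = h e} \<in> reg S ` C"
      by (intro exI[of _ "h \<circ> unreg"] conjI)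
  qed
qed

section \<open>Every closed family contains the pointlike sets\<close>

context pseudovar
begin

text \<open>The cover of \<open>C\<close> is read as a relational morphism \<open>\<rho>\<close>,
  whose fibre over the code of \<open>v\<close> is the member of \<open>C\<close> represented by
  \<open>f v\<close>. Laxness makes \<open>\<rho>\<close> a subsemigroup, and the singletons in
  \<open>C\<close> make it project onto \<open>S\<close>. A pointlike set lies in one fibre and thus
  belongs to \<open>C\<close> by closure under subsets.\<close>

lemma PL_least:
  fixes S :: "'a sgp"
  assumes S: "finite_semigroup S" and C: "pl_closed H S C" and X: "X \<in> PL (GH H) S"
  shows "X \<in> C"
proof -
  have CS: "C \<subseteq> Pow (carrier S)" and sing: "\<And>s. s \<in> carrier S \<Longrightarrow> {s} \<in> C"
    and down: "\<And>X Y. X \<in> C \<Longrightarrow> Y \<subseteq> X \<Longrightarrow> Y \<noteq> {} \<Longrightarrow> Y \<in> C"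
    and sat: "saturated H (setmult S) C" using C by (auto simp: pl_closed_def)
  have "finite C" using CS S finite_subset by (auto simp: finite_semigroup_def)
  then have "covers H (reg S ` C) (reg S ` C)"
    using saturated_covers[OF _ reg_saturated[OF S CS sat]] by blast
  then obtain V :: "nat rel set" and f where V: "GH_on H (O) V" "f ` V \<subseteq> reg S ` C"
    and "Id \<notin> V" and lax: "\<forall>x\<in>V. \<forall>y\<in>V. f x O f y \<subseteq> f (x O y)"
    and cov: "\<forall>a\<in>reg S ` C. \<exists>v\<in>V. a \<subseteq> f v" by (rule coversE)
  have finV: "finite V" and Vcl: "\<And>v w. v \<in> V \<Longrightarrow> w \<in> V \<Longrightarrow> v O w \<in> V"
    using V(1) by (auto simp: GH_on_def semigroup_on_def)
  have fC: "\<exists>Y\<in>C. f v = reg S Y" if "v \<in> V" for v using V(2) that by blast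
  obtain c :: "nat rel \<Rightarrow> nat" where c: "inj_on c V" using finite_imp_inj_to_nat_seg[OF finV] by blast
  let ?i = "inv_into V c"
  define W where "W = (\<lparr>carrier = c ` V, sg_mult = \<lambda>x y. c (?i x O ?i y)\<rparr> :: nat sgp)"
  have ic: "?i (c v) = v" if "v \<in> V" for v using c that by simp
  have Wm: "sg_mult W (c v) (c w) = c (v O w)" if "v \<in> V" "w \<in> V" for v w
    using ic that by (simp add: W_def)
  have Wc: "carrier W = c ` V" by (simp add: W_def)
  have cover: "\<exists>v\<in>V. s \<in> unreg (f v)" if s: "s \<in> carrier S" for s
  proof -
    obtain v where "v \<in> V" "reg S {s} \<subseteq> f v" using cov sing[OF s] by blast
    then show ?thesis by (auto simp: unreg_def reg_def)
  qed
  have "V \<noteq> {}" using cover S by (auto simp: finite_semigroup_def)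
  have W: "finite_semigroup W"
    unfolding finite_semigroup_iff semigroup_on_def
    using finV \<open>V \<noteq> {}\<close> by (auto simp: Wc Wm Vcl O_assoc)
  have "GH_on H (sg_mult W) (carrier W)"
  proof (rule GH_on_embed)
    show "finite (carrier W)" "semigroup_on (sg_mult W) (carrier W)"
      using W by (simp_all add: finite_semigroup_iff)
    fix G e assume G: "G \<subseteq> carrier W"
    have "?i ` G \<subseteq> V" "inj_on ?i G" using G ic by (auto simp: Wc inj_on_inv_into)
    moreover have "\<forall>x\<in>G. \<forall>y\<in>G. ?i (sg_mult W x y) = ?i x O ?i y"
    proof (intro ballI)
      fix x y assume "x \<in> G" "y \<in> G"
      then obtain v w where "x = c v" "v \<in> V" "y = c w" "w \<in> V" using G Wc by blast
      then show "?i (sg_mult W x y) = ?i x O ?i y" by (simp add: Wm ic Vcl)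
    qed
    ultimately show "\<exists>(U :: nat rel set) m' j. GH_on H m' U \<and> j ` G \<subseteq> U \<and> inj_on j G \<and>
        (\<forall>x\<in>G. \<forall>y\<in>G. j (sg_mult W x y) = m' (j x) (j y))" using V(1) by blast
  qed
  then have WGH: "W \<in> GH H" using GH_on_iff[OF W] by simp
  define \<rho> where "\<rho> = {(s, c v) |s v. s \<in> carrier S \<and> v \<in> V \<and> s \<in> unreg (f v)}"
  have smul: "sg_mult S x y \<in> carrier S" if "x \<in> carrier S" "y \<in> carrier S" for x y
    using S that by (simp add: finite_semigroup_def)
  have mul: "sg_mult S s t \<in> unreg (f (v O w))"
    if st: "s \<in> unreg (f v)" "t \<in> unreg (f w)" "v \<in> V" "w \<in> V" for s t v w
  proof -
    obtain Y Z where YZ: "Y \<in> C" "f v = reg S Y" "Z \<in> C" "f w = reg S Z" using fC st by metis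
    have YS: "Y \<subseteq> carrier S" "Z \<subseteq> carrier S" using YZ CS by blast+
    have "sg_mult S s t \<in> setmult S Y Z" using st YZ by (simp add: setmultI)
    then have "(None, Some (sg_mult S s t)) \<in> reg S (setmult S Y Z)" unfolding reg_def by blast
    then have "(None, Some (sg_mult S s t)) \<in> f v O f w"
      using reg_setmult[OF S YS] YZ by simp
    then show ?thesis using lax st(3,4) unfolding unreg_def by blast
  qed
  have "relational_morphism S W \<rho>"
    unfolding relational_morphism_def subsemigroup_def
  proof (intro conjI ballI)
    obtain s where "s \<in> carrier S" using S by (auto simp: finite_semigroup_def)
    then show "\<rho> \<noteq> {}" using cover unfolding \<rho>_def by blast
    show "\<rho> \<subseteq> carrier (prod_sgp S W)" unfolding \<rho>_def prod_sgp_def by (auto simp: Wc)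
    show "fst ` \<rho> = carrier S"
    proof (intro equalityI subsetI)
      fix s assume s: "s \<in> carrier S"
      then obtain v where "v \<in> V" "s \<in> unreg (f v)" using cover by blast
      then have "(s, c v) \<in> \<rho>" using s unfolding \<rho>_def by blast
      then show "s \<in> fst ` \<rho>" by force
    qed (auto simp: \<rho>_def)
    fix x y assume "x \<in> \<rho>" "y \<in> \<rho>"
    then obtain s v t w where x: "x = (s, c v)" "s \<in> carrier S" "v \<in> V" "s \<in> unreg (f v)"
      and y: "y = (t, c w)" "t \<in> carrier S" "w \<in> V" "t \<in> unreg (f w)" unfolding \<rho>_def by blast
    have "sg_mult (prod_sgp S W) x y = (sg_mult S s t, c (v O w))"
      using x y Wm by (simp add: prod_sgp_def)
    then show "sg_mult (prod_sgp S W) x y \<in> \<rho>"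
      using x y mul smul Vcl unfolding \<rho>_def by blast
  qed
  then obtain k where k: "k \<in> carrier W" "X \<subseteq> {s. (s, k) \<in> \<rho>}" and "X \<noteq> {}"
    using X WGH unfolding PL_def by blast
  then obtain v where v: "v \<in> V" "k = c v" using Wc by blast
  have "X \<subseteq> unreg (f v)"
  proof
    fix s assume "s \<in> X"
    then obtain w where w: "c v = c w" "w \<in> V" "s \<in> unreg (f w)" using k(2) v unfolding \<rho>_def by blast
    then have "v = w" using c v(1) by (simp add: inj_on_eq_iff)
    then show "s \<in> unreg (f v)" using w by simp
  qed
  moreover obtain Y where "Y \<in> C" "f v = reg S Y" using fC v by blast
  ultimately show ?thesis using down[of Y X] \<open>X \<noteq> {}\<close> by simp
qed

theorem PL_iff:
  assumes "finite_semigroup S"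
  shows "X \<in> PL (GH H) S \<longleftrightarrow> (\<forall>C. pl_closed H S C \<longrightarrow> X \<in> C)"
  using PL_least[OF assms] PL_saturated[OF assms] by blast

end

section \<open>Computable functions and decidable predicates\<close>

text \<open>Computability is a property of HOL functions with a fixed number of arguments, so that
  programs arise from rules that follow the structure of a term. The rules are collected in
  \<open>cintro\<close>.\<close>

definition cfun :: "nat \<Rightarrow> (nat list \<Rightarrow> nat) \<Rightarrow> bool" where
  "cfun n f \<longleftrightarrow> (\<exists>p. \<forall>xs. length xs = n \<longrightarrow> computes p xs (f xs))"

definition cpred :: "nat \<Rightarrow> (nat list \<Rightarrow> bool) \<Rightarrow> bool" where
  "cpred n P \<longleftrightarrow> cfun n (\<lambda>xs. if P xs then 1 else 0)"

lemma cfun_cong: "cfun n f \<Longrightarrow> (\<And>xs. length xs = n \<Longrightarrow> g xs = f xs) \<Longrightarrow> cfun n g"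
  unfolding cfun_def by metis

lemma cpred_cong: "cpred n P \<Longrightarrow> (\<And>xs. length xs = n \<Longrightarrow> Q xs = P xs) \<Longrightarrow> cpred n Q"
  unfolding cpred_def by (erule cfun_cong) simp

lemma cfun_nth: "i < n \<Longrightarrow> cfun n (\<lambda>xs. xs ! i)"
  unfolding cfun_def by (intro exI[of _ "Proj i"]) (auto intro: computes.proj)

lemma cfun_compose:
  assumes "cfun (length gs) f" "\<forall>g\<in>set gs. cfun n g"
  shows "cfun n (\<lambda>xs. f (map (\<lambda>g. g xs) gs))"
proof -
  obtain p where p: "\<And>ys. length ys = length gs \<Longrightarrow> computes p ys (f ys)"
    using assms(1) unfolding cfun_def by auto
  have "\<forall>g\<in>set gs. \<exists>q. \<forall>xs. length xs = n \<longrightarrow> computes q xs (g xs)"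
    using assms(2) unfolding cfun_def by auto
  then obtain q where q: "\<forall>g\<in>set gs. \<forall>xs. length xs = n \<longrightarrow> computes (q g) xs (g xs)" by metis
  have "computes (Comp p (map q gs)) xs (f (map (\<lambda>g. g xs) gs))" if "length xs = n" for xs
  proof (rule computes.comp)
    show "list_all2 (\<lambda>q y. computes q xs y) (map q gs) (map (\<lambda>g. g xs) gs)"
      using q that by (simp add: list_all2_conv_all_nth)
  qed (simp add: p)
  then show ?thesis unfolding cfun_def by blast
qed

lemma cfun_zero: "cfun n (\<lambda>xs. 0)"
  unfolding cfun_def by (intro exI[of _ Zero]) (auto intro: computes.zero)

lemma cfun_Suc: "cfun n f \<Longrightarrow> cfun n (\<lambda>xs. Suc (f xs))"
proof -
  assume f: "cfun n f"
  have "cfun 1 (\<lambda>ys. Suc (ys ! 0))"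
    unfolding cfun_def by (intro exI[of _ Succ]) (auto simp: length_Suc_conv intro: computes.succ)
  from cfun_compose[of "[f]", OF _ _] this f show ?thesis by fastforce
qed

lemma cfun_const: "cfun n (\<lambda>xs. c)"
  by (induction c) (auto intro: cfun_zero cfun_Suc)

text \<open>This rule and its variants reduce the computability of an operation to the case where
  its arguments are the plain entries of the list.\<close>

lemma cfun_c1: "cfun 1 (\<lambda>ys. F (ys ! 0)) \<Longrightarrow> cfun n f \<Longrightarrow> cfun n (\<lambda>xs. F (f xs))"
  using cfun_compose[of "[f]" "\<lambda>ys. F (ys ! 0)" n] by simp

lemma cfun_c2: "cfun 2 (\<lambda>ys. F (ys ! 0) (ys ! 1)) \<Longrightarrow> cfun n f \<Longrightarrow> cfun n g \<Longrightarrow>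
    cfun n (\<lambda>xs. F (f xs) (g xs))"
  using cfun_compose[of "[f, g]" "\<lambda>ys. F (ys ! 0) (ys ! 1)" n] by (simp add: numeral_2_eq_2)

lemma cfun_c3: "cfun 3 (\<lambda>ys. F (ys ! 0) (ys ! 1) (ys ! 2)) \<Longrightarrow> cfun n f \<Longrightarrow> cfun n g \<Longrightarrow>
    cfun n h \<Longrightarrow> cfun n (\<lambda>xs. F (f xs) (g xs) (h xs))"
  using cfun_compose[of "[f, g, h]" "\<lambda>ys. F (ys ! 0) (ys ! 1) (ys ! 2)" n]
  by (simp add: numeral_3_eq_3 numeral_2_eq_2)

lemma cpred_c1: "cpred 1 (\<lambda>ys. P (ys ! 0)) \<Longrightarrow> cfun n f \<Longrightarrow> cpred n (\<lambda>xs. P (f xs))"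
  unfolding cpred_def by (rule cfun_c1)

lemma cpred_c2: "cpred 2 (\<lambda>ys. P (ys ! 0) (ys ! 1)) \<Longrightarrow> cfun n f \<Longrightarrow> cfun n g \<Longrightarrow>
    cpred n (\<lambda>xs. P (f xs) (g xs))"
  unfolding cpred_def by (rule cfun_c2)

lemma cpred_c3: "cpred 3 (\<lambda>ys. P (ys ! 0) (ys ! 1) (ys ! 2)) \<Longrightarrow> cfun n f \<Longrightarrow> cfun n g \<Longrightarrow>
    cfun n h \<Longrightarrow> cpred n (\<lambda>xs. P (f xs) (g xs) (h xs))"
  unfolding cpred_def by (rule cfun_c3)

text \<open>
  Formulas are written with HOL's own binders. A binder adds its variable at the head of the
  argument list, so that an outer variable appears as \<open>xs ! i\<close>, or as the \<open>hd\<close> or \<open>nth\<close> of an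
  iterated \<open>tl\<close>.
\<close>

lemma cfun_tl_nth: "k + i < n \<Longrightarrow> cfun n (\<lambda>xs. (tl ^^ k) xs ! i)"
proof -
  assume "k + i < n"
  then have "cfun n (\<lambda>xs. xs ! (k + i))" by (rule cfun_nth)
  moreover have "(tl ^^ k) xs = drop k xs" for xs :: "nat list"
    by (induction k) (simp_all add: drop_Suc tl_drop)
  ultimately show ?thesis using \<open>k + i < n\<close> by (elim cfun_cong) (simp add: add.commute)
qed

lemma cfun_tl_hd: "k < n \<Longrightarrow> cfun n (\<lambda>xs. hd ((tl ^^ k) xs))"
proof -
  assume "k < n"
  then have "cfun n (\<lambda>xs. xs ! k)" by (rule cfun_nth)
  moreover have "(tl ^^ k) xs = drop k xs" for xs :: "nat list"
    by (induction k) (simp_all add: drop_Suc tl_drop)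
  ultimately show ?thesis using \<open>k < n\<close> by (elim cfun_cong) (simp add: hd_drop_conv_nth)
qed

named_theorems cintro

text \<open>Each binder puts one more \<open>tl\<close> around the outer variables. The eight levels
  provided suffice for \<open>code_closed\<close>, which nests seven binders.\<close>

lemma cfun_hd_tl:
  "0 < n \<Longrightarrow> cfun n (\<lambda>xs. hd xs)"
  "1 < n \<Longrightarrow> cfun n (\<lambda>xs. hd (tl xs))"
  "2 < n \<Longrightarrow> cfun n (\<lambda>xs. hd (tl (tl xs)))"
  "3 < n \<Longrightarrow> cfun n (\<lambda>xs. hd (tl (tl (tl xs))))"
  "4 < n \<Longrightarrow> cfun n (\<lambda>xs. hd (tl (tl (tl (tl xs)))))"
  "5 < n \<Longrightarrow> cfun n (\<lambda>xs. hd (tl (tl (tl (tl (tl xs))))))"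
  "6 < n \<Longrightarrow> cfun n (\<lambda>xs. hd (tl (tl (tl (tl (tl (tl xs)))))))"
  "7 < n \<Longrightarrow> cfun n (\<lambda>xs. hd (tl (tl (tl (tl (tl (tl (tl xs))))))))"
  "8 < n \<Longrightarrow> cfun n (\<lambda>xs. hd (tl (tl (tl (tl (tl (tl (tl (tl xs)))))))))"
  using cfun_tl_hd[of 0 n] cfun_tl_hd[of 1 n] cfun_tl_hd[of 2 n] cfun_tl_hd[of 3 n] cfun_tl_hd[of 4 n] cfun_tl_hd[of 5 n] cfun_tl_hd[of 6 n] cfun_tl_hd[of 7 n] cfun_tl_hd[of 8 n]
  by (simp_all add: eval_nat_numeral)

lemma cfun_nth_tl:
  "1 + i < n \<Longrightarrow> cfun n (\<lambda>xs. (tl xs) ! i)"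
  "2 + i < n \<Longrightarrow> cfun n (\<lambda>xs. (tl (tl xs)) ! i)"
  "3 + i < n \<Longrightarrow> cfun n (\<lambda>xs. (tl (tl (tl xs))) ! i)"
  "4 + i < n \<Longrightarrow> cfun n (\<lambda>xs. (tl (tl (tl (tl xs)))) ! i)"
  "5 + i < n \<Longrightarrow> cfun n (\<lambda>xs. (tl (tl (tl (tl (tl xs))))) ! i)"
  "6 + i < n \<Longrightarrow> cfun n (\<lambda>xs. (tl (tl (tl (tl (tl (tl xs)))))) ! i)"
  "7 + i < n \<Longrightarrow> cfun n (\<lambda>xs. (tl (tl (tl (tl (tl (tl (tl xs))))))) ! i)"
  "8 + i < n \<Longrightarrow> cfun n (\<lambda>xs. (tl (tl (tl (tl (tl (tl (tl (tl xs)))))))) ! i)"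
  using cfun_tl_nth[of 1 i n] cfun_tl_nth[of 2 i n] cfun_tl_nth[of 3 i n] cfun_tl_nth[of 4 i n] cfun_tl_nth[of 5 i n] cfun_tl_nth[of 6 i n] cfun_tl_nth[of 7 i n] cfun_tl_nth[of 8 i n]
  by (simp_all add: eval_nat_numeral)

lemmas [cintro] = cfun_nth cfun_const cfun_hd_tl cfun_nth_tl

lemma cfun_rec:
  assumes f: "cfun n f" and b: "cfun n b"
    and g: "cfun (Suc (Suc n)) (\<lambda>zs. g (tl (tl zs)) (hd zs) (hd (tl zs)))"
  shows "cfun n (\<lambda>xs. rec_nat (f xs) (\<lambda>k r. g xs k r) (b xs))"
proof -
  obtain p where p: "\<And>xs. length xs = n \<Longrightarrow> computes p xs (f xs)" using f unfolding cfun_def by auto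
  obtain q where q: "\<And>zs. length zs = Suc (Suc n) \<Longrightarrow>
      computes q zs (g (tl (tl zs)) (hd zs) (hd (tl zs)))" using g unfolding cfun_def by auto
  have "computes (PrimRec p q) (k # xs) (rec_nat (f xs) (\<lambda>k r. g xs k r) k)"
    if xs: "length xs = n" for xs k
  proof (induction k)
    case 0
    then show ?case using p[OF xs] by (simp add: computes.prim_0)
  next
    case (Suc k)
    show ?case using computes.prim_Suc[OF Suc.IH] q[of "k # _ # xs"] xs by simp
  qed
  then have "\<forall>ys. length ys = Suc n \<longrightarrow>
      computes (PrimRec p q) ys (rec_nat (f (tl ys)) (\<lambda>k r. g (tl ys) k r) (hd ys))"
    by (auto simp: length_Suc_conv)
  then have *: "cfun (Suc n) (\<lambda>ys. rec_nat (f (tl ys)) (\<lambda>k r. g (tl ys) k r) (hd ys))"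
    unfolding cfun_def by (rule exI)
  let ?gs = "b # map (\<lambda>i xs. xs ! i) [0..<n]"
  have "cfun n (\<lambda>xs. rec_nat (f (tl (map (\<lambda>g. g xs) ?gs))) (\<lambda>k r. g (tl (map (\<lambda>g. g xs) ?gs)) k r)
      (hd (map (\<lambda>g. g xs) ?gs)))"
    by (rule cfun_compose[of ?gs]) (use * b in \<open>auto intro: cfun_nth\<close>)
  moreover have "map ((\<lambda>g. g xs) \<circ> (\<lambda>i xs. xs ! i)) [0..<n] = xs" if "length xs = n" for xs :: "nat list"
    using that by (intro nth_equalityI) auto
  ultimately show ?thesis by (elim cfun_cong) simp
qed

section \<open>Logical connectives, bounded quantifiers and minimization\<close>

lemma cpred_ind: "cpred n P \<Longrightarrow> cfun n (\<lambda>xs. if P xs then 1 else 0)"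
  by (simp add: cpred_def)

text \<open>A case distinction is a primitive recursion over the truth value, which runs for one
  step or none.\<close>

lemma cfun_if [cintro]:
  assumes "cpred n P" "cfun n f" "cfun n g"
  shows "cfun n (\<lambda>xs. if P xs then f xs else g xs)"
proof -
  have f: "cfun (Suc (Suc n)) (\<lambda>zs. f (tl (tl zs)))"
  proof -
    let ?gs = "map (\<lambda>i xs. xs ! Suc (Suc i)) [0..<n]"
    have "cfun (Suc (Suc n)) (\<lambda>xs. f (map (\<lambda>g. g xs) ?gs))"
      by (rule cfun_compose[of ?gs]) (use assms(2) in \<open>auto intro: cfun_nth\<close>)
    then show ?thesis
    proof (rule cfun_cong)
      fix xs :: "nat list" assume xs: "length xs = Suc (Suc n)"
      have "tl (tl xs) = map (\<lambda>g. g xs) ?gs"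
        by (rule nth_equalityI) (use xs in \<open>simp_all add: nth_tl\<close>)
      then show "f (tl (tl xs)) = f (map (\<lambda>g. g xs) ?gs)" by simp
    qed
  qed
  have "cfun n (\<lambda>xs. rec_nat (g xs) (\<lambda>_ _. f xs) (if P xs then 1 else 0))"
    using cfun_rec[OF assms(3) cpred_ind[OF assms(1)], of "\<lambda>xs _ _. f xs"] f by simp
  then show ?thesis by (elim cfun_cong) simp
qed

lemma cpred_not [cintro]: "cpred n P \<Longrightarrow> cpred n (\<lambda>xs. \<not> P xs)"
  unfolding cpred_def by (rule cfun_cong[of n "\<lambda>xs. if P xs then 0 else 1"])
    (auto intro!: cfun_if cfun_const simp: cpred_def)

lemma cpred_conj [cintro]: "cpred n P \<Longrightarrow> cpred n Q \<Longrightarrow> cpred n (\<lambda>xs. P xs \<and> Q xs)"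
  unfolding cpred_def by (rule cfun_cong[of n "\<lambda>xs. if P xs then if Q xs then 1 else 0 else 0"])
    (auto intro!: cfun_if cfun_const simp: cpred_def)

lemma cpred_imp [cintro]: "cpred n P \<Longrightarrow> cpred n Q \<Longrightarrow> cpred n (\<lambda>xs. P xs \<longrightarrow> Q xs)"
  unfolding cpred_def by (rule cfun_cong[of n "\<lambda>xs. if P xs then if Q xs then 1 else 0 else 1"])
    (auto intro!: cfun_if cfun_const simp: cpred_def)

lemma cpred_iff [cintro]: "cpred n P \<Longrightarrow> cpred n Q \<Longrightarrow> cpred n (\<lambda>xs. P xs \<longleftrightarrow> Q xs)"
  by (rule cpred_cong[of n "\<lambda>xs. (P xs \<longrightarrow> Q xs) \<and> (Q xs \<longrightarrow> P xs)"]) (auto intro!: cintro)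

text \<open>The search is a primitive recursion on the bound that carries along the truth value
  found so far.\<close>

lemma cpred_ex [cintro]:
  assumes "cfun n b" "cpred (Suc n) (\<lambda>zs. P (tl zs) (hd zs))"
  shows "cpred n (\<lambda>xs. \<exists>y<b xs. P xs y)"
proof -
  let ?gs = "(\<lambda>xs. xs ! 0) # map (\<lambda>i xs. xs ! Suc (Suc i)) [0..<n]"
  have "cfun (Suc (Suc n)) (\<lambda>xs. if P (tl (map (\<lambda>g. g xs) ?gs)) (hd (map (\<lambda>g. g xs) ?gs)) then 1 else 0)"
    by (rule cfun_compose[of ?gs "\<lambda>zs. if P (tl zs) (hd zs) then 1 else 0"])
      (use assms(2) in \<open>auto intro: cfun_nth simp: cpred_def\<close>)
  moreover have "map (\<lambda>g. g xs) (map (\<lambda>i xs. xs ! Suc (Suc i)) [0..<n]) = tl (tl xs)"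
    if "length xs = Suc (Suc n)" for xs :: "nat list"
    by (rule nth_equalityI) (use that in \<open>simp_all add: nth_tl\<close>)
  moreover have "xs ! 0 = hd xs" if "length xs = Suc (Suc n)" for xs :: "nat list"
    using that by (cases xs) auto
  ultimately have "cpred (Suc (Suc n)) (\<lambda>xs. P (tl (tl xs)) (hd xs))"
    unfolding cpred_def by (elim cfun_cong) simp
  then have "cfun (Suc (Suc n)) (\<lambda>zs. if P (tl (tl zs)) (hd zs) then 1 else hd (tl zs))"
    by (intro cintro) simp_all
  then have "cfun n (\<lambda>xs. rec_nat 0 (\<lambda>y r. if P xs y then 1 else r) (b xs))"
    by (rule cfun_rec[OF cfun_zero assms(1), where g = "\<lambda>xs y r. if P xs y then 1 else r"])
  moreover have "rec_nat 0 (\<lambda>y r. if P xs y then 1 else r) k = (if \<exists>y<k. P xs y then 1 else 0 :: nat)" for xs k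
    by (induction k) (auto simp: less_Suc_eq)
  ultimately show ?thesis unfolding cpred_def by (simp only:)
qed

lemma cpred_all [cintro]:
  assumes "cfun n b" "cpred (Suc n) (\<lambda>zs. P (tl zs) (hd zs))"
  shows "cpred n (\<lambda>xs. \<forall>y<b xs. P xs y)"
  using cpred_not[OF cpred_ex[OF assms(1) cpred_not[OF assms(2)]]] by simp

lemma cfun_Least:
  assumes P: "cpred (Suc n) (\<lambda>zs. P (tl zs) (hd zs))"
    and ex: "\<And>xs. length xs = n \<Longrightarrow> \<exists>y. P xs y"
  shows "cfun n (\<lambda>xs. LEAST y. P xs y)"
proof -
  \<comment> \<open>\<open>Mu\<close> looks for a zero, so the program has to test the
    negation.\<close>
  obtain p where p: "\<And>zs. length zs = Suc n \<Longrightarrow> computes p zs (if \<not> P (tl zs) (hd zs) then 1 else 0)"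
    using cpred_not[OF P] unfolding cpred_def cfun_def by auto
  have "computes (Mu p) xs (LEAST y. P xs y)" if xs: "length xs = n" for xs
  proof (rule computes.mu)
    have "P xs (LEAST y. P xs y)" using ex[OF xs] by (metis LeastI)
    then show "computes p ((LEAST y. P xs y) # xs) 0"
      using p[of "(LEAST y. P xs y) # xs"] xs by simp
    show "\<forall>k<LEAST y. P xs y. \<exists>y. computes p (k # xs) (Suc y)"
    proof (intro allI impI)
      fix k assume "k < (LEAST y. P xs y)"
      then have "\<not> P xs k" by (rule not_less_Least)
      then show "\<exists>y. computes p (k # xs) (Suc y)" using p[of "k # xs"] xs by force
    qed
  qed
  then show ?thesis unfolding cfun_def by blast
qed

subsection \<open>Arithmetic\<close>

lemma cfun_add [cintro]: assumes "cfun n f" "cfun n g" shows "cfun n (\<lambda>xs. f xs + g xs)"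
proof (rule cfun_c2[OF _ assms])
  have "cfun 2 (\<lambda>ys. rec_nat (ys ! 0) (\<lambda>k r. Suc r) (ys ! 1))"
    by (rule cfun_rec; (intro cintro cfun_Suc)?; simp)
  moreover have "rec_nat a (\<lambda>k r. Suc r) b = a + b" for a b by (induction b) auto
  ultimately show "cfun 2 (\<lambda>ys. ys ! 0 + ys ! 1)" by simp
qed

lemma cfun_pred: assumes "cfun n f" shows "cfun n (\<lambda>xs. f xs - 1)"
proof (rule cfun_c1[OF _ assms])
  have "cfun 1 (\<lambda>ys. rec_nat 0 (\<lambda>k r. k) (ys ! 0))"
    by (rule cfun_rec; (intro cintro)?; simp)
  moreover have "rec_nat 0 (\<lambda>k r. k) b = b - 1" for b by (induction b) auto
  ultimately show "cfun 1 (\<lambda>ys. ys ! 0 - 1)" by simp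
qed

lemma cfun_diff [cintro]: assumes "cfun n f" "cfun n g" shows "cfun n (\<lambda>xs. f xs - g xs)"
proof (rule cfun_c2[OF _ assms])
  have "cfun 2 (\<lambda>ys. rec_nat (ys ! 0) (\<lambda>k r. r - 1) (ys ! 1))"
    by (rule cfun_rec; (intro cintro cfun_pred)?; simp)
  moreover have "rec_nat a (\<lambda>k r. r - 1) b = a - b" for a b by (induction b) auto
  ultimately show "cfun 2 (\<lambda>ys. ys ! 0 - ys ! 1)" by simp
qed

lemma cfun_mult [cintro]: assumes "cfun n f" "cfun n g" shows "cfun n (\<lambda>xs. f xs * g xs)"
proof (rule cfun_c2[OF _ assms])
  have "cfun 2 (\<lambda>ys. rec_nat 0 (\<lambda>k r. ys ! 0 + r) (ys ! 1))"
    by (rule cfun_rec; (intro cintro)?; simp)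
  moreover have "rec_nat 0 (\<lambda>k r. a + r) b = a * b" for a b by (induction b) auto
  ultimately show "cfun 2 (\<lambda>ys. ys ! 0 * ys ! 1)" by simp
qed

lemma cfun_power2 [cintro]: assumes "cfun n f" shows "cfun n (\<lambda>xs. 2 ^ f xs)"
proof (rule cfun_c1[OF _ assms])
  have "cfun 1 (\<lambda>ys. rec_nat 1 (\<lambda>k r. 2 * r) (ys ! 0))"
    by (rule cfun_rec; (intro cintro)?; simp)
  moreover have "rec_nat 1 (\<lambda>k r. 2 * r) b = (2 ^ b :: nat)" for b by (induction b) auto
  ultimately show "cfun 1 (\<lambda>ys. 2 ^ (ys ! 0))" by (simp only:)
qed

lemma cpred_le [cintro]: assumes "cfun n f" "cfun n g" shows "cpred n (\<lambda>xs. f xs \<le> g xs)"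
proof -
  have "cfun n (\<lambda>xs. 1 - (f xs - g xs))" using assms by (intro cintro)
  then show ?thesis unfolding cpred_def by (elim cfun_cong) simp
qed

lemma cpred_less [cintro]: assumes "cfun n f" "cfun n g" shows "cpred n (\<lambda>xs. f xs < g xs)"
proof -
  have "cpred n (\<lambda>xs. \<not> g xs \<le> f xs)" using assms by (intro cintro)
  then show ?thesis by (simp add: not_le)
qed

lemma cpred_eq [cintro]: assumes "cfun n f" "cfun n g" shows "cpred n (\<lambda>xs. f xs = g xs)"
proof -
  have "cpred n (\<lambda>xs. f xs \<le> g xs \<and> g xs \<le> f xs)" using assms by (intro cintro)
  then show ?thesis by (elim cpred_cong) auto
qed

lemma cfun_half: assumes "cfun n f" shows "cfun n (\<lambda>xs. f xs div 2)"
proof (rule cfun_c1[OF _ assms])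
  have "cfun 1 (\<lambda>ys. LEAST q. ys ! 0 < 2 * (q + 1))"
  proof (rule cfun_Least)
    show "\<exists>y. xs ! 0 < 2 * (y + 1)" for xs :: "nat list" by (rule exI[of _ "xs ! 0"]) simp
  qed (intro cintro; simp)
  moreover have "(LEAST q. a < 2 * (q + 1)) = a div 2" for a :: nat by (rule Least_equality) auto
  ultimately show "cfun 1 (\<lambda>ys. ys ! 0 div 2)" by simp
qed

subsection \<open>Sets and lists as numbers\<close>

definition mem :: "nat \<Rightarrow> nat \<Rightarrow> bool" where
  "mem x s \<longleftrightarrow> x \<in> set_decode s"

lemma cpred_mem [cintro]: assumes "cfun n f" "cfun n g" shows "cpred n (\<lambda>xs. mem (f xs) (g xs))"
proof (rule cpred_c2[OF _ assms])
  have 1: "cfun 2 (\<lambda>ys. rec_nat (ys ! 1) (\<lambda>k r. r div 2) (ys ! 0))"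
    by (rule cfun_rec; (intro cintro cfun_half)?; simp)
  have "rec_nat s (\<lambda>k r. r div 2) x = s div 2 ^ x" for s x :: nat
    by (induction x) (auto simp: div_mult2_eq power_Suc2 simp del: power_Suc)
  then have "cfun 2 (\<lambda>ys. ys ! 1 div 2 ^ (ys ! 0))" using 1 by simp
  then have "cpred 2 (\<lambda>ys. ys ! 1 div 2 ^ (ys ! 0) = 2 * ((ys ! 1 div 2 ^ (ys ! 0)) div 2) + 1)"
    by (intro cintro cfun_half; simp)
  moreover have "mem x s \<longleftrightarrow> s div 2 ^ x = 2 * ((s div 2 ^ x) div 2) + 1" for x s
    unfolding mem_def set_decode_def by (auto elim!: oddE)
  ultimately show "cpred 2 (\<lambda>ys. mem (ys ! 0) (ys ! 1))" by simp
qed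

lemma cfun_prod_encode [cintro]:
  assumes "cfun n f" "cfun n g" shows "cfun n (\<lambda>xs. prod_encode (f xs, g xs))"
proof -
  have "cfun n (\<lambda>xs. ((f xs + g xs) * (f xs + g xs + 1)) div 2 + f xs)"
    using assms by (intro cintro cfun_half)
  then show ?thesis by (simp add: prod_encode_def triangle_def)
qed

lemma cfun_fst_decode:
  assumes "cfun n f" shows "cfun n (\<lambda>xs. fst (prod_decode (f xs)))"
proof (rule cfun_c1[OF _ assms])
  have "cfun 1 (\<lambda>ys. LEAST a. \<exists>b<ys ! 0 + 1. prod_encode (a, b) = ys ! 0)"
  proof (rule cfun_Least)
    show "\<exists>a. \<exists>b<xs ! 0 + 1. prod_encode (a, b) = xs ! 0" for xs :: "nat list"
      using le_prod_encode_2[of "snd (prod_decode (xs ! 0))" "fst (prod_decode (xs ! 0))"]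
      by (intro exI[of _ "fst (prod_decode (xs ! 0))"] exI[of _ "snd (prod_decode (xs ! 0))"])
        (simp add: less_Suc_eq_le)
  qed (intro cintro; simp)
  moreover have "(LEAST a. \<exists>b<z + 1. prod_encode (a, b) = z) = fst (prod_decode z)" for z
    using le_prod_encode_2[of "snd (prod_decode z)" "fst (prod_decode z)"]
    by (intro Least_equality)
      (auto intro!: exI[of _ "snd (prod_decode z)"] simp: less_Suc_eq_le)
  ultimately show "cfun 1 (\<lambda>ys. fst (prod_decode (ys ! 0)))" by simp
qed

lemma cfun_snd_decode:
  assumes "cfun n f" shows "cfun n (\<lambda>xs. snd (prod_decode (f xs)))"
proof (rule cfun_c1[OF _ assms])
  have "cfun 1 (\<lambda>ys. LEAST b. \<exists>a<ys ! 0 + 1. prod_encode (a, b) = ys ! 0)"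
  proof (rule cfun_Least)
    show "\<exists>b. \<exists>a<xs ! 0 + 1. prod_encode (a, b) = xs ! 0" for xs :: "nat list"
      using le_prod_encode_1[of "fst (prod_decode (xs ! 0))" "snd (prod_decode (xs ! 0))"]
      by (intro exI[of _ "snd (prod_decode (xs ! 0))"] exI[of _ "fst (prod_decode (xs ! 0))"])
        (simp add: less_Suc_eq_le)
  qed (intro cintro; simp)
  moreover have "(LEAST b. \<exists>a<z + 1. prod_encode (a, b) = z) = snd (prod_decode z)" for z
    using le_prod_encode_1[of "fst (prod_decode z)" "snd (prod_decode z)"]
    by (intro Least_equality)
      (auto intro!: exI[of _ "fst (prod_decode z)"] simp: less_Suc_eq_le)
  ultimately show "cfun 1 (\<lambda>ys. snd (prod_decode (ys ! 0)))" by simp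
qed

text \<open>The code of a nonempty list is the successor of the pair of its head and the code of its
  tail. The code \<open>0\<close> of the empty list is a fixed point of the step, since
  \<open>prod_decode 0\<close> is \<open>(0, 0)\<close>; hence the length is the least number of
  steps that lead to \<open>0\<close>.\<close>

definition code_drop :: "nat \<Rightarrow> nat \<Rightarrow> nat" where
  "code_drop c i = rec_nat c (\<lambda>_ r. snd (prod_decode (r - 1))) i"

definition code_nth :: "nat \<Rightarrow> nat \<Rightarrow> nat" where
  "code_nth c i = fst (prod_decode (code_drop c i - 1))"

definition code_length :: "nat \<Rightarrow> nat" where
  "code_length c = (LEAST i. code_drop c i = 0)"

lemma code_drop: "code_drop (list_encode xs) i = list_encode (drop i xs)"
proof (induction i)
  case (Suc i)
  have "snd (prod_decode (list_encode ys - 1)) = list_encode (drop 1 ys)" for ys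
  proof (cases ys)
    case Nil
    have "prod_decode 0 = (0, 0)" using prod_encode_inverse[of "(0, 0)"] by (simp add: prod_encode_def)
    then show ?thesis using Nil by simp
  qed simp
  then show ?case using Suc by (simp add: code_drop_def)
qed (simp add: code_drop_def)

lemma code_nth: "i < length xs \<Longrightarrow> code_nth (list_encode xs) i = xs ! i"
  unfolding code_nth_def code_drop by (simp flip: Cons_nth_drop_Suc)

lemma code_length: "code_length (list_encode xs) = length xs"
  unfolding code_length_def code_drop
proof (rule Least_equality)
  fix i assume "list_encode (drop i xs) = 0"
  then have "drop i xs = []" by (metis list_encode.simps(1) list_encode_eq)
  then show "length xs \<le> i" by simp
qed simp

lemma cfun_code_drop: assumes "cfun n f" "cfun n g" shows "cfun n (\<lambda>xs. code_drop (f xs) (g xs))"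
  unfolding code_drop_def
  by (rule cfun_rec[OF assms]; intro cintro cfun_snd_decode; simp)

lemma cfun_code_nth [cintro]: "cfun n f \<Longrightarrow> cfun n g \<Longrightarrow> cfun n (\<lambda>xs. code_nth (f xs) (g xs))"
  unfolding code_nth_def by (intro cintro cfun_fst_decode cfun_code_drop)

lemma cfun_code_length [cintro]: assumes "cfun n f" shows "cfun n (\<lambda>xs. code_length (f xs))"
proof (rule cfun_c1[OF _ assms])
  show "cfun 1 (\<lambda>ys. code_length (ys ! 0))"
    unfolding code_length_def
  proof (rule cfun_Least)
    show "\<exists>i. code_drop (xs ! 0) i = 0" for xs :: "nat list"
      using code_drop[of "list_decode (xs ! 0)" "length (list_decode (xs ! 0))"] by auto
  qed (intro cintro cfun_code_drop; simp)
qed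

text \<open>The code of the list of \<open>k\<close> copies of \<open>b\<close>. As pairing is
  monotone, it bounds the codes of all lists of at most \<open>k\<close> entries up to
  \<open>b\<close>.\<close>

definition list_bound :: "nat \<Rightarrow> nat \<Rightarrow> nat" where
  "list_bound k b = rec_nat 0 (\<lambda>_ r. prod_encode (b, r) + 1) k"

lemma cfun_list_bound [cintro]:
  assumes "cfun n f" "cfun n g" shows "cfun n (\<lambda>xs. list_bound (f xs) (g xs))"
proof (rule cfun_c2[OF _ assms])
  show "cfun 2 (\<lambda>ys. list_bound (ys ! 0) (ys ! 1))"
    unfolding list_bound_def by (rule cfun_rec; (intro cintro)?; simp)
qed

lemma prod_encode_mono: "a \<le> a' \<Longrightarrow> b \<le> b' \<Longrightarrow> prod_encode (a, b) \<le> prod_encode (a', b')"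
proof -
  have "triangle m \<le> triangle n" if "m \<le> n" for m n
    using that by (induction rule: dec_induct) auto
  then show "a \<le> a' \<Longrightarrow> b \<le> b' \<Longrightarrow> prod_encode (a, b) \<le> prod_encode (a', b')"
    by (simp add: prod_encode_def add_mono)
qed

lemma list_encode_le_bound:
  "length xs \<le> k \<Longrightarrow> \<forall>x\<in>set xs. x \<le> b \<Longrightarrow> list_encode xs \<le> list_bound k b"
proof (induction k arbitrary: xs)
  case (Suc k)
  show ?case
  proof (cases xs)
    case (Cons x ys)
    then have "list_encode ys \<le> list_bound k b" using Suc by simp
    then have "prod_encode (x, list_encode ys) \<le> prod_encode (b, list_bound k b)"
      using Cons Suc.prems by (intro prod_encode_mono) auto
    then show ?thesis using Cons by (simp add: list_bound_def)
  qed simp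
qed (simp add: list_bound_def)

section \<open>Deciding membership in all closed families\<close>

definition code_lookup :: "nat \<Rightarrow> nat \<Rightarrow> nat \<Rightarrow> nat" where
  "code_lookup t i j = code_nth (code_nth t i) j"

definition dec_table :: "nat \<Rightarrow> nat list list" where
  "dec_table t = map list_decode (list_decode t)"

text \<open>The quantifier over \<open>e\<close> also forces the table to be nonempty.\<close>

definition code_group_table :: "nat \<Rightarrow> bool" where
  "code_group_table t \<longleftrightarrow>
     (\<forall>i<code_length t. code_length (code_nth t i) = code_length t \<and>
        (\<forall>j<code_length t. code_lookup t i j < code_length t)) \<and>
     (\<forall>i<code_length t. \<forall>j<code_length t. \<forall>k<code_length t.
        code_lookup t (code_lookup t i j) k = code_lookup t i (code_lookup t j k)) \<and>
     (\<exists>e<code_length t. \<forall>i<code_length t. code_lookup t e i = i \<and> code_lookup t i e = i \<and>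
        (\<exists>j<code_length t. code_lookup t i j = e \<and> code_lookup t j i = e))"

text \<open>The program for \<open>H\<close> is specified on group tables only; the first conjunct
  makes the predicate decidable on all numbers.\<close>

definition code_in :: "nat sgp set \<Rightarrow> nat \<Rightarrow> bool" where
  "code_in H t \<longleftrightarrow> code_group_table t \<and> table_sgp (dec_table t) \<in> H"

text \<open>The bound and the bits determine the mask of the product set uniquely;
  \<open>LEAST\<close> gives it the form that \<open>cfun_Least\<close> handles.\<close>

definition code_mult :: "nat \<Rightarrow> nat \<Rightarrow> nat \<Rightarrow> nat" where
  "code_mult t X Y = (LEAST Z. Z < 2 ^ code_length t \<and> (\<forall>z<code_length t. mem z Z \<longleftrightarrow>
     (\<exists>x<code_length t. \<exists>y<code_length t. mem x X \<and> mem y Y \<and> code_lookup t x y = z)))"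

text \<open>Associativity comes from the semigroup whose table is \<open>t\<close>.\<close>

definition code_group :: "nat \<Rightarrow> nat \<Rightarrow> nat \<Rightarrow> bool" where
  "code_group t g e \<longleftrightarrow> mem e g \<and>
     (\<forall>X<2 ^ code_length t. mem X g \<longrightarrow> code_mult t e X = X \<and> code_mult t X e = X \<and>
        (\<exists>Y<2 ^ code_length t. mem Y g \<and> code_mult t X Y = e \<and> code_mult t Y X = e)) \<and>
     (\<forall>X<2 ^ code_length t. \<forall>Y<2 ^ code_length t. mem X g \<and> mem Y g \<longrightarrow> mem (code_mult t X Y) g)"

text \<open>
  \<open>hom_bound p\<close> exceeds the codes of all tables of size at most \<open>p\<close> and of all maps from
  \<open>{..<p}\<close> to their elements.
\<close>

definition hom_bound :: "nat \<Rightarrow> nat" where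
  "hom_bound p = list_bound p (list_bound p p) + list_bound p p + 1"

text \<open>This is \<open>pl_closed\<close> with subsets as bit masks and families as masks of
  masks, in a form where every quantifier is bounded. Bounds for \<open>u\<close> and
  \<open>h\<close> exist because the image of a group of subsets has at most
  \<open>2 ^ code_length t\<close> elements, which can be renumbered from \<open>0\<close>.\<close>

definition code_closed :: "nat sgp set \<Rightarrow> nat \<Rightarrow> nat \<Rightarrow> bool" where
  "code_closed H t c \<longleftrightarrow>
     (\<forall>X<2 ^ code_length t. mem X c \<longrightarrow> X \<noteq> 0) \<and>
     (\<forall>x<code_length t. mem (2 ^ x) c) \<and>
     (\<forall>X<2 ^ code_length t. \<forall>Y<2 ^ code_length t.
        mem X c \<and> Y \<noteq> 0 \<and> (\<forall>x<code_length t. mem x Y \<longrightarrow> mem x X) \<longrightarrow> mem Y c) \<and>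
     (\<forall>X<2 ^ code_length t. \<forall>Y<2 ^ code_length t. mem X c \<and> mem Y c \<longrightarrow> mem (code_mult t X Y) c) \<and>
     (\<forall>g<2 ^ 2 ^ code_length t. \<forall>e<2 ^ code_length t.
        (\<forall>X<2 ^ code_length t. mem X g \<longrightarrow> mem X c) \<and> code_group t g e \<longrightarrow>
        (\<exists>u<hom_bound (2 ^ code_length t). \<exists>h<hom_bound (2 ^ code_length t). code_in H u \<and>
           (\<forall>X<2 ^ code_length t. mem X g \<longrightarrow> code_nth h X < code_length u) \<and>
           (\<forall>X<2 ^ code_length t. \<forall>Y<2 ^ code_length t. mem X g \<and> mem Y g \<longrightarrow>
              code_nth h (code_mult t X Y) = code_lookup u (code_nth h X) (code_nth h Y)) \<and>
           (\<exists>U<2 ^ code_length t. mem U c \<and> (\<forall>z<code_length t. mem z U \<longleftrightarrow>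
              (\<exists>X<2 ^ code_length t. mem X g \<and> code_nth h X = code_nth h e \<and> mem z X)))))"

subsection \<open>Decidability\<close>

lemma set_decode_zero_iff: "set_decode n = {} \<longleftrightarrow> n = 0"
  by (metis set_decode_inverse set_encode_empty set_decode_zero)

lemma set_encode_less: "A \<subseteq> {..<n} \<Longrightarrow> set_encode A < 2 ^ n"
proof -
  assume A: "A \<subseteq> {..<n}"
  have "set_encode A \<le> set_encode {..<n}"
    unfolding set_encode_def by (intro sum_mono2) (use A in auto)
  also have "\<dots> < 2 ^ n" unfolding set_encode_def by (induction n) (auto simp: lessThan_Suc)
  finally show ?thesis .
qed

lemma set_decode_subset: "Z < 2 ^ n \<Longrightarrow> set_decode Z \<subseteq> {..<n}"
proof
  fix x assume Z: "Z < 2 ^ n" and x: "x \<in> set_decode Z"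
  then have "Z div 2 ^ x \<noteq> 0" by (auto simp: set_decode_def intro: ccontr)
  then have "2 ^ x \<le> Z" by (metis div_less not_le)
  then have "(2::nat) ^ x < 2 ^ n" using Z by (rule le_less_trans)
  then show "x \<in> {..<n}" by simp
qed

lemma code_mult_ex: "\<exists>Z. Z < 2 ^ code_length t \<and> (\<forall>z<code_length t. mem z Z \<longleftrightarrow>
     (\<exists>x<code_length t. \<exists>y<code_length t. mem x X \<and> mem y Y \<and> code_lookup t x y = z))"
proof -
  let ?A = "{z \<in> {..<code_length t}.
    \<exists>x<code_length t. \<exists>y<code_length t. mem x X \<and> mem y Y \<and> code_lookup t x y = z}"
  have "finite ?A" by simp
  then show ?thesis
    by (intro exI[of _ "set_encode ?A"] conjI set_encode_less) (auto simp: mem_def)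
qed

lemma cfun_code_lookup [cintro]:
  "cfun n f \<Longrightarrow> cfun n g \<Longrightarrow> cfun n h \<Longrightarrow> cfun n (\<lambda>xs. code_lookup (f xs) (g xs) (h xs))"
  unfolding code_lookup_def by (intro cintro)

lemma cpred_code_group_table:
  assumes "cfun n f" shows "cpred n (\<lambda>xs. code_group_table (f xs))"
proof (rule cpred_c1[OF _ assms])
  show "cpred 1 (\<lambda>ys. code_group_table (ys ! 0))"
    unfolding code_group_table_def by (intro cintro; simp)
qed

lemma cfun_code_mult [cintro]:
  assumes "cfun n f" "cfun n g" "cfun n h" shows "cfun n (\<lambda>xs. code_mult (f xs) (g xs) (h xs))"
proof (rule cfun_c3[OF _ assms])
  show "cfun 3 (\<lambda>ys. code_mult (ys ! 0) (ys ! 1) (ys ! 2))"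
    unfolding code_mult_def
  proof (rule cfun_Least)
    show "cpred (Suc 3) (\<lambda>zs. hd zs < 2 ^ code_length (tl zs ! 0) \<and>
        (\<forall>z<code_length (tl zs ! 0). mem z (hd zs) \<longleftrightarrow> (\<exists>x<code_length (tl zs ! 0).
          \<exists>y<code_length (tl zs ! 0). mem x (tl zs ! 1) \<and> mem y (tl zs ! 2) \<and>
            code_lookup (tl zs ! 0) x y = z)))"
      by (intro cintro; simp)
  qed (rule code_mult_ex)
qed

lemma cpred_code_group [cintro]:
  assumes "cfun n f" "cfun n g" "cfun n h" shows "cpred n (\<lambda>xs. code_group (f xs) (g xs) (h xs))"
proof (rule cpred_c3[OF _ assms])
  show "cpred 3 (\<lambda>ys. code_group (ys ! 0) (ys ! 1) (ys ! 2))"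
    unfolding code_group_def by (intro cintro; simp)
qed

lemma cfun_hom_bound [cintro]: "cfun n f \<Longrightarrow> cfun n (\<lambda>xs. hom_bound (f xs))"
  unfolding hom_bound_def by (intro cintro)

lemma enc_dec_table [simp]: "enc_table (dec_table t) = t" "dec_table (enc_table T) = T"
  by (simp_all add: enc_table_def dec_table_def comp_def map_idI)

lemma code_length_enc: "code_length (enc_table T) = length T"
  by (simp add: enc_table_def code_length)

lemma code_row_enc: "i < length T \<Longrightarrow> code_nth (enc_table T) i = list_encode (T ! i)"
  by (simp add: enc_table_def code_nth)

lemma code_lookup_enc: "i < length T \<Longrightarrow> j < length (T ! i) \<Longrightarrow> code_lookup (enc_table T) i j = T ! i ! j"
  by (simp add: code_lookup_def code_row_enc code_nth)

lemma is_group_iff: "is_group S \<longleftrightarrow> (\<exists>e. group_on (sg_mult S) (carrier S) e)"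
  using is_group_restrict[of S "carrier S"] by (simp add: restrict_sgp_def is_group_def)

lemma code_group_table_enc:
  "code_group_table (enc_table T) \<longleftrightarrow> semigroup_table T \<and> is_group (table_sgp T)"
proof (cases "\<forall>i<length T. length (T ! i) = length T")
  case True
  have lk: "code_lookup (enc_table T) i j = T ! i ! j" if "i < length T" "j < length T" for i j
    using code_lookup_enc True that by simp
  have 1: "(\<forall>r\<in>set T. length r = length T)" using True by (simp add: all_set_conv_all_nth)
  have cl: "code_group_table (enc_table T) \<longleftrightarrow> (\<forall>i<length T. \<forall>j<length T. T ! i ! j < length T) \<and>
     (\<forall>i<length T. \<forall>j<length T. \<forall>k<length T. T ! (T ! i ! j) ! k = T ! i ! (T ! j ! k)) \<and>
     (\<exists>e<length T. \<forall>i<length T. T ! e ! i = i \<and> T ! i ! e = i \<and>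
        (\<exists>j<length T. T ! i ! j = e \<and> T ! j ! i = e))"
    unfolding code_group_table_def code_length_enc
    using True by (simp add: lk code_row_enc code_length cong: conj_cong)
  show ?thesis
  proof
    assume "code_group_table (enc_table T)"
    note * = iffD1[OF cl this]
    note T = conjunct1[OF *, rule_format] conjunct1[OF conjunct2[OF *], rule_format]
    from conjunct2[OF conjunct2[OF *]] obtain e where e: "e < length T \<and>
        (\<forall>i<length T. T ! e ! i = i \<and> T ! i ! e = i \<and>
        (\<exists>j<length T. T ! i ! j = e \<and> T ! j ! i = e))" by (rule exE)
    have "group_on (sg_mult (table_sgp T)) (carrier (table_sgp T)) e"
      unfolding group_on_def semigroup_on_def table_sgp_def
    proof (intro conjI ballI)
      fix i assume "i \<in> carrier \<lparr>carrier = {..<length T}, sg_mult = \<lambda>i j. T ! i ! j\<rparr>"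
      then have "\<exists>j<length T. T ! i ! j = e \<and> T ! j ! i = e" using e by simp
      then show "\<exists>y\<in>carrier \<lparr>carrier = {..<length T}, sg_mult = \<lambda>i j. T ! i ! j\<rparr>.
          sg_mult \<lparr>carrier = {..<length T}, sg_mult = \<lambda>i j. T ! i ! j\<rparr> i y = e \<and>
          sg_mult \<lparr>carrier = {..<length T}, sg_mult = \<lambda>i j. T ! i ! j\<rparr> y i = e" by auto
    qed (use T e in simp_all)
    moreover have "0 < length T" using conjunct1[OF e] by linarith
    then have "semigroup_table T"
      unfolding semigroup_table_def finite_semigroup_def table_sgp_def using 1 T by auto
    ultimately show "semigroup_table T \<and> is_group (table_sgp T)" unfolding is_group_iff by blast
  next
    assume "semigroup_table T \<and> is_group (table_sgp T)"
    then obtain e where e: "group_on (sg_mult (table_sgp T)) (carrier (table_sgp T)) e"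
      unfolding is_group_iff by blast
    note grp = group_onD[OF e, unfolded table_sgp_def partial_object.simps sgp.simps lessThan_iff]
    show "code_group_table (enc_table T)"
      unfolding cl
    proof (intro conjI)
      have "\<exists>j<length T. T ! i ! j = e \<and> T ! j ! i = e" if "i < length T" for i
        using grp(5)[OF that] by auto
      then show "\<exists>e<length T. \<forall>i<length T. T ! e ! i = i \<and> T ! i ! e = i \<and>
          (\<exists>j<length T. T ! i ! j = e \<and> T ! j ! i = e)"
        using grp(1,3,4) by (intro exI[of _ e]) simp
    qed (use grp in simp_all)
  qed
next
  case False
  then have "\<not> code_group_table (enc_table T)"
    unfolding code_group_table_def code_length_enc by (auto simp: code_row_enc code_length)
  moreover have "\<not> semigroup_table T" using False by (auto simp: semigroup_table_def)
  ultimately show ?thesis by simp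
qed

text \<open>The given program may fail to halt on numbers that do not code group tables. Such inputs
  are first replaced by the table of the trivial group, and the conjunct
  \<open>code_group_table\<close> then rejects them.\<close>

lemma cpred_code_in:
  assumes H: "decidable_group_membership H" and f: "cfun n f"
  shows "cpred n (\<lambda>xs. code_in H (f xs))"
proof (rule cpred_c1[OF _ f])
  obtain p where p: "\<And>T. semigroup_table T \<and> is_group (table_sgp T) \<Longrightarrow>
      computes p [enc_table T] (if table_sgp T \<in> H then 1 else 0)"
    using H unfolding decidable_group_membership_def decidable_on_def by blast
  define g where "g ys = (if code_group_table (ys ! 0) then ys ! 0 else enc_table [[0]])" for ys
  have "cfun 1 g" unfolding g_def by (intro cintro cpred_code_group_table; simp)
  then obtain q where q: "\<And>ys. length ys = 1 \<Longrightarrow> computes q ys (g ys)" unfolding cfun_def by auto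
  have triv: "code_group_table (enc_table [[0]])"
    unfolding code_group_table_def 
    by (simp add: code_length_enc code_row_enc code_lookup_enc code_length[of "[0]", simplified])
  have "computes (Comp p [q]) ys (if table_sgp (dec_table (g ys)) \<in> H then 1 else 0)"
    if ys: "length ys = 1" for ys
  proof (rule computes.comp)
    show "list_all2 (\<lambda>q y. computes q ys y) [q] [g ys]" using q[OF ys] by simp
    have "code_group_table (g ys)" using triv by (simp add: g_def)
    then show "computes p [g ys] (if table_sgp (dec_table (g ys)) \<in> H then 1 else 0)"
      using p[of "dec_table (g ys)"] code_group_table_enc[of "dec_table (g ys)"] by simp
  qed
  then have "cpred 1 (\<lambda>ys. table_sgp (dec_table (g ys)) \<in> H)"
    unfolding cpred_def cfun_def by blast
  then have "cpred 1 (\<lambda>ys. code_group_table (ys ! 0) \<and> table_sgp (dec_table (g ys)) \<in> H)"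
    by (intro cintro cpred_code_group_table; simp)
  then show "cpred 1 (\<lambda>ys. code_in H (ys ! 0))"
    by (rule cpred_cong) (auto simp: code_in_def g_def)
qed

lemma cpred_code_closed:
  assumes H: "decidable_group_membership H" and f: "cfun n f" "cfun n g"
  shows "cpred n (\<lambda>xs. code_closed H (f xs) (g xs))"
proof (rule cpred_c2[OF _ f])
  show "cpred 2 (\<lambda>ys. code_closed H (ys ! 0) (ys ! 1))"
    unfolding code_closed_def by (intro cintro cpred_code_in[OF H]; simp)
qed

section \<open>Homomorphisms, subsets and families as numbers\<close>

context pseudovar
begin

lemma hom_into_code:
  assumes u: "code_in H u" and h: "\<forall>X\<in>G. h X < code_length u"
    "\<forall>X\<in>G. \<forall>Y\<in>G. h (m X Y) = code_lookup u (h X) (h Y)"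
  shows "hom_into H m G h"
proof -
  let ?T = "dec_table u"
  have T: "semigroup_table ?T" "table_sgp ?T \<in> H" and L: "code_length u = length ?T"
    using u code_group_table_enc[of ?T] code_length_enc[of ?T] by (simp_all add: code_in_def)
  have row: "length (?T ! i) = length ?T" if "i < length ?T" for i
    using T(1) that by (simp add: semigroup_table_def)
  have lk: "code_lookup u i j = ?T ! i ! j" if "i < length ?T" "j < length ?T" for i j
    using code_lookup_enc[of i ?T j] row that by simp
  show ?thesis
    unfolding hom_into_def
  proof (rule bexI[OF _ T(2)], intro conjI ballI)
    show "h ` G \<subseteq> carrier (table_sgp ?T)" using h(1) L by (auto simp: table_sgp_def)
    show "h (m X Y) = sg_mult (table_sgp ?T) (h X) (h Y)" if "X \<in> G" "Y \<in> G" for X Y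
      using h that lk L by (simp add: table_sgp_def)
  qed
qed

text \<open>The member \<open>Q\<close> of \<open>H\<close> may be arbitrarily large, but only the
  image of \<open>h\<close> matters. It has at most \<open>p\<close> elements, and numbered by
  \<open>d\<close> it is the semigroup of a small table that is again in \<open>H\<close>. The
  renumbered map has the kernel of \<open>h\<close>, which is what saturation speaks about.\<close>

lemma hom_into_codeE:
  fixes m :: "nat \<Rightarrow> nat \<Rightarrow> nat"
  assumes h: "hom_into H m G h" and G: "group_on m G e" "G \<subseteq> {..<p}"
  obtains u k where "u < hom_bound p" "k < hom_bound p" "code_in H u"
    "\<forall>X\<in>G. code_nth k X < code_length u"
    "\<forall>X\<in>G. \<forall>Y\<in>G. code_nth k (m X Y) = code_lookup u (code_nth k X) (code_nth k Y)"
    "\<forall>X\<in>G. \<forall>Y\<in>G. code_nth k X = code_nth k Y \<longleftrightarrow> h X = h Y"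
proof -
  have finG: "finite G" using G(2) finite_subset by blast
  from h obtain Q where Q: "Q \<in> H" "h ` G \<subseteq> carrier Q"
    "\<forall>x\<in>G. \<forall>y\<in>G. h (m x y) = sg_mult Q (h x) (h y)" by (rule hom_intoE)
  define n where "n = card (h ` G)"
  have "n \<le> card G" unfolding n_def using finG by (rule card_image_le)
  also have "\<dots> \<le> p" using card_mono[OF _ G(2)] by simp
  finally have np: "n \<le> p" .
  obtain d where d: "bij_betw d (h ` G) {0..<n}"
    using ex_bij_betw_finite_nat[of "h ` G"] finG unfolding n_def by blast
  let ?i = "inv_into (h ` G) d"
  have di: "inj_on d (h ` G)" "d ` h ` G = {0..<n}" using d by (auto simp: bij_betw_def)
  define T where "T = map (\<lambda>i. map (\<lambda>j. d (sg_mult Q (?i i) (?i j))) [0..<n]) [0..<n]"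
  have lenT: "length T = n" by (simp add: T_def)
  have cl: "m X Y \<in> G" if "X \<in> G" "Y \<in> G" for X Y using group_onD(2)[OF G(1) that] .
  have dn: "d (h X) < n" if "X \<in> G" for X using di(2) that by auto
  have ex: "\<exists>X\<in>G. i = d (h X)" if "i < n" for i
  proof -
    have "i \<in> d ` h ` G" using that di(2) by simp
    then show ?thesis by blast
  qed
  have TXY: "T ! d (h X) ! d (h Y) = d (h (m X Y))" if "X \<in> G" "Y \<in> G" for X Y
    using dn that Q(3) di(1) by (simp add: T_def)
  have car: "carrier (table_sgp T) = (d \<circ> h) ` G"
    using di(2) by (simp add: table_sgp_def lenT image_comp atLeast0LessThan)
  have mult: "sg_mult (table_sgp T) ((d \<circ> h) X) ((d \<circ> h) Y) = (d \<circ> h) (m X Y)"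
    if "X \<in> G" "Y \<in> G" for X Y using TXY[OF that] by (simp add: table_sgp_def)
  have TH: "table_sgp T \<in> H"
  proof (rule hom_image_in[OF h _ _ finG _ car mult])
    show "semigroup_on m G" using G(1) by (simp add: group_on_def)
    show "G \<noteq> {}" using group_onD(1)[OF G(1)] by blast
  qed simp_all
  have "group_on (sg_mult (table_sgp T)) ((d \<circ> h) ` G) ((d \<circ> h) e)"
    by (rule group_on_image[OF G(1)]) (simp only: mult)
  then have "is_group (table_sgp T)" unfolding is_group_iff car by blast
  moreover have "semigroup_table T"
    using fin[OF TH] unfolding semigroup_table_def by (auto simp: T_def)
  ultimately have in_H: "code_in H (enc_table T)"
    using TH code_group_table_enc by (simp add: code_in_def)
  have entry: "T ! i ! j < n" if "i < n" "j < n" for i j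
    using ex[OF that(1)] ex[OF that(2)] TXY dn cl by auto
  have row: "list_encode r \<le> list_bound p p" if r: "r \<in> set T" for r
  proof (rule list_encode_le_bound)
    obtain i where i: "i < n" "r = T ! i" using r lenT by (metis in_set_conv_nth)
    then have lr: "length r = n" by (simp add: T_def)
    then show "length r \<le> p" using np by simp
    show "\<forall>x\<in>set r. x \<le> p"
    proof
      fix x assume "x \<in> set r"
      then obtain j where "j < n" "x = T ! i ! j" using lr i(2) by (metis in_set_conv_nth)
      then have "x < n" using entry[OF i(1)] by simp
      then show "x \<le> p" using np by simp
    qed
  qed
  have "enc_table T \<le> list_bound p (list_bound p p)"
    unfolding enc_table_def using row lenT np by (intro list_encode_le_bound) auto
  then have 1: "enc_table T < hom_bound p" by (simp add: hom_bound_def)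
  \<comment> \<open>The value \<open>0\<close> outside \<open>G\<close> is a filler that makes the
    position in the list equal to the argument.\<close>
  define k where "k = list_encode (map (\<lambda>X. if X \<in> G then d (h X) else 0) [0..<p])"
  have "k \<le> list_bound p p"
    unfolding k_def using dn np by (intro list_encode_le_bound) (auto intro: less_imp_le less_le_trans)
  then have 2: "k < hom_bound p" by (simp add: hom_bound_def)
  have k: "code_nth k X = d (h X)" if X: "X \<in> G" for X
  proof -
    have "X < p" using X G(2) by blast
    then show ?thesis using X by (simp add: k_def code_nth)
  qed
  have lk: "code_lookup (enc_table T) i j = T ! i ! j" if "i < n" "j < n" for i j
    using that by (intro code_lookup_enc) (simp_all add: T_def)
  show thesis
  proof (rule that[OF 1 2 in_H])
    show "\<forall>X\<in>G. code_nth k X < code_length (enc_table T)"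
      using k dn by (simp add: code_length_enc lenT)
    show "\<forall>X\<in>G. \<forall>Y\<in>G. code_nth k (m X Y) = code_lookup (enc_table T) (code_nth k X) (code_nth k Y)"
      using k cl lk dn TXY by simp
    show "\<forall>X\<in>G. \<forall>Y\<in>G. code_nth k X = code_nth k Y \<longleftrightarrow> h X = h Y"
      using k di(1) by (simp add: inj_on_eq_iff)
  qed
qed

end

locale table_instance = pseudovar +
  fixes T :: "nat list list"
  assumes T: "semigroup_table T"
begin

abbreviation "t \<equiv> enc_table T"
abbreviation "N \<equiv> length T"
abbreviation "S \<equiv> table_sgp T"
abbreviation "prd \<equiv> code_mult t"

lemma S: "finite_semigroup S"
  using T by (simp add: semigroup_table_def)

lemma carrier_S: "carrier S = {..<N}"
  by (simp add: table_sgp_def)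

lemma lookup: "i < N \<Longrightarrow> j < N \<Longrightarrow> code_lookup t i j = sg_mult S i j"
  using T by (simp add: semigroup_table_def table_sgp_def code_lookup_enc)

lemma mult_less: "prd X Y < 2 ^ N"
  and mem_mult: "z < N \<Longrightarrow> mem z (prd X Y) \<longleftrightarrow>
     (\<exists>x<N. \<exists>y<N. mem x X \<and> mem y Y \<and> code_lookup t x y = z)"
  using LeastI_ex[OF code_mult_ex[of t X Y]] unfolding code_mult_def code_length_enc by simp_all

lemma decode_mult:
  assumes X: "X < 2 ^ N" and Y: "Y < 2 ^ N"
  shows "set_decode (prd X Y) = setmult S (set_decode X) (set_decode Y)"
proof -
  have sub: "set_decode X \<subseteq> {..<N}" "set_decode Y \<subseteq> {..<N}" "set_decode (prd X Y) \<subseteq> {..<N}"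
    using set_decode_subset X Y mult_less by blast+
  have cl: "sg_mult S x y < N" if "x < N" "y < N" for x y
    using S that unfolding finite_semigroup_def carrier_S by simp
  show ?thesis
  proof (intro equalityI subsetI)
    fix z assume z: "z \<in> set_decode (prd X Y)"
    then have "z < N" using sub by blast
    then obtain x y where "x < N" "y < N" "mem x X" "mem y Y" "code_lookup t x y = z"
      using mem_mult[of z X Y] z unfolding mem_def by blast
    then show "z \<in> setmult S (set_decode X) (set_decode Y)"
      using setmultI[of x "set_decode X" y "set_decode Y" S] lookup[of x y] by (simp add: mem_def)
  next
    fix z assume "z \<in> setmult S (set_decode X) (set_decode Y)"
    then obtain x y where xy: "x \<in> set_decode X" "y \<in> set_decode Y" "z = sg_mult S x y" by (rule setmultE)
    then have xyN: "x < N" "y < N" using sub by blast+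
    then have "\<exists>x<N. \<exists>y<N. mem x X \<and> mem y Y \<and> code_lookup t x y = z"
      using xy lookup by (intro exI[of _ x] conjI exI[of _ y]) (simp_all add: mem_def)
    then show "z \<in> set_decode (prd X Y)"
      using mem_mult[of z X Y] cl[OF xyN] xy(3) by (simp add: mem_def)
  qed
qed

lemma decode_inj: "set_decode X = set_decode Y \<Longrightarrow> X = Y"
  by (metis set_decode_inverse)

lemma mult_assoc:
  assumes "X < 2 ^ N" "Y < 2 ^ N" "Z < 2 ^ N"
  shows "prd (prd X Y) Z = prd X (prd Y Z)"
proof (rule decode_inj)
  have assoc: "sg_mult S (sg_mult S x y) z = sg_mult S x (sg_mult S y z)"
    if "x < N" "y < N" "z < N" for x y z
    using S that unfolding finite_semigroup_def carrier_S by simp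
  have sub: "set_decode X \<subseteq> {..<N}" "set_decode Y \<subseteq> {..<N}" "set_decode Z \<subseteq> {..<N}"
    using set_decode_subset assms by blast+
  have "setmult S (setmult S A B) C = setmult S A (setmult S B C)"
    if "A \<subseteq> {..<N}" "B \<subseteq> {..<N}" "C \<subseteq> {..<N}" for A B C
  proof (intro equalityI subsetI)
    fix x assume "x \<in> setmult S (setmult S A B) C"
    then obtain a b c where abc: "a \<in> A" "b \<in> B" "c \<in> C" "x = sg_mult S (sg_mult S a b) c"
      by (auto elim!: setmultE)
    then have "a < N" "b < N" "c < N" using that by auto
    then have "x = sg_mult S a (sg_mult S b c)" using assoc abc(4) by simp
    then show "x \<in> setmult S A (setmult S B C)" using abc by (auto intro!: setmultI)
  next
    fix x assume "x \<in> setmult S A (setmult S B C)"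
    then obtain a b c where abc: "a \<in> A" "b \<in> B" "c \<in> C" "x = sg_mult S a (sg_mult S b c)"
      by (auto elim!: setmultE)
    then have "a < N" "b < N" "c < N" using that by auto
    then have "x = sg_mult S (sg_mult S a b) c" using assoc abc(4) by simp
    then show "x \<in> setmult S (setmult S A B) C" using abc by (auto intro!: setmultI)
  qed
  then show "set_decode (prd (prd X Y) Z) = set_decode (prd X (prd Y Z))"
    using assms mult_less sub by (simp add: decode_mult)
qed

lemma code_group_iff:
  assumes "set_decode g \<subseteq> {..<2 ^ N}"
  shows "code_group t g e \<longleftrightarrow> group_on prd (set_decode g) e"
proof -
  have "semigroup_on prd (set_decode g) \<longleftrightarrow>
      (\<forall>X\<in>set_decode g. \<forall>Y\<in>set_decode g. prd X Y \<in> set_decode g)"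
    unfolding semigroup_on_def using mult_assoc assms by blast
  then show ?thesis
    unfolding code_group_def group_on_def code_length_enc mem_def using assms by blast
qed

definition family :: "nat \<Rightarrow> nat set set" where
  "family c = set_decode ` set_decode c"

lemma decode_in_family: "set_decode X \<in> family c \<longleftrightarrow> mem X c"
  unfolding family_def mem_def using decode_inj by blast

text \<open>\<open>set_decode\<close> is injective, and multiplicative on the masks in
  \<open>c\<close>. So groups, homomorphisms and kernels carry over along it and its inverse
  \<open>set_encode\<close>.\<close>

lemma saturated_family:
  assumes c: "set_decode c \<subseteq> {..<2 ^ N}"
  shows "saturated H (setmult S) (family c) \<longleftrightarrow>
    (\<forall>X\<in>set_decode c. \<forall>Y\<in>set_decode c. mem (prd X Y) c) \<and>
    (\<forall>G e. G \<subseteq> set_decode c \<and> group_on prd G e \<longrightarrow>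
       (\<exists>h. hom_into H prd G h \<and> \<Union>(set_decode ` {X \<in> G. h X = h e}) \<in> family c))"
proof -
  have less: "X < 2 ^ N" if "X \<in> set_decode c" for X using c that by blast
  have dm: "setmult S (set_decode X) (set_decode Y) = set_decode (prd X Y)"
    if "X \<in> set_decode c" "Y \<in> set_decode c" for X Y using decode_mult less that by simp
  have 1: "(\<forall>x\<in>family c. \<forall>y\<in>family c. setmult S x y \<in> family c) \<longleftrightarrow>
      (\<forall>X\<in>set_decode c. \<forall>Y\<in>set_decode c. mem (prd X Y) c)"
    by (subst (1 2) family_def) (simp add: dm decode_in_family)
  have 2: "(\<exists>h. hom_into H (setmult S) G h \<and> \<Union>{g \<in> G. h g = h E} \<in> family c)"
    if R: "\<forall>G e. G \<subseteq> set_decode c \<and> group_on prd G e \<longrightarrow>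
       (\<exists>h. hom_into H prd G h \<and> \<Union>(set_decode ` {X \<in> G. h X = h e}) \<in> family c)"
      and G: "G \<subseteq> family c" "group_on (setmult S) G E" for G E
  proof -
    have enc: "set_decode (set_encode g) = g" "set_encode g \<in> set_decode c" if g: "g \<in> G" for g
      using G(1) g unfolding family_def by auto
    have hom: "set_encode (setmult S x y) = prd (set_encode x) (set_encode y)" if "x \<in> G" "y \<in> G" for x y
      using dm[OF enc(2) enc(2), OF that] enc(1) that by (metis set_decode_inverse)
    have "group_on prd (set_encode ` G) (set_encode E)"
      using group_on_image[of "setmult S" G E set_encode prd] G(2) hom by blast
    moreover have "set_encode ` G \<subseteq> set_decode c" using enc(2) by blast
    ultimately obtain h where h: "hom_into H prd (set_encode ` G) h"
      "\<Union>(set_decode ` {X \<in> set_encode ` G. h X = h (set_encode E)}) \<in> family c" using R by metis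
    from h(1) obtain Q where Q: "Q \<in> H" "h ` set_encode ` G \<subseteq> carrier Q"
      "\<forall>x\<in>set_encode ` G. \<forall>y\<in>set_encode ` G. h (prd x y) = sg_mult Q (h x) (h y)" by (rule hom_intoE)
    have "hom_into H (setmult S) G (\<lambda>x. h (set_encode x))"
      unfolding hom_into_def
      by (rule bexI[OF _ Q(1)]) (use Q(2,3) hom in \<open>simp add: image_subset_iff\<close>)
    moreover have "set_decode ` {X \<in> set_encode ` G. h X = h (set_encode E)} =
        {g \<in> G. h (set_encode g) = h (set_encode E)}"
    proof (intro equalityI subsetI)
      fix x assume "x \<in> set_decode ` {X \<in> set_encode ` G. h X = h (set_encode E)}"
      then obtain g where "g \<in> G" "h (set_encode g) = h (set_encode E)" "x = set_decode (set_encode g)"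
        by blast
      then show "x \<in> {g \<in> G. h (set_encode g) = h (set_encode E)}" using enc(1) by simp
    next
      fix x assume "x \<in> {g \<in> G. h (set_encode g) = h (set_encode E)}"
      then show "x \<in> set_decode ` {X \<in> set_encode ` G. h X = h (set_encode E)}"
        using enc(1) by (intro image_eqI[of _ _ "set_encode x"]) auto
    qed
    ultimately show ?thesis using h(2) by (intro exI[of _ "\<lambda>x. h (set_encode x)"] conjI) simp_all
  qed
  have 3: "(\<exists>h. hom_into H prd G h \<and> \<Union>(set_decode ` {X \<in> G. h X = h e}) \<in> family c)"
    if L: "\<forall>G e. G \<subseteq> family c \<and> group_on (setmult S) G e \<longrightarrow>
       (\<exists>h. hom_into H (setmult S) G h \<and> \<Union>{g \<in> G. h g = h e} \<in> family c)"
      and G: "G \<subseteq> set_decode c" "group_on prd G e" for G e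
  proof -
    have hom: "set_decode (prd x y) = setmult S (set_decode x) (set_decode y)" if "x \<in> G" "y \<in> G" for x y
      using dm G(1) that by (simp add: subset_iff)
    have "group_on (setmult S) (set_decode ` G) (set_decode e)"
      using group_on_image[of prd G e set_decode "setmult S"] G(2) hom by blast
    moreover have "set_decode ` G \<subseteq> family c" using G(1) unfolding family_def by blast
    ultimately obtain h where h: "hom_into H (setmult S) (set_decode ` G) h"
      "\<Union>{g \<in> set_decode ` G. h g = h (set_decode e)} \<in> family c" using L by metis
    from h(1) obtain Q where Q: "Q \<in> H" "h ` set_decode ` G \<subseteq> carrier Q"
      "\<forall>x\<in>set_decode ` G. \<forall>y\<in>set_decode ` G. h (setmult S x y) = sg_mult Q (h x) (h y)" by (rule hom_intoE)
    have "hom_into H prd G (\<lambda>x. h (set_decode x))"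
      unfolding hom_into_def
      by (rule bexI[OF _ Q(1)]) (use Q(2,3) hom in \<open>simp add: image_subset_iff\<close>)
    moreover have "{g \<in> set_decode ` G. h g = h (set_decode e)} =
        set_decode ` {X \<in> G. h (set_decode X) = h (set_decode e)}" by blast
    ultimately show ?thesis using h(2) by (intro exI[of _ "\<lambda>x. h (set_decode x)"] conjI) simp_all
  qed
  have "(\<forall>G E. G \<subseteq> family c \<and> group_on (setmult S) G E \<longrightarrow>
       (\<exists>h. hom_into H (setmult S) G h \<and> \<Union>{g \<in> G. h g = h E} \<in> family c)) \<longleftrightarrow>
     (\<forall>G e. G \<subseteq> set_decode c \<and> group_on prd G e \<longrightarrow>
       (\<exists>h. hom_into H prd G h \<and> \<Union>(set_decode ` {X \<in> G. h X = h e}) \<in> family c))"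
    (is "?L \<longleftrightarrow> ?R")
  proof
    assume L: ?L
    show ?R by (intro allI impI, erule conjE, rule 3[OF L])
  next
    assume R: ?R
    show ?L by (intro allI impI, erule conjE, rule 2[OF R])
  qed
  then show ?thesis unfolding saturated_def 1 by (rule arg_cong)
qed

lemma code_closed_iff:
  assumes c: "c < 2 ^ 2 ^ N"
  shows "code_closed H t c \<longleftrightarrow> pl_closed H S (family c)"
proof -
  have cS: "set_decode c \<subseteq> {..<2 ^ N}" using set_decode_subset[OF c] .
  have less: "X < 2 ^ N" if "X \<in> set_decode c" for X using cS that by blast
  have sub: "set_decode X \<subseteq> {..<N}" if "X < 2 ^ N" for X using set_decode_subset[OF that] .
  have "(\<forall>X<2 ^ N. mem X c \<longrightarrow> X \<noteq> 0) \<longleftrightarrow> (\<forall>X\<in>set_decode c. set_decode X \<noteq> {})"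
    unfolding set_decode_zero_iff mem_def using less by blast
  also have "\<dots> \<longleftrightarrow> family c \<subseteq> Pow (carrier S) - {{}}"
    unfolding family_def carrier_S using less sub by blast
  finally have 1: "(\<forall>X<2 ^ N. mem X c \<longrightarrow> X \<noteq> 0) \<longleftrightarrow> family c \<subseteq> Pow (carrier S) - {{}}" .
  have "set_decode (2 ^ x) = {x}" for x
    using set_encode_inverse[of "{x}"] by (simp add: set_encode_def)
  then have 2: "(\<forall>x<N. mem (2 ^ x) c) \<longleftrightarrow> (\<forall>s\<in>carrier S. {s} \<in> family c)"
    unfolding carrier_S by (metis decode_in_family lessThan_iff)
  have 3: "(\<forall>X<2 ^ N. \<forall>Y<2 ^ N. mem X c \<and> Y \<noteq> 0 \<and> (\<forall>x<N. mem x Y \<longrightarrow> mem x X) \<longrightarrow> mem Y c) \<longleftrightarrow>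
      (\<forall>X\<in>family c. \<forall>Y. Y \<subseteq> X \<and> Y \<noteq> {} \<longrightarrow> Y \<in> family c)" (is "?L \<longleftrightarrow> ?R")
  proof
    assume L: ?L
    show ?R
    proof (intro ballI allI impI)
      fix X' Y' assume X': "X' \<in> family c" and Y': "Y' \<subseteq> X' \<and> Y' \<noteq> {}"
      obtain X where X: "X \<in> set_decode c" "X' = set_decode X" using X' unfolding family_def by blast
      have "Y' \<subseteq> {..<N}" using Y' X less sub by blast
      then have Y: "set_encode Y' < 2 ^ N" "set_decode (set_encode Y') = Y'"
        using set_encode_less set_encode_inverse finite_subset[OF _ finite_lessThan] by blast+
      then have "set_encode Y' \<noteq> 0" using Y' set_decode_zero_iff by metis
      moreover have "\<forall>x<N. mem x (set_encode Y') \<longrightarrow> mem x X" using Y Y' X by (auto simp: mem_def)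
      ultimately have "mem (set_encode Y') c" using L X(1) less Y(1) unfolding mem_def by blast
      then show "Y' \<in> family c" using Y(2) decode_in_family by metis
    qed
  next
    assume R: ?R
    show ?L
    proof (intro allI impI, elim conjE)
      fix X Y assume XY: "X < 2 ^ N" "Y < 2 ^ N" "mem X c" "Y \<noteq> 0" "\<forall>x<N. mem x Y \<longrightarrow> mem x X"
      have "set_decode X \<in> family c" using XY(3) by (simp only: decode_in_family)
      moreover have "set_decode Y \<subseteq> set_decode X" using XY(5) sub[OF XY(2)] unfolding mem_def by blast
      moreover have "set_decode Y \<noteq> {}" using XY(4) by (simp only: set_decode_zero_iff not_False_eq_True)
      ultimately have "set_decode Y \<in> family c" using R[rule_format] by blast
      then show "mem Y c" by (simp only: decode_in_family)
    qed
  qed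
  have 4: "(\<forall>X<2 ^ N. \<forall>Y<2 ^ N. mem X c \<and> mem Y c \<longrightarrow> mem (prd X Y) c) \<longleftrightarrow>
      (\<forall>X\<in>set_decode c. \<forall>Y\<in>set_decode c. mem (prd X Y) c)"
    unfolding mem_def using less by blast
  \<comment> \<open>A mask below \<open>2 ^ N\<close> is determined by its bits below
    \<open>N\<close>, so a \<open>U\<close> in \<open>c\<close> with the bits of the union exists
    exactly if the union is in the family.\<close>
  have kernel: "(\<exists>U<2 ^ N. mem U c \<and> (\<forall>z<N. mem z U \<longleftrightarrow>
      (\<exists>X<2 ^ N. mem X g \<and> h X = h e \<and> mem z X))) \<longleftrightarrow>
      \<Union>(set_decode ` {X \<in> set_decode g. h X = h e}) \<in> family c" (is "?L \<longleftrightarrow> ?R")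
    if g: "set_decode g \<subseteq> set_decode c" for g e and h :: "nat \<Rightarrow> nat"
  proof -
    have UN: "(\<forall>z<N. mem z U \<longleftrightarrow> (\<exists>X<2 ^ N. mem X g \<and> h X = h e \<and> mem z X)) \<longleftrightarrow>
        set_decode U = \<Union>(set_decode ` {X \<in> set_decode g. h X = h e})" if U: "U < 2 ^ N" for U
    proof -
      have "\<Union>(set_decode ` {X \<in> set_decode g. h X = h e}) \<subseteq> {..<N}" using g less sub by blast
      moreover have "(\<exists>X<2 ^ N. mem X g \<and> h X = h e \<and> mem z X) \<longleftrightarrow>
          z \<in> \<Union>(set_decode ` {X \<in> set_decode g. h X = h e})" for z
        unfolding mem_def using g less by auto
      ultimately show ?thesis
        unfolding mem_def using sub[OF U] by (simp only: set_eq_iff) (meson lessThan_iff subsetD)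
    qed
    have "?L \<longleftrightarrow> (\<exists>U<2 ^ N. mem U c \<and> set_decode U = \<Union>(set_decode ` {X \<in> set_decode g. h X = h e}))"
      using UN by (intro arg_cong[where f = Ex] ext) (simp cong: conj_cong)
    also have "\<dots> \<longleftrightarrow> ?R" 
      unfolding family_def mem_def using less by auto
    finally show ?thesis .
  qed
  have 5: "(\<forall>g<2 ^ 2 ^ N. \<forall>e<2 ^ N. (\<forall>X<2 ^ N. mem X g \<longrightarrow> mem X c) \<and> code_group t g e \<longrightarrow>
        (\<exists>u<hom_bound (2 ^ N). \<exists>h<hom_bound (2 ^ N). code_in H u \<and>
           (\<forall>X<2 ^ N. mem X g \<longrightarrow> code_nth h X < code_length u) \<and>
           (\<forall>X<2 ^ N. \<forall>Y<2 ^ N. mem X g \<and> mem Y g \<longrightarrow>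
              code_nth h (prd X Y) = code_lookup u (code_nth h X) (code_nth h Y)) \<and>
           (\<exists>U<2 ^ N. mem U c \<and> (\<forall>z<N. mem z U \<longleftrightarrow>
              (\<exists>X<2 ^ N. mem X g \<and> code_nth h X = code_nth h e \<and> mem z X))))) \<longleftrightarrow>
     (\<forall>G e. G \<subseteq> set_decode c \<and> group_on prd G e \<longrightarrow>
       (\<exists>h. hom_into H prd G h \<and> \<Union>(set_decode ` {X \<in> G. h X = h e}) \<in> family c))" (is "?L \<longleftrightarrow> ?R")
  proof
    assume L: ?L
    show ?R
    proof (intro allI impI)
      fix G e assume Ge: "G \<subseteq> set_decode c \<and> group_on prd G e"
      then have GS: "G \<subseteq> {..<2 ^ N}" using cS by blast
      define g where "g = set_encode G"
      have g: "set_decode g = G" "g < 2 ^ 2 ^ N"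
        unfolding g_def
        using GS set_encode_less set_encode_inverse finite_subset[OF _ finite_lessThan] by blast+
      have cg: "code_group t g e" using code_group_iff[of g e] g(1) GS Ge by simp
      have e: "e < 2 ^ N" using group_onD(1)[of prd G e] Ge GS by blast
      have gc: "\<forall>X<2 ^ N. mem X g \<longrightarrow> mem X c" using g(1) Ge unfolding mem_def by blast
      obtain u k where uk: "code_in H u"
        "\<forall>X<2 ^ N. mem X g \<longrightarrow> code_nth k X < code_length u"
        "\<forall>X<2 ^ N. \<forall>Y<2 ^ N. mem X g \<and> mem Y g \<longrightarrow>
              code_nth k (prd X Y) = code_lookup u (code_nth k X) (code_nth k Y)"
        "\<exists>U<2 ^ N. mem U c \<and> (\<forall>z<N. mem z U \<longleftrightarrow>
              (\<exists>X<2 ^ N. mem X g \<and> code_nth k X = code_nth k e \<and> mem z X))"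
        using L[THEN spec, THEN mp, OF g(2), THEN spec, THEN mp, OF e, THEN mp, OF conjI[OF gc cg]]
        by (elim exE conjE) (rule that; (assumption | intro exI conjI; assumption))
      have "hom_into H prd G (code_nth k)"
        by (rule hom_into_code[OF uk(1)]) (use uk(2,3) g(1) GS in \<open>auto simp: mem_def\<close>)
      moreover have "\<Union>(set_decode ` {X \<in> G. code_nth k X = code_nth k e}) \<in> family c"
        using kernel[of g "code_nth k" e] uk(4) g(1) Ge by simp
      ultimately show "\<exists>h. hom_into H prd G h \<and> \<Union>(set_decode ` {X \<in> G. h X = h e}) \<in> family c" by blast
    qed
  next
    assume R: ?R
    show ?L
    proof (intro allI impI, elim conjE)
      fix g e assume g: "g < 2 ^ 2 ^ N" "e < 2 ^ N" "\<forall>X<2 ^ N. mem X g \<longrightarrow> mem X c" "code_group t g e"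
      let ?G = "set_decode g"
      have GS: "?G \<subseteq> {..<2 ^ N}" using set_decode_subset[OF g(1)] .
      then have Gc: "?G \<subseteq> set_decode c" using g(3) unfolding mem_def by blast
      have G: "group_on prd ?G e" using code_group_iff[OF GS] g(4) by simp
      obtain h where h: "hom_into H prd ?G h" "\<Union>(set_decode ` {X \<in> ?G. h X = h e}) \<in> family c"
        using R Gc G by blast
      from h(1) G GS obtain u k where uk: "u < hom_bound (2 ^ N)" "k < hom_bound (2 ^ N)" "code_in H u"
        "\<forall>X\<in>?G. code_nth k X < code_length u"
        "\<forall>X\<in>?G. \<forall>Y\<in>?G. code_nth k (prd X Y) = code_lookup u (code_nth k X) (code_nth k Y)"
        "\<forall>X\<in>?G. \<forall>Y\<in>?G. code_nth k X = code_nth k Y \<longleftrightarrow> h X = h Y"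
        by (rule hom_into_codeE)
      have "{X \<in> ?G. code_nth k X = code_nth k e} = {X \<in> ?G. h X = h e}"
        using uk(6) group_onD(1)[OF G] by blast
      then have ker: "\<exists>U<2 ^ N. mem U c \<and> (\<forall>z<N. mem z U \<longleftrightarrow>
              (\<exists>X<2 ^ N. mem X g \<and> code_nth k X = code_nth k e \<and> mem z X))"
        using kernel[OF Gc, of "code_nth k" e] h(2) by simp
      show "\<exists>u<hom_bound (2 ^ N). \<exists>h<hom_bound (2 ^ N). code_in H u \<and>
           (\<forall>X<2 ^ N. mem X g \<longrightarrow> code_nth h X < code_length u) \<and>
           (\<forall>X<2 ^ N. \<forall>Y<2 ^ N. mem X g \<and> mem Y g \<longrightarrow>
              code_nth h (prd X Y) = code_lookup u (code_nth h X) (code_nth h Y)) \<and>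
           (\<exists>U<2 ^ N. mem U c \<and> (\<forall>z<N. mem z U \<longleftrightarrow>
              (\<exists>X<2 ^ N. mem X g \<and> code_nth h X = code_nth h e \<and> mem z X)))"
        by (rule exI[of _ u], rule conjI[OF uk(1)], rule exI[of _ k], intro conjI uk(2,3) ker)
          (use uk(4,5) in \<open>simp_all add: mem_def\<close>)
    qed
  qed
  show ?thesis
    unfolding code_closed_def pl_closed_def code_length_enc saturated_family[OF cS]
    using 1 2 3 4 5 by argo
qed

text \<open>A closed family consists of subsets of \<open>{..<N}\<close> and is thus
  \<open>family c\<close> for some \<open>c\<close> below \<open>2 ^ 2 ^ N\<close>. The quantifier
  over families in \<open>PL_iff\<close> becomes a bounded search.\<close>

lemma PL_code:
  assumes X: "X \<subseteq> carrier S"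
  shows "X \<in> PL (GH H) S \<longleftrightarrow> (\<forall>c<2 ^ 2 ^ N. code_closed H t c \<longrightarrow> mem (set_encode X) c)"
proof -
  have finX: "finite X" using X carrier_S finite_subset by auto
  have mem: "mem (set_encode X) c \<longleftrightarrow> X \<in> family c" for c
    using decode_in_family[of "set_encode X" c] finX by simp
  have "\<exists>c<2 ^ 2 ^ N. C = family c" if C: "pl_closed H S C" for C
  proof -
    have CN: "C \<subseteq> Pow {..<N}" using C unfolding pl_closed_def carrier_S by blast
    then have fin: "\<And>Y. Y \<in> C \<Longrightarrow> finite Y" and "finite C"
      using finite_subset[of _ "{..<N}"] finite_subset[of C "Pow {..<N}"] by auto
    let ?c = "set_encode (set_encode ` C)"
    have "set_encode ` C \<subseteq> {..<2 ^ N}" using CN set_encode_less by blast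
    then have "?c < 2 ^ 2 ^ N" by (rule set_encode_less)
    moreover have "family ?c = C"
      unfolding family_def using \<open>finite C\<close> fin by (force simp: image_image)
    ultimately show ?thesis by blast
  qed
  then show ?thesis unfolding PL_iff[OF S] mem using code_closed_iff by metis
qed

end

theorem mainTheorem2:
  fixes H :: "nat sgp set"
  assumes "group_pseudovariety H"
    and "decidable_group_membership H"
  shows "decidable_pointlikes (GH H)"
proof -
  interpret pseudovar H using assms(1) by unfold_locales (simp add: group_pseudovariety_def)
  have "cpred 2 (\<lambda>ys. \<forall>c<2 ^ 2 ^ code_length (ys ! 0). code_closed H (ys ! 0) c \<longrightarrow> mem (ys ! 1) c)"
    by (intro cintro cpred_code_closed[OF assms(2)]; simp)
  then obtain p where "\<forall>ys. length ys = 2 \<longrightarrow> computes p ys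
      (if \<forall>c<2 ^ 2 ^ code_length (ys ! 0). code_closed H (ys ! 0) c \<longrightarrow> mem (ys ! 1) c then 1 else 0)"
    unfolding cpred_def cfun_def by (rule exE)
  then have p: "computes p [t, X]
      (if \<forall>c<2 ^ 2 ^ code_length t. code_closed H t c \<longrightarrow> mem X c then 1 else 0)" for t X
    by (elim allE[of _ "[t, X]"]) simp
  have "computes p [enc_table T, set_encode X] (if X \<in> PL (GH H) (table_sgp T) then 1 else 0)"
    if "semigroup_table T" "X \<subseteq> carrier (table_sgp T)" for T X
  proof -
    interpret table_instance H T using that(1) by unfold_locales
    show ?thesis using p[of t "set_encode X"] PL_code[OF that(2)] by (simp add: code_length_enc)
  qed
  then show ?thesis
    unfolding decidable_pointlikes_def decidable_on_def by (intro exI[of _ p]) auto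
qed

end
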